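(* For all $p,q,a,b,c\in\mathbb{N}$, the identity $\mathcal{S}_{G}(p,q,a,b,c;s)=\tfrac12(J_0+J_2)$ holds for $s\in\mathbb{C}$ except for singularities of the functions on both sides, where $G(\mathbf{s})=\zeta_3(\mathbf{s};SO(6))$ and $J_0,J_2$ are as defined in the context.
   Context: For $\mathbf{s}=(s_1,\dots,s_6)\in\mathbb{C}^6$, $\zeta_3(\mathbf{s};SO(6))=\sum_{l,m,n\ge1,\ l\equiv n\ (\mathrm{mod}\ 2)} \frac{1}{l^{s_1}m^{s_2}n^{s_3}(l+m)^{s_4}(m+n)^{s_5}(l+m+n)^{s_6}}$, absolutely convergent for real parts sufficiently large and meromorphically continued to $\mathbb{C}^6$. For a function $F$ of six complex variables define $\mathcal{S}_F(p,q,a,b,c;s)=F(p,q,s,a,b,c)+(-1)^pF(p,a,s,q,c,b)+(-1)^{p+a}F(q,a,c,p,s,b)+(-1)^{p+a+c}F(q,s,c,b,a,p)+(-1)^{q}F(a,q,b,p,s,c)+(-1)^{q+b}F(a,s,b,c,q,p)+(-1)^{q+a}F(a,p,b,q,c,s)+(-1)^{q+a+b}F(a,c,b,s,p,q)+(-1)^{q+a+b+c}F(s,c,p,a,b,q)+(-1)^{p+q+a}F(q,p,c,a,b,s)+(-1)^{p+q+a+c}F(q,b,c,s,p,a)+(-1)^{p+q+a+b+c}F(s,b,p,q,c,a)$. $\zeta$ is the Riemann zeta-function ($\zeta(0)=-1/2$), $\phi(s)=(2^{1-s}-1)\zeta(s)$ ($\phi(0)=-1/2$). For $p,q\in\mathbb{N}$,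 $|x|,|y|\le1$, $s>1$: $\mathfrak{T}(p,s,q;x,y)=\sum_{l\in\mathbb{Z}\setminus\{0\},\,m\ge1,\,l+m\neq0}\frac{x^ly^m}{l^pm^s(l+m)^q}$, regarded as meromorphic in $s$. $[x]$ is the integer part. For $\psi\in\{\zeta,\phi\}$ and $(u_1,u_2,u_3,u_4)$ pairs of signs, set $R(\psi;u_1,u_2,u_3,u_4)=2(-1)^{p}\sum_{j=0}^{[p/2]}\psi(2j)\sum_{\omega=0}^{p-2j}\binom{\omega+a-1}{\omega}\binom{p+c-2j-\omega-1}{c-1}\mathfrak{T}(q+a+\omega,s,p+b+c-2j-\omega;u_1) +2(-1)^{p+a}\sum_{j=0}^{[c/2]}\psi(2j)\sum_{\omega=0}^{c-2j}\binom{\omega+a-1}{\omega}\binom{p+c-2j-\omega-1}{p-1}\mathfrak{T}(q,s+a+\omega,p+b+c-2j-\omega;u_2) +2(-1)^p\sum_{j=0}^{[a/2]}\psi(2j)\sum_{\omega=0}^{p-1}\binom{\omega+a-2j}{\omega}\binom{p+c-2-\omega}{c-1}\mathfrak{T}(q+a-2j+\omega+1,s,p+b+c-1-\omega;u_3) +2(-1)^{p+a}\sum_{j=0}^{[a/2]}\psi(2j)\sum_{\omega=0}^{c-1}\binom{\omega+a-2j}{\omega}\binom{p+c-2-\omega}{p-1}\mathfrak{T}(q,s+a-2j+\omega+1,p+b+c-1-\omega;u_4)$, where $\mathfrak{T}(\cdot,\cdot,\cdot;u)$ with $u=(x,y)$ means $\mathfrak{T}(\cdot,\cdot,\cdot;x,y)$.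 Then $J_0=R(\zeta;(1,1),(1,1),(1,1),(1,1))$ and $J_2=R(\phi;(1,-1),(-1,1),(-1,-1),(-1,-1))$. *)

theory Defs
  imports "HOL-Complex_Analysis.Complex_Analysis"
begin

section \<open>Functions of several complex variables\<close>

text \<open>The sets \<open>U\<close> below are open. Compatibility of the derivative with complex scalars makes
  the real Frechet derivative a complex one.\<close>

definition holomorphic_vec_on :: "(complex ^ 'n \<Rightarrow> complex) \<Rightarrow> (complex ^ 'n) set \<Rightarrow> bool" where
  "holomorphic_vec_on f U \<longleftrightarrow>
     (\<forall>z\<in>U. \<exists>D. (f has_derivative D) (at z) \<and> (\<forall>k v. D (k *s v) = k * D v))"

definition regular_at :: "(complex ^ 'n \<Rightarrow> complex) \<Rightarrow> complex ^ 'n \<Rightarrow> bool" where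
  "regular_at f z \<longleftrightarrow> (\<exists>U. open U \<and> z \<in> U \<and> holomorphic_vec_on f U)"

text \<open>A meromorphic function is locally a quotient of holomorphic functions whose denominator does
  not vanish identically. As HOL functions are total, \<open>f\<close> also has values where the
  denominator vanishes; nothing is required of these.\<close>

definition meromorphic_vec :: "(complex ^ 'n \<Rightarrow> complex) \<Rightarrow> bool" where
  "meromorphic_vec f \<longleftrightarrow>
     (\<forall>z. \<exists>U g h. open U \<and> connected U \<and> z \<in> U \<and>
        holomorphic_vec_on g U \<and> holomorphic_vec_on h U \<and> (\<exists>w\<in>U. h w \<noteq> 0) \<and>
        (\<forall>w\<in>U. h w \<noteq> 0 \<longrightarrow> f w = g w / h w))"


section \<open>The zeta-function of SO(6)\<close>

definition SO6_index :: "(nat \<times> nat \<times> nat) set" where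
  "SO6_index = {(l, m, n). 1 \<le> l \<and> 1 \<le> m \<and> 1 \<le> n \<and> l mod 2 = n mod 2}"

definition SO6_term :: "complex ^ 6 \<Rightarrow> nat \<times> nat \<times> nat \<Rightarrow> complex" where
  "SO6_term z = (\<lambda>(l, m, n).
     1 / (of_nat l powr (z $ 1) * of_nat m powr (z $ 2) * of_nat n powr (z $ 3) *
          of_nat (l + m) powr (z $ 4) * of_nat (m + n) powr (z $ 5) *
          of_nat (l + m + n) powr (z $ 6)))"

text \<open>\<open>G\<close> is the meromorphic continuation to the whole space: it is meromorphic and is given by the
  series wherever that converges absolutely.\<close>

definition is_zeta_SO6 :: "(complex ^ 6 \<Rightarrow> complex) \<Rightarrow> bool" where
  "is_zeta_SO6 G \<longleftrightarrow> meromorphic_vec G \<and>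
     (\<forall>z. (\<lambda>i. norm (SO6_term z i)) summable_on SO6_index \<longrightarrow>
          G z = infsum (SO6_term z) SO6_index)"


section \<open>The symmetrized sum\<close>

text \<open>A pair \<open>(k, z)\<close> in the list stands for the summand \<open>(-1) ^ k * F z\<close>.\<close>

definition S_terms :: "nat \<Rightarrow> nat \<Rightarrow> nat \<Rightarrow> nat \<Rightarrow> nat \<Rightarrow> complex \<Rightarrow> (nat \<times> (complex ^ 6)) list" where
  "S_terms p q a b c s =
    (let P = of_nat p; Q = of_nat q; A = of_nat a; B = of_nat b; C = of_nat c in
     [(0,                 vector [P, Q, s, A, B, C]),
      (p,                 vector [P, A, s, Q, C, B]),
      (p + a,             vector [Q, A, C, P, s, B]),
      (p + a + c,         vector [Q, s, C, B, A, P]),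
      (q,                 vector [A, Q, B, P, s, C]),
      (q + b,             vector [A, s, B, C, Q, P]),
      (q + a,             vector [A, P, B, Q, C, s]),
      (q + a + b,         vector [A, C, B, s, P, Q]),
      (q + a + b + c,     vector [s, C, P, A, B, Q]),
      (p + q + a,         vector [Q, P, C, A, B, s]),
      (p + q + a + c,     vector [Q, B, C, s, P, A]),
      (p + q + a + b + c, vector [s, B, P, Q, C, A])])"

definition S_sum ::
  "(complex ^ 6 \<Rightarrow> complex) \<Rightarrow> nat \<Rightarrow> nat \<Rightarrow> nat \<Rightarrow> nat \<Rightarrow> nat \<Rightarrow> complex \<Rightarrow> complex" where
  "S_sum F p q a b c s = (\<Sum>(k, z)\<leftarrow>S_terms p q a b c s. (-1) ^ k * F z)"


section \<open>The functions of one variable on the right-hand side\<close>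

text \<open>The meromorphic continuation to the plane of a function given for \<open>Re s > 1\<close>. Nice
  meromorphy (removable singularities are removed, the value at a pole is 0) makes it unique as a
  total function.\<close>

definition mero_continuation :: "(complex \<Rightarrow> complex) \<Rightarrow> complex \<Rightarrow> complex" where
  "mero_continuation f =
     (THE F. F nicely_meromorphic_on UNIV \<and> (\<forall>s. Re s > 1 \<longrightarrow> F s = f s))"

definition Riemann_zeta :: "complex \<Rightarrow> complex" where
  "Riemann_zeta = mero_continuation (\<lambda>s. \<Sum>\<^sub>\<infinity>n\<in>{1::nat..}. 1 / of_nat n powr s)"

definition zeta_phi :: "complex \<Rightarrow> complex" where
  "zeta_phi s = (2 powr (1 - s) - 1) * Riemann_zeta s"

definition T_series :: "nat \<Rightarrow> complex \<Rightarrow> nat \<Rightarrow> complex \<times> complex \<Rightarrow> complex" where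
  "T_series p s q u =
     (\<Sum>\<^sub>\<infinity>(l, m)\<in>{(l::int, m::int). l \<noteq> 0 \<and> 1 \<le> m \<and> l + m \<noteq> 0}.
        fst u powi l * snd u powi m / (of_int l ^ p * of_int m powr s * of_int (l + m) ^ q))"

definition T_fun :: "nat \<Rightarrow> complex \<Rightarrow> nat \<Rightarrow> complex \<times> complex \<Rightarrow> complex" where
  "T_fun p s q u = mero_continuation (\<lambda>s. T_series p s q u) s"

text \<open>For positive \<open>p\<close>, \<open>a\<close>, \<open>c\<close> no subtraction of natural numbers below truncates.\<close>

definition R_sum ::
  "(complex \<Rightarrow> complex) \<Rightarrow> complex \<times> complex \<Rightarrow> complex \<times> complex \<Rightarrow> complex \<times> complex \<Rightarrow>
   complex \<times> complex \<Rightarrow> nat \<Rightarrow> nat \<Rightarrow> nat \<Rightarrow> nat \<Rightarrow> nat \<Rightarrow> complex \<Rightarrow> complex" where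
  "R_sum \<psi> u1 u2 u3 u4 p q a b c s =
     2 * (-1) ^ p * (\<Sum>j = 0..p div 2. \<psi> (of_nat (2 * j)) * (\<Sum>w = 0..p - 2 * j.
        of_nat ((w + a - 1) choose w) * of_nat ((p + c - 2 * j - w - 1) choose (c - 1)) *
        T_fun (q + a + w) s (p + b + c - 2 * j - w) u1))
   + 2 * (-1) ^ (p + a) * (\<Sum>j = 0..c div 2. \<psi> (of_nat (2 * j)) * (\<Sum>w = 0..c - 2 * j.
        of_nat ((w + a - 1) choose w) * of_nat ((p + c - 2 * j - w - 1) choose (p - 1)) *
        T_fun q (s + of_nat (a + w)) (p + b + c - 2 * j - w) u2))
   + 2 * (-1) ^ p * (\<Sum>j = 0..a div 2. \<psi> (of_nat (2 * j)) * (\<Sum>w = 0..p - 1.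
        of_nat ((w + a - 2 * j) choose w) * of_nat ((p + c - 2 - w) choose (c - 1)) *
        T_fun (q + a - 2 * j + w + 1) s (p + b + c - 1 - w) u3))
   + 2 * (-1) ^ (p + a) * (\<Sum>j = 0..a div 2. \<psi> (of_nat (2 * j)) * (\<Sum>w = 0..c - 1.
        of_nat ((w + a - 2 * j) choose w) * of_nat ((p + c - 2 - w) choose (p - 1)) *
        T_fun q (s + of_nat (a - 2 * j + w + 1)) (p + b + c - 1 - w) u4))"

definition J0 :: "nat \<Rightarrow> nat \<Rightarrow> nat \<Rightarrow> nat \<Rightarrow> nat \<Rightarrow> complex \<Rightarrow> complex" where
  "J0 = R_sum Riemann_zeta (1, 1) (1, 1) (1, 1) (1, 1)"

definition J2 :: "nat \<Rightarrow> nat \<Rightarrow> nat \<Rightarrow> nat \<Rightarrow> nat \<Rightarrow> complex \<Rightarrow> complex" where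
  "J2 = R_sum zeta_phi (1, -1) (-1, 1) (-1, -1) (-1, -1)"

end

theory Submission
  imports Defs
begin

text \<open>The twelve summands of the left-hand side are the sums over the twelve Weyl chambers of type \<open>A\<^sub>3\<close>
  with \<open>n > 0\<close>, rewritten in positive coordinates. Together they form the sum of
  \<open>1 / (l\<^sup>p m\<^sup>q n\<^sup>s (l + m)\<^sup>a (m + n)\<^sup>b (l + m + n)\<^sup>c)\<close> over all integers \<open>l\<close>, \<open>m\<close>, \<open>n\<close> with \<open>n > 0\<close>, no factor
  zero and \<open>l \<equiv> n\<close> modulo 2. Detecting the parity by \<open>(1 + (-1)\<^bsup>l + n\<^esup>) / 2\<close> gives the two halves \<open>J0\<close> and \<open>J2\<close>,
  which differ by the character \<open>x\<^bsup>l + n\<^esup>\<close>, \<open>x = 1\<close> or \<open>x = -1\<close>. For fixed \<open>m\<close> and \<open>n\<close> the sum over \<open>l\<close> is a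
  combination of the values \<open>\<psi>(2j)\<close> whose coefficients are Laurent coefficients of the summand at its
  three poles; the value \<open>\<psi>(0) = -1/2\<close> accounts for the omitted terms. At the middle pole a
  partial fraction decomposition with respect to \<open>m + n\<close> brings the coefficients into the form of \<open>T\<close>.

  This proves the relation for \<open>Re s > 1\<close>. Summing over \<open>l\<close> first also shows that \<open>T\<close> is a finite combination
  of shifted values of \<open>\<zeta>\<close> and of its alternating variant, hence meromorphic in \<open>s\<close>. Each summand on
  the left is the restriction of \<open>G\<close> to a complex line that contains regular points of \<open>G\<close>; such a
  restriction is meromorphic, and the identity theorem in one variable applies.\<close>

section \<open>Sums of rational functions over the integers\<close>

text \<open>No contour is integrated for the sum over \<open>l\<close>. The formula by residues is
  purely algebraic: the splitting of two linear factors by partial fractions holds in any field,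
  hence for complex numbers and for formal Laurent series alike, so both sides obey the same
  recursion and only a single pole has to be checked. The coefficients come from the expansion of pi
  cot(pi z) and of pi / sin(pi z) as -2 times the sum of psi(2j) z^(2j - 1) with psi(0) = -1/2.
  \<open>psi_const\<close> lists these values as plain series, so that this part needs no
  continuation of zeta.

  All exponents except \<open>s\<close> may equal 1, so the factors in \<open>l\<close> and
  \<open>m\<close> alone do not give absolute convergence; two linear forms at a time are paired by
  1 / |u v| <= 1 / u^2 + 1 / v^2.

  On the left, \<open>meromorphic_vec\<close> prescribes no values where a local denominator
  vanishes. Continuity of \<open>G\<close> is therefore taken from the series where all real parts
  exceed 5/6, a region that contains exponents equal to 1, and near \<open>s\<close> from the
  assumed regularity.\<close>

definition psi_const :: "complex \<Rightarrow> nat \<Rightarrow> complex" where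
  "psi_const x j = (if j = 0 then -1/2 else (\<Sum>n. x ^ Suc n / of_nat (Suc n) ^ (2 * j)))"

section \<open>Symmetric partial sums of single powers\<close>

lemma sum_symmetric_int:
  fixes g :: "int \<Rightarrow> 'a::ab_group_add"
  shows "(\<Sum>r\<in>{- int N..int N}. g r) = g 0 + (\<Sum>n<N. g (int (Suc n)) + g (- int (Suc n)))"
proof (induction N)
  case (Suc N)
  have "{- int (Suc N)..int (Suc N)} = insert (int (Suc N)) (insert (- int (Suc N)) {- int N..int N})"
    by auto
  then show ?case using Suc by (simp add: algebra_simps)
qed auto

lemma powi_sign:
  fixes x :: complex
  assumes "x = 1 \<or> x = -1"
  shows "x \<noteq> 0" "x powi (- k) = x powi k" "x powi k * x powi k = 1" "norm (x powi k) = 1"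
proof -
  show "x \<noteq> 0" "norm (x powi k) = 1" using assms by (auto simp: norm_power_int)
  show *: "x powi (- k) = x powi k"
    using assms by (auto simp: power_int_minus_left)
  show "x powi k * x powi k = 1"
    using * \<open>x \<noteq> 0\<close> by (metis power_int_minus right_inverse power_int_eq_0_iff)
qed

text \<open>Opposite indices cancel for odd \<open>i\<close> and double for even \<open>i\<close>.
  The index 0 is harmless because division by zero gives 0. For \<open>i = 1\<close> there is no
  absolute convergence, hence the symmetric intervals.\<close>

lemma sym_power_sum_0:
  fixes x :: complex
  assumes x: "x = 1 \<or> x = -1" and i: "i \<ge> 1"
  shows "(\<lambda>N::nat. \<Sum>r\<in>{- int N..int N}. x powi r / of_int r ^ i) \<longlonglongrightarrow>
           (if even i then 2 * psi_const x (i div 2) else 0)"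
proof (cases "even i")
  case False
  have "(\<Sum>r\<in>{- int N..int N}. x powi r / of_int r ^ i) = 0" for N
  proof -
    have "x powi int (Suc n) / of_int (int (Suc n)) ^ i + x powi (- int (Suc n)) / of_int (- int (Suc n)) ^ i = 0" for n
      using False powi_sign(2)[OF x] by (simp add: power_minus_odd del: of_nat_Suc)
    then show ?thesis using i
      unfolding sum_symmetric_int by (simp add: del: of_nat_Suc)
  qed
  then show ?thesis using False by simp
next
  case True
  then obtain j where j: "i = 2 * j" by blast
  have j1: "j \<ge> 1" using i j by simp
  have "summable (\<lambda>n. norm (x ^ Suc n / of_nat (Suc n) ^ (2 * j)))"
  proof -
    have "norm (x ^ Suc n / of_nat (Suc n) ^ (2 * j)) = 1 / real (Suc n) ^ (2 * j)" for n
      using x by (auto simp: norm_divide norm_power norm_mult simp del: of_nat_Suc)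
    moreover have "summable (\<lambda>n. 1 / real (Suc n) ^ (2 * j))"
      using inverse_power_summable[of "2 * j", where 'a=real] j1
      by (subst summable_Suc_iff) (auto simp: inverse_eq_divide)
    ultimately show ?thesis by simp
  qed
  then have "(\<lambda>n. x ^ Suc n / of_nat (Suc n) ^ (2 * j)) sums psi_const x j"
    using j1 unfolding psi_const_def by (simp add: summable_norm_cancel summable_sums)
  then have "(\<lambda>n. 2 * (x ^ Suc n / of_nat (Suc n) ^ (2 * j))) sums (2 * psi_const x j)"
    by (rule sums_mult)
  then have lim: "(\<lambda>N. \<Sum>n<N. 2 * (x ^ Suc n / of_nat (Suc n) ^ (2 * j))) \<longlonglongrightarrow> 2 * psi_const x j"
    by (simp add: sums_def)
  have "(\<Sum>r\<in>{- int N..int N}. x powi r / of_int r ^ i) =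
        (\<Sum>n<N. 2 * (x ^ Suc n / of_nat (Suc n) ^ (2 * j)))" for N
  proof -
    have "x powi int (Suc n) / of_int (int (Suc n)) ^ i + x powi (- int (Suc n)) / of_int (- int (Suc n)) ^ i
       = 2 * (x ^ Suc n / of_nat (Suc n) ^ (2 * j))" for n
      using powi_sign(2)[OF x] j unfolding power_int_of_nat
      by (simp add: power_minus_even power_int_of_nat  del: of_nat_Suc)
    then show ?thesis using i
      unfolding sum_symmetric_int by (simp add: del: of_nat_Suc power_Suc)
  qed
  then show ?thesis using lim j by simp
qed

text \<open>Disposes of the boundary terms of a summation window: \<open>b\<close> selects the right
  or the left end and \<open>c\<close> its offset.\<close>

lemma inverse_linear_power_tendsto_0:
  fixes x :: complex and f :: "nat \<Rightarrow> int"
  assumes "i \<ge> 1" "b = 1 \<or> b = -1" and x: "x = 1 \<or> x = -1"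
  shows "(\<lambda>N::nat. x powi (f N) / of_int (b * int N + c) ^ i) \<longlonglongrightarrow> 0"
proof (rule Lim_null_comparison)
  have "eventually (\<lambda>N::nat. N \<ge> 1 + nat \<bar>c\<bar>) sequentially" by (rule eventually_ge_at_top)
  then show "eventually (\<lambda>N. norm (x powi (f N) / of_int (b * int N + c) ^ i) \<le> 1 / (real N - \<bar>real_of_int c\<bar>)) sequentially"
  proof eventually_elim
    case (elim N)
    have ge1: "real N - \<bar>real_of_int c\<bar> \<ge> 1" using elim by linarith
    have "real N - \<bar>real_of_int c\<bar> \<le> \<bar>real_of_int (b * int N + c)\<bar>"
      using assms(2) by (auto split: abs_split)
    also have "\<dots> = norm (of_int (b * int N + c) :: complex)" by (simp only: norm_of_int)
    finally have le: "real N - \<bar>real_of_int c\<bar> \<le> norm (of_int (b * int N + c) :: complex)" .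
    have "norm (of_int (b * int N + c) :: complex) ^ 1 \<le> norm (of_int (b * int N + c) :: complex) ^ i"
      using le ge1 assms(1) by (intro power_increasing) linarith+
    then have "real N - \<bar>real_of_int c\<bar> \<le> norm (of_int (b * int N + c) :: complex) ^ i" using le by simp
    then have "1 / norm (of_int (b * int N + c) :: complex) ^ i \<le> 1 / (real N - \<bar>real_of_int c\<bar>)"
      using ge1 by (intro divide_left_mono mult_pos_pos) linarith+
    then show ?case using powi_sign(4)[OF x] by (simp add: norm_divide norm_power)
  qed
  show "(\<lambda>N. 1 / (real N - \<bar>real_of_int c\<bar>)) \<longlonglongrightarrow> 0"
    by real_asymp
qed

text \<open>Moving the window by one adds a term on the left and drops one on the right; both tend
  to 0. The equivalence serves the upward and the downward step of the induction over the integers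
  in \<open>sym_power_sum_shift\<close>.\<close>

lemma sym_power_sum_shift_step:
  fixes x :: complex and e :: int
  assumes x: "x = 1 \<or> x = -1" and i: "i \<ge> 1"
  shows "((\<lambda>N::nat. \<Sum>r\<in>{- int N - e..int N - e}. x powi r / of_int r ^ i) \<longlonglongrightarrow> L) \<longleftrightarrow>
         ((\<lambda>N::nat. \<Sum>r\<in>{- int N - (e+1)..int N - (e+1)}. x powi r / of_int r ^ i) \<longlonglongrightarrow> L)"
    (is "(?A \<longlonglongrightarrow> L) \<longleftrightarrow> (?B \<longlonglongrightarrow> L)")
proof -
  define g where "g = (\<lambda>r::int. x powi r / of_int r ^ i)"
  have "?B N = ?A N + (g (- int N - e - 1) - g (int N - e))" for N
  proof -
    have "{- int N - (e+1)..int N - (e+1)} = insert (- int N - e - 1) ({- int N - e..int N - e} - {int N - e})"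
      by auto
    then have "sum g {- int N - (e+1)..int N - (e+1)} = g (- int N - e - 1) + sum g ({- int N - e..int N - e} - {int N - e})"
      by simp
    also have "sum g ({- int N - e..int N - e} - {int N - e}) = sum g {- int N - e..int N - e} - g (int N - e)"
      by (subst sum_diff1) auto
    finally show ?thesis unfolding g_def by simp
  qed
  then have *: "?B = (\<lambda>N. ?A N + (g (- int N - e - 1) - g (int N - e)))" by blast
  have "(\<lambda>N. g (- int N - e - 1)) \<longlonglongrightarrow> 0"
  proof -
    have "- int N - e - 1 = -1 * int N + (- e - 1)" for N by simp
    then show ?thesis
      using inverse_linear_power_tendsto_0[OF i _ x, of "-1" "\<lambda>N. - int N - e - 1" "- e - 1"]
      unfolding g_def by presburger
  qed
  moreover have "(\<lambda>N. g (int N - e)) \<longlonglongrightarrow> 0"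
    using inverse_linear_power_tendsto_0[OF i _ x, of "1" "\<lambda>N. int N - e" "- e"] unfolding g_def by simp
  ultimately have lim0: "(\<lambda>N. g (- int N - e - 1) - g (int N - e)) \<longlonglongrightarrow> 0"
    using tendsto_diff by fastforce
  show ?thesis
  proof
    assume "?A \<longlonglongrightarrow> L" then show "?B \<longlonglongrightarrow> L"
      unfolding * using tendsto_add[OF _ lim0, of ?A L] by simp
  next
    assume "?B \<longlonglongrightarrow> L" then show "?A \<longlonglongrightarrow> L"
      unfolding * using tendsto_diff[OF _ lim0, of "\<lambda>N. ?A N + (g (- int N - e - 1) - g (int N - e))" L] by simp
  qed
qed

lemma sym_power_sum_shift:
  fixes x :: complex and e :: int
  assumes x: "x = 1 \<or> x = -1" and i: "i \<ge> 1"
  shows "(\<lambda>N::nat. \<Sum>r\<in>{- int N - e..int N - e}. x powi r / of_int r ^ i) \<longlonglongrightarrow>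
           (if even i then 2 * psi_const x (i div 2) else 0)"
proof (induction e rule: int_induct[where k = 0])
  case base
  then show ?case using sym_power_sum_0[OF assms] by simp
next
  case (step1 e)
  then show ?case using sym_power_sum_shift_step[OF assms] by blast
next
  case (step2 e)
  then show ?case using sym_power_sum_shift_step[OF assms, of "e - 1"] by simp
qed

lemma sym_power_sum:
  fixes x :: complex and e :: int
  assumes x: "x = 1 \<or> x = -1" and i: "i \<ge> 1"
  shows "(\<lambda>N::nat. \<Sum>l\<in>{- int N..int N}. x powi l / of_int (l - e) ^ i) \<longlonglongrightarrow>
           x powi e * (if even i then 2 * psi_const x (i div 2) else 0)"
proof -
  have "(\<Sum>l\<in>{- int N..int N}. x powi l / of_int (l - e) ^ i) =
        x powi e * (\<Sum>r\<in>{- int N - e..int N - e}. x powi r / of_int r ^ i)" for N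
    unfolding sum_distrib_left
    by (rule sum.reindex_bij_witness[of _ "\<lambda>r. r + e" "\<lambda>l. l - e"])
       (use powi_sign(1)[OF x] in \<open>auto simp: power_int_diff\<close>)
  then show ?thesis
    using tendsto_mult_left[OF sym_power_sum_shift[OF assms, of e], of "x powi e"] by simp
qed

text \<open>Minus the residue at 0 of pi cot(pi z) F(z) for \<open>x = 1\<close>, and of pi F(z) /
  sin(pi z) for \<open>x = -1\<close>: the kernels expand as -2 times the sum of psi(2j) z^(2j - 1).
  The sign is that of the residue theorem, where the lattice sum away from the poles of F is minus
  the sum of the residues there. The cut-off \<open>M\<close> loses nothing when the pole order is
  at most \<open>2 * M\<close>.\<close>

definition principal_functional :: "complex \<Rightarrow> nat \<Rightarrow> complex fls \<Rightarrow> complex" where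
  "principal_functional x M F = 2 * (\<Sum>j\<le>M. psi_const x j * fls_nth F (- int (2 * j)))"

lemma principal_functional_diff_const:
  "principal_functional x M (fls_const c * (F - G)) =
     c * (principal_functional x M F - principal_functional x M G)"
  unfolding principal_functional_def
  by (simp add: sum_subtractf sum_distrib_left algebra_simps)

lemma inverse_powers_partial_fraction_step:
  fixes u v :: "'a::field"
  assumes "u \<noteq> 0" "v \<noteq> 0" "v - u = d" "d \<noteq> 0"
  shows "inverse (u ^ Suc i) * inverse (v ^ Suc j) =
     inverse d * (inverse (u ^ Suc i) * inverse (v ^ j) - inverse (u ^ i) * inverse (v ^ Suc j))"
proof -
  have "inverse u * inverse v = inverse d * (inverse u - inverse v)"
    using assms by (auto simp: field_simps)
  then have "inverse (u ^ i) * inverse (v ^ j) * (inverse u * inverse v) =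
     inverse (u ^ i) * inverse (v ^ j) * (inverse d * (inverse u - inverse v))" by simp
  then show ?thesis by (simp add: algebra_simps)
qed

text \<open>The Laurent expansion at \<open>e\<close> of the product of (z - d)^(-k d) over
  \<open>E\<close>, with X = z - e. Multiplicities may be 0.\<close>

definition shift_prod :: "(int \<Rightarrow> nat) \<Rightarrow> int set \<Rightarrow> int \<Rightarrow> complex fls" where
  "shift_prod k E e = (\<Prod>d\<in>E. inverse ((fls_X + fls_const (of_int (e - d))) ^ k d))"

lemma prod_remove2:
  assumes "finite E" "e \<in> E" "e' \<in> E" "e \<noteq> e'"
  shows "prod g E = prod g (E - {e, e'}) * (g e * g e')"
proof -
  have "prod g E = prod g (insert e (insert e' (E - {e, e'})))"
    by (rule arg_cong[of _ _ "prod g"]) (use assms in auto)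
  also have "\<dots> = g e * (g e' * prod g (E - {e, e'}))"
    by (subst prod.insert, use assms in simp, use assms in simp, subst prod.insert, use assms in auto)
  finally show ?thesis by (simp add: ac_simps)
qed

text \<open>From 1 / (u v) = (1 / u - 1 / v) / (v - u), applied to two of the factors. It is stated
  over an arbitrary field because it is needed for the summands, which are complex numbers, and for
  their Laurent expansions.\<close>

lemma prod_partial_fraction_step:
  fixes h :: "int \<Rightarrow> 'a::field"
  assumes E: "finite E" "e \<in> E" "e' \<in> E" "e \<noteq> e'" and k: "k e > 0" "k e' > 0"
    and h: "h e \<noteq> 0" "h e' \<noteq> 0" "h e' - h e = d" "d \<noteq> 0"
  shows "(\<Prod>y\<in>E. inverse (h y ^ k y)) = inverse d *
           ((\<Prod>y\<in>E. inverse (h y ^ (k(e' := k e' - 1)) y)) -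
            (\<Prod>y\<in>E. inverse (h y ^ (k(e := k e - 1)) y)))"
proof -
  obtain i j where ij: "k e = Suc i" "k e' = Suc j"
    using k by (metis gr0_implies_Suc)
  define A where "A = (\<Prod>y\<in>E - {e, e'}. inverse (h y ^ k y))"
  have 1: "(\<Prod>y\<in>E. inverse (h y ^ k y)) = A * (inverse (h e ^ Suc i) * inverse (h e' ^ Suc j))"
    unfolding A_def by (subst prod_remove2[OF E]) (simp add: ij)
  have 2: "(\<Prod>y\<in>E. inverse (h y ^ (k(e' := k e' - 1)) y)) = A * (inverse (h e ^ Suc i) * inverse (h e' ^ j))"
    unfolding A_def by (subst prod_remove2[OF E]) (use E in \<open>auto simp: ij intro!: prod.cong\<close>)
  have 3: "(\<Prod>y\<in>E. inverse (h y ^ (k(e := k e - 1)) y)) = A * (inverse (h e ^ i) * inverse (h e' ^ Suc j))"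
    unfolding A_def by (subst prod_remove2[OF E]) (use E in \<open>auto simp: ij intro!: prod.cong\<close>)
  show ?thesis unfolding 1 2 3
    by (subst inverse_powers_partial_fraction_step[OF h]) (simp add: algebra_simps)
qed

lemma fls_X_plus_const_neq_0 [simp]: "fls_X + fls_const (c::complex) \<noteq> 0"
proof
  assume "fls_X + fls_const c = 0"
  then have "fls_nth (fls_X + fls_const c) 1 = 0" by (metis fls_zero_nth)
  then show False by simp
qed

text \<open>The binomial series: the coefficient of X^n in (X + u)^(-a). For \<open>a = 0\<close>
  the truncated subtraction still gives 1 at \<open>n = 0\<close> and 0 elsewhere.\<close>

definition linear_coeff :: "nat \<Rightarrow> complex \<Rightarrow> nat \<Rightarrow> complex" where
  "linear_coeff a u n = (-1) ^ n * of_nat ((n + a - 1) choose n) / u ^ (a + n)"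

lemma inverse_linear_power_fls:
  assumes u: "u \<noteq> (0::complex)"
  shows "inverse ((fls_X + fls_const u) ^ a) = fps_to_fls (Abs_fps (linear_coeff a u))"
proof -
  have "fls_X + fls_const u = fps_to_fls (fps_X + fps_const u)"
    by (simp add: fps_to_fls_plus)
  then have "inverse ((fls_X + fls_const u) ^ a) = inverse (fps_to_fls ((fps_X + fps_const u) ^ a))"
    by (simp add: fps_to_fls_power)
  also have "\<dots> = fps_to_fls (inverse ((fps_X + fps_const u) ^ a))"
    by (rule fls_inverse_fps_to_fls) (use assms in \<open>simp add: subdegree_eq_0_iff\<close>)
  also have "inverse ((fps_X + fps_const u) ^ a) = Abs_fps (linear_coeff a u)"
  proof (cases "a = 0")
    case True
    show ?thesis using True
      by (auto simp: fps_eq_iff linear_coeff_def fps_one_nth)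
  next
    case False
    have "fps_X + fps_const u = fps_const u * (1 - fps_const (- inverse u) * fps_X)"
      using u by (simp add: algebra_simps flip: mult.assoc)
    then have "inverse ((fps_X + fps_const u) ^ a) =
       inverse (fps_const (u ^ a)) * inverse ((1 - fps_const (- inverse u) * fps_X) ^ a)"
      by (simp only: power_mult_distrib fps_inverse_mult fps_const_power)
    also have "\<dots> = fps_const (inverse (u ^ a)) * Abs_fps (\<lambda>k. of_nat (a + k - 1 choose k) * (- inverse u) ^ k)"
      using False u by (subst one_minus_const_fps_X_neg_power') (auto simp: fps_const_inverse)
    also have "\<dots> = Abs_fps (linear_coeff a u)"
    proof -
      have "(- inverse u) ^ k = (-1) ^ k / u ^ k" for k
        by (subst power_minus) (simp add: power_inverse divide_inverse)
      then show ?thesis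
        by (simp add: fps_eq_iff linear_coeff_def power_add divide_inverse add_ac mult_ac)
    qed
    finally show ?thesis .
  qed
  finally show ?thesis .
qed

lemma fls_nth_inverse_linear_nonpos:
  assumes "u \<noteq> (0::complex)" and "n \<le> 0"
  shows "fls_nth (inverse ((fls_X + fls_const u) ^ i)) n = (if n = 0 then inverse (u ^ i) else 0)"
  using assms(2) unfolding inverse_linear_power_fls[OF assms(1)] by (simp add: linear_coeff_def divide_inverse)

text \<open>The base case: only \<open>d\<close> carries a pole. The other points of
  \<open>E\<close> have multiplicity 0 but are left out of the sum all the same, and psi(0) = -1/2
  subtracts exactly the values of the summand there.\<close>

lemma lattice_partial_fraction_single:
  fixes x :: complex
  assumes x: "x = 1 \<or> x = -1" and E: "finite E" "d \<in> E" and i: "i \<ge> 1" "i \<le> 2 * M"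
    and k: "\<And>y. y \<in> E \<Longrightarrow> k y = (if y = d then i else 0)"
  shows "(\<lambda>N::nat. \<Sum>l\<in>{- int N..int N} - E. x powi l * (\<Prod>y\<in>E. inverse (of_int (l - y) ^ k y)))
           \<longlonglongrightarrow> (\<Sum>e\<in>E. x powi e * principal_functional x M (shift_prod k E e))"
proof -
  define g where "g = (\<lambda>l. x powi l / of_int (l - d) ^ i)"
  have prodeq: "(\<Prod>y\<in>E. inverse (h y ^ k y)) = inverse (h d ^ i)" for h :: "int \<Rightarrow> 'b::field"
  proof -
    have "(\<Prod>y\<in>E. inverse (h y ^ k y)) = inverse (h d ^ k d) * (\<Prod>y\<in>E-{d}. inverse (h y ^ k y))"
      by (rule prod.remove) (use E in auto)
    also have "(\<Prod>y\<in>E-{d}. inverse (h y ^ k y)) = 1"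
      by (rule prod.neutral) (use k in auto)
    finally show ?thesis using k[OF E(2)] by simp
  qed
  \<comment> \<open>For such \<open>N\<close> the window contains \<open>E\<close>, so leaving out
    \<open>E\<close> subtracts all of \<open>sum g E\<close>.\<close>
  have "eventually (\<lambda>N::nat. N \<ge> nat (Max (abs ` E))) sequentially" by (rule eventually_ge_at_top)
  then have ev: "eventually (\<lambda>N::nat. (\<Sum>l\<in>{- int N..int N}. g l) - sum g E =
       (\<Sum>l\<in>{- int N..int N} - E. x powi l * (\<Prod>y\<in>E. inverse (of_int (l - y) ^ k y)))) sequentially"
  proof eventually_elim
    case (elim N)
    have bnd: "\<bar>y\<bar> \<le> int N" if "y \<in> E" for y
    proof -
      have "\<bar>y\<bar> \<le> Max (abs ` E)" using E that by (intro Max_ge) auto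
      then show ?thesis using elim by linarith
    qed
    have "E \<subseteq> {- int N..int N}"
    proof
      fix y assume "y \<in> E"
      then have "\<bar>y\<bar> \<le> int N" by (rule bnd)
      then show "y \<in> {- int N..int N}" unfolding atLeastAtMost_iff by linarith
    qed
    then have "sum g ({- int N..int N} - E) = sum g {- int N..int N} - sum g E"
      by (intro sum_diff) auto
    then show ?case unfolding prodeq g_def divide_inverse by (simp only:)
  qed
  have lim: "(\<lambda>N::nat. (\<Sum>l\<in>{- int N..int N}. g l) - sum g E) \<longlonglongrightarrow>
           x powi d * (if even i then 2 * psi_const x (i div 2) else 0) - sum g E"
    unfolding g_def by (intro tendsto_diff sym_power_sum x i tendsto_const)
  have "(\<Sum>e\<in>E. x powi e * principal_functional x M (shift_prod k E e)) =
     (\<Sum>e\<in>E. (if e = d then x powi d * (if even i then 2 * psi_const x (i div 2) else 0) else 0) - g e)"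
  proof (rule sum.cong[OF refl])
    fix e assume e: "e \<in> E"
    have F: "shift_prod k E e = inverse ((fls_X + fls_const (of_int (e - d))) ^ i)"
      unfolding shift_prod_def by (rule prodeq)
    show "x powi e * principal_functional x M (shift_prod k E e) =
      (if e = d then x powi d * (if even i then 2 * psi_const x (i div 2) else 0) else 0) - g e"
    proof (cases "e = d")
      case True
      have *: "fls_nth (inverse (fls_X ^ i)) n = (if n = - int i then 1 else (0::complex))" for n
        by (simp add: fls_inverse_X_power eq_commute)
      have "(\<Sum>j\<le>M. psi_const x j * (if - int (2 * j) = - int i then 1 else 0)) =
         (\<Sum>j\<le>M. if even i \<and> j = i div 2 then psi_const x j else 0)"
      proof (rule sum.cong[OF refl])
        fix j
        have "- int (2 * j) = - int i \<longleftrightarrow> even i \<and> j = i div 2" by presburger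
        then show "psi_const x j * (if - int (2 * j) = - int i then 1 else 0) =
          (if even i \<and> j = i div 2 then psi_const x j else 0)" by simp
      qed
      also have "\<dots> = (if even i then psi_const x (i div 2) else 0)"
        using i by (cases "even i") auto
      finally have sum_eq: "(\<Sum>j\<le>M. psi_const x j * (if - int (2 * j) = - int i then 1 else 0)) =
         (if even i then psi_const x (i div 2) else 0)" .
      have "shift_prod k E e = inverse (fls_X ^ i)" unfolding F using True by simp
      then have "principal_functional x M (shift_prod k E e) = 2 * (if even i then psi_const x (i div 2) else 0)"
        unfolding principal_functional_def by (simp only: * sum_eq)
      \<comment> \<open>Leaving out the pole itself changes nothing, since there \<open>g\<close>
        takes the value 1 / 0 = 0.\<close>
      moreover have "g e = 0" using True i by (simp add: g_def)
      ultimately show ?thesis using True by simp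
    next
      case False
      \<comment> \<open>Away from the pole the expansion has no negative powers, so only its
        constant term is seen, with factor 2 * (-1/2).\<close>
      have "(\<Sum>j\<le>M. psi_const x j * fls_nth (shift_prod k E e) (- int (2 * j))) =
        (\<Sum>j\<le>M. if j = 0 then psi_const x 0 * inverse (of_int (e - d) ^ i) else 0)"
        unfolding F using False by (intro sum.cong refl) (subst fls_nth_inverse_linear_nonpos; auto)
      also have "\<dots> = - (inverse (of_int (e - d) ^ i) / 2)" by (simp add: psi_const_def)
      finally have "principal_functional x M (shift_prod k E e) = - inverse (of_int (e - d) ^ i)"
        unfolding principal_functional_def by simp
      then show ?thesis using False by (simp add: g_def divide_inverse)
    qed
  qed
  also have "\<dots> = x powi d * (if even i then 2 * psi_const x (i div 2) else 0) - sum g E"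
    using E by (simp add: sum_subtractf)
  finally show ?thesis using Lim_transform_eventually[OF lim ev] by simp
qed

text \<open>The residues of \<open>\<pi> cot (\<pi> z) f(z)\<close> (or \<open>\<pi> f(z) / sin (\<pi> z)\<close>) at the poles of the rational function
  \<open>f\<close>, written with the Laurent coefficients of \<open>f\<close>.\<close>

lemma lattice_partial_fraction:
  fixes x :: complex
  assumes x: "x = 1 \<or> x = -1" and E: "finite E" and k: "1 \<le> sum k E" "sum k E \<le> 2 * M"
  shows "(\<lambda>N::nat. \<Sum>l\<in>{- int N..int N} - E. x powi l * (\<Prod>y\<in>E. inverse (of_int (l - y) ^ k y)))
           \<longlonglongrightarrow> (\<Sum>e\<in>E. x powi e * principal_functional x M (shift_prod k E e))"
  using k
\<comment> \<open>While two points have positive multiplicity, one partial fraction step lowers the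
  total by one in both resulting terms. \<open>E\<close> stays fixed: a point whose multiplicity has
  dropped to 0 remains excluded from the sum.\<close>
proof (induction "sum k E" arbitrary: k rule: less_induct)
  case less
  show ?case
  proof (cases "\<exists>e\<in>E. \<exists>e'\<in>E. e \<noteq> e' \<and> k e > 0 \<and> k e' > 0")
    case False
    obtain d where d: "d \<in> E" "k d > 0" using less.prems E
      by (metis One_nat_def Suc_le_lessD sum_eq_0_iff bot_nat_0.not_eq_extremum)
    have 0: "k y = (if y = d then k d else 0)" if "y \<in> E" for y
      using False d that by (metis bot_nat_0.not_eq_extremum)
    have "k d \<le> 2 * M" using less.prems E d member_le_sum[of d E k] by simp
    moreover have "1 \<le> k d" using d by simp
    ultimately show ?thesis
      by (intro lattice_partial_fraction_single[OF x E d(1), of "k d"] 0)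
  next
    case True
    then obtain e e' where e: "e \<in> E" "e' \<in> E" "e \<noteq> e'" "k e > 0" "k e' > 0" by blast
    define k1 where "k1 = k(e' := k e' - 1)"
    define k2 where "k2 = k(e := k e - 1)"
    define D where "D = (of_int (e - e') :: complex)"
    have D: "D \<noteq> 0" using e by (simp add: D_def)
    \<comment> \<open>Two distinct points of positive multiplicity give a total of at least 2, so
      the lowered total still meets the lower bound 1 of the induction hypothesis.\<close>
    have dec: "sum (k(a := k a - 1)) E = sum k E - 1" "sum k E \<ge> 2" if a: "a \<in> {e, e'}" for a
    proof -
      have "k e + k e' = sum k {e, e'}" using e by simp
      also have "\<dots> \<le> sum k E" using e E by (intro sum_mono2) auto
      finally show "sum k E \<ge> 2" using e by linarith
      have "a \<in> E" using a e by auto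
      then have "sum k E = k a + sum k (E - {a})" "sum (k(a := k a - 1)) E = (k a - 1) + sum (k(a := k a - 1)) (E - {a})"
        using sum.remove[OF E \<open>a \<in> E\<close>, of k] sum.remove[OF E \<open>a \<in> E\<close>, of "k(a := k a - 1)"] by simp_all
      moreover have "sum (k(a := k a - 1)) (E - {a}) = sum k (E - {a})" by (rule sum.cong) auto
      moreover have "k a > 0" using a e by auto
      ultimately show "sum (k(a := k a - 1)) E = sum k E - 1" by linarith
    qed
    have IH: "(\<lambda>N::nat. \<Sum>l\<in>{- int N..int N} - E. x powi l * (\<Prod>y\<in>E. inverse (of_int (l - y) ^ k' y)))
           \<longlonglongrightarrow> (\<Sum>e\<in>E. x powi e * principal_functional x M (shift_prod k' E e))"
      if "k' = k1 \<or> k' = k2" for k'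
    proof (rule less.hyps)
      show "sum k' E < sum k E" "1 \<le> sum k' E" "sum k' E \<le> 2 * M"
        using that dec[of e] dec[of e'] less.prems unfolding k1_def k2_def by auto
    qed
    have 1: "(\<Sum>l\<in>{- int N..int N} - E. x powi l * (\<Prod>y\<in>E. inverse (of_int (l - y) ^ k y))) =
       inverse D * ((\<Sum>l\<in>{- int N..int N} - E. x powi l * (\<Prod>y\<in>E. inverse (of_int (l - y) ^ k1 y))) -
                    (\<Sum>l\<in>{- int N..int N} - E. x powi l * (\<Prod>y\<in>E. inverse (of_int (l - y) ^ k2 y))))" for N
      unfolding sum_subtractf[symmetric] sum_distrib_left
    proof (rule sum.cong[OF refl])
      fix l assume l: "l \<in> {- int N..int N} - E"
      have "(\<Prod>y\<in>E. inverse ((of_int (l - y) :: complex) ^ k y)) = inverse D *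
           ((\<Prod>y\<in>E. inverse (of_int (l - y) ^ k1 y)) - (\<Prod>y\<in>E. inverse (of_int (l - y) ^ k2 y)))"
        unfolding k1_def k2_def
        by (rule prod_partial_fraction_step) (use E e D l in \<open>auto simp: D_def\<close>)
      then show "x powi l * (\<Prod>y\<in>E. inverse (of_int (l - y) ^ k y)) =
         inverse D * (x powi l * (\<Prod>y\<in>E. inverse (of_int (l - y) ^ k1 y)) -
                      x powi l * (\<Prod>y\<in>E. inverse (of_int (l - y) ^ k2 y)))"
        by (simp only: right_diff_distrib mult.left_commute)
    qed
    \<comment> \<open>The same step in the field of Laurent series: the difference of two linear
      factors is the constant \<open>D\<close>, whatever the centre \<open>f\<close> of the
      expansion.\<close>
    have 2: "shift_prod k E f = fls_const (inverse D) * (shift_prod k1 E f - shift_prod k2 E f)" for f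
    proof -
      have "shift_prod k E f = inverse (fls_const D) * (shift_prod k1 E f - shift_prod k2 E f)"
        unfolding shift_prod_def k1_def k2_def
      proof (rule prod_partial_fraction_step)
        show "fls_X + fls_const (of_int (f - e')) - (fls_X + fls_const (of_int (f - e))) = fls_const D"
          unfolding D_def by (simp add: fls_minus_const)
      qed (use E e D in auto)
      then show ?thesis by (simp add: fls_inverse_const)
    qed
    have 3: "(\<Sum>f\<in>E. x powi f * principal_functional x M (shift_prod k E f)) =
       inverse D * ((\<Sum>f\<in>E. x powi f * principal_functional x M (shift_prod k1 E f)) -
                    (\<Sum>f\<in>E. x powi f * principal_functional x M (shift_prod k2 E f)))"
      unfolding 2 principal_functional_diff_const sum_subtractf[symmetric] sum_distrib_left
      by (rule sum.cong) (auto simp: algebra_simps)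
    show ?thesis unfolding 1 3
      by (intro tendsto_mult_left tendsto_diff IH) auto
  qed
qed

section \<open>Laurent coefficients at a pole with one or two further factors\<close>

lemma principal_functional_fps:
  assumes "p \<le> 2 * M"
  shows "principal_functional x M (inverse (fls_X ^ p) * fps_to_fls f) =
           2 * (\<Sum>j = 0..p div 2. psi_const x j * fps_nth f (p - 2 * j))"
proof -
  have "fls_nth (inverse (fls_X ^ p) * fps_to_fls f) (- int (2 * j)) =
      (if 2 * j \<le> p then fps_nth f (p - 2 * j) else 0)" for j
    by (auto simp: fls_inverse_X_power fls_X_inv_power_times_conv_shift nat_diff_distrib nat_mult_distrib)
  then have "principal_functional x M (inverse (fls_X ^ p) * fps_to_fls f) =
     2 * (\<Sum>j\<le>M. if 2 * j \<le> p then psi_const x j * fps_nth f (p - 2 * j) else 0)"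
    unfolding principal_functional_def by (auto intro!: sum.cong)
  also have "(\<Sum>j\<le>M. if 2 * j \<le> p then psi_const x j * fps_nth f (p - 2 * j) else 0) =
     (\<Sum>j = 0..p div 2. psi_const x j * fps_nth f (p - 2 * j))"
    by (rule sum.mono_neutral_cong_right) (use assms in auto)
  finally show ?thesis .
qed

lemma principal_functional_sum:
  "principal_functional x M (\<Sum>i\<in>I. fls_const (c i) * F i) = (\<Sum>i\<in>I. c i * principal_functional x M (F i))"
proof -
  have "principal_functional x M (\<Sum>i\<in>I. fls_const (c i) * F i) =
     2 * (\<Sum>j\<le>M. \<Sum>i\<in>I. c i * (psi_const x j * fls_nth (F i) (- int (2 * j))))"
    unfolding principal_functional_def
    by (simp add: fls_nth_sum sum_distrib_left mult_ac)
  also have "\<dots> = (\<Sum>i\<in>I. c i * principal_functional x M (F i))"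
    unfolding principal_functional_def by (subst sum.swap) (simp add: sum_distrib_left mult_ac)
  finally show ?thesis .
qed

lemma principal_functional_add:
  "principal_functional x M (F + G) = principal_functional x M F + principal_functional x M G"
  unfolding principal_functional_def by (simp add: sum.distrib algebra_simps)

text \<open>For v = u + d and D = 1 / d, the coefficient of u^(-(w + 1)) in the partial fraction
  decomposition of u^(-p) v^(-c); \<open>pf_right\<close> is the coefficient of v^(-(w + 1)). If
  \<open>c = 0\<close>, or \<open>p = 0\<close> for \<open>pf_right\<close>, the truncated
  subtractions leave only the top coefficient, with value 1. The type is a general field so that
  \<open>u\<close> and \<open>v\<close> can be Laurent series.\<close>

definition pf_left :: "'a::field \<Rightarrow> nat \<Rightarrow> nat \<Rightarrow> nat \<Rightarrow> 'a" where
  "pf_left D p c w = (-1) ^ (p - 1 - w) * of_nat ((p + c - 2 - w) choose (p - 1 - w)) * D ^ (p + c - 1 - w)"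

definition pf_right :: "'a::field \<Rightarrow> nat \<Rightarrow> nat \<Rightarrow> nat \<Rightarrow> 'a" where
  "pf_right D p c w = (-1) ^ p * of_nat ((p + c - 2 - w) choose (c - 1 - w)) * D ^ (p + c - 1 - w)"

lemma le_div_imp_mult_le: "j \<le> p div 2 \<Longrightarrow> 2 * j \<le> (p::nat)"
  by simp

text \<open>Pascal's rule. This is the recursion that
  \<open>inverse_powers_partial_fraction_step\<close> forces on the coefficients; the top
  coefficient receives a contribution from one of the two terms only.\<close>

lemma pf_left_rec:
  "w < p \<Longrightarrow> pf_left D (Suc p) (Suc c) w = D * (pf_left D (Suc p) c w - pf_left D p (Suc c) w)"
  "pf_left D (Suc p) (Suc c) p = D * pf_left D (Suc p) c p"
proof -
  assume "w < p"
  then obtain e where "p = w + Suc e" by (metis add_Suc_right less_iff_Suc_add)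
  then show "pf_left D (Suc p) (Suc c) w = D * (pf_left D (Suc p) c w - pf_left D p (Suc c) w)"
    by (simp add: pf_left_def algebra_simps)
qed (simp add: pf_left_def)

lemma pf_right_rec:
  "w < c \<Longrightarrow> pf_right D (Suc p) (Suc c) w = D * (pf_right D (Suc p) c w - pf_right D p (Suc c) w)"
  "pf_right D (Suc p) (Suc c) c = - (D * pf_right D p (Suc c) c)"
proof -
  assume "w < c"
  then obtain e where "c = w + Suc e" by (metis add_Suc_right less_iff_Suc_add)
  then show "pf_right D (Suc p) (Suc c) w = D * (pf_right D (Suc p) c w - pf_right D p (Suc c) w)"
    by (simp add: pf_right_def algebra_simps)
qed (simp add: pf_right_def)

lemma two_poles_partial_fraction:
  fixes u v d :: "'a::field"
  assumes "u \<noteq> 0" "v \<noteq> 0" "v - u = d" "d \<noteq> 0" "p + c \<ge> 1"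
  shows "inverse (u ^ p) * inverse (v ^ c) =
           (\<Sum>w<p. pf_left (inverse d) p c w * inverse (u ^ Suc w)) +
           (\<Sum>w<c. pf_right (inverse d) p c w * inverse (v ^ Suc w))"
  using assms(5)
proof (induction "p + c" arbitrary: p c)
  case (Suc k)
  consider "p = 0" | "c = 0" | p' c' where "p = Suc p'" "c = Suc c'"
    by (metis not0_implies_Suc)
  then show ?case
  proof cases
    case 1
    then obtain c' where c: "c = Suc c'" using Suc.prems by (cases c) auto
    have "(\<Sum>w<c'. pf_right (inverse d) 0 (Suc c') w * inverse (v ^ Suc w)) = 0"
      by (rule sum.neutral) (simp add: pf_right_def binomial_eq_0 diff_less_mono2)
    then show ?thesis using 1 c by (simp add: pf_right_def)
  next
    case 2
    then obtain p' where p: "p = Suc p'" using Suc.prems by (cases p) auto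
    have "(\<Sum>w<p'. pf_left (inverse d) (Suc p') 0 w * inverse (u ^ Suc w)) = 0"
      by (rule sum.neutral) (simp add: pf_left_def binomial_eq_0 diff_less_mono2)
    then show ?thesis using 2 p by (simp add: pf_left_def)
  next
    case 3
    let ?D = "inverse d"
    have IH1: "inverse (u ^ Suc p') * inverse (v ^ c') =
           (\<Sum>w<Suc p'. pf_left ?D (Suc p') c' w * inverse (u ^ Suc w)) +
           (\<Sum>w<c'. pf_right ?D (Suc p') c' w * inverse (v ^ Suc w))"
      using Suc.hyps 3 by (intro Suc.hyps(1)) auto
    have IH2: "inverse (u ^ p') * inverse (v ^ Suc c') =
           (\<Sum>w<p'. pf_left ?D p' (Suc c') w * inverse (u ^ Suc w)) +
           (\<Sum>w<Suc c'. pf_right ?D p' (Suc c') w * inverse (v ^ Suc w))"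
      using Suc.hyps 3 by (intro Suc.hyps(1)) auto
    have L: "(\<Sum>w<p'. pf_left ?D (Suc p') (Suc c') w * inverse (u ^ Suc w)) =
      ?D * ((\<Sum>w<p'. pf_left ?D (Suc p') c' w * inverse (u ^ Suc w)) - (\<Sum>w<p'. pf_left ?D p' (Suc c') w * inverse (u ^ Suc w)))"
      unfolding sum_subtractf[symmetric] sum_distrib_left
      by (rule sum.cong) (auto simp: pf_left_rec algebra_simps)
    have R: "(\<Sum>w<c'. pf_right ?D (Suc p') (Suc c') w * inverse (v ^ Suc w)) =
      ?D * ((\<Sum>w<c'. pf_right ?D (Suc p') c' w * inverse (v ^ Suc w)) - (\<Sum>w<c'. pf_right ?D p' (Suc c') w * inverse (v ^ Suc w)))"
      unfolding sum_subtractf[symmetric] sum_distrib_left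
      by (rule sum.cong) (auto simp: pf_right_rec algebra_simps)
    show ?thesis unfolding 3
      apply (subst inverse_powers_partial_fraction_step[OF assms(1-4)])
      unfolding IH1 IH2 sum.lessThan_Suc pf_left_rec(2) pf_right_rec(2) L R
      by (simp add: algebra_simps)
  qed
qed auto

lemma linear_coeff_minus:
  "linear_coeff a (- u) n = (-1) ^ a * of_nat ((n + a - 1) choose n) / u ^ (a + n)"
proof -
  have "(- u) ^ (a + n) = (-1) ^ (a + n) * u ^ (a + n)" by (rule power_minus)
  moreover have "(-1) ^ n / (-1) ^ (a + n) = ((-1) ^ a :: complex)"
    by (cases "even n"; cases "even a") auto
  moreover have "(-1) ^ n * B / ((-1) ^ (a + n) * V) = (-1) ^ n / (-1) ^ (a + n) * B / V" for B V :: complex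
    by (simp only: times_divide_times_eq times_divide_eq_left divide_divide_eq_left)
  ultimately show ?thesis unfolding linear_coeff_def by (simp only:)
qed

lemma principal_functional_one_factor:
  assumes "p \<le> 2 * M" "u \<noteq> 0"
  shows "principal_functional x M (inverse (fls_X ^ p) * inverse ((fls_X + fls_const u) ^ a)) =
           2 * (\<Sum>j = 0..p div 2. psi_const x j * linear_coeff a u (p - 2 * j))"
  unfolding inverse_linear_power_fls[OF assms(2)] principal_functional_fps[OF assms(1)] by simp

lemma principal_functional_two_factors:
  assumes "p \<le> 2 * M" "u \<noteq> 0" "v \<noteq> 0"
  shows "principal_functional x M (inverse (fls_X ^ p) *
           (inverse ((fls_X + fls_const u) ^ a) * inverse ((fls_X + fls_const v) ^ c))) =
         2 * (\<Sum>j = 0..p div 2. psi_const x j *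
            (\<Sum>w = 0..p - 2 * j. linear_coeff a u w * linear_coeff c v (p - 2 * j - w)))"
  unfolding inverse_linear_power_fls[OF assms(2)] inverse_linear_power_fls[OF assms(3)]
    fls_times_fps_to_fls[symmetric] principal_functional_fps[OF assms(1)] fps_mult_nth by simp

lemma fls_const_pf:
  "pf_left (inverse (fls_const d)) p c w = fls_const (pf_left (inverse d) p c w)"
  "pf_right (inverse (fls_const d)) p c w = fls_const (pf_right (inverse d) p c w)" for d :: complex
proof -
  have 1: "(-1 :: complex fls) ^ k = fls_const ((-1) ^ k)" for k
    by (cases "even k") auto
  have 2: "(of_nat k :: complex fls) = fls_const (of_nat k)" for k
    by (simp add: fls_of_nat)
  have 3: "inverse (fls_const d) ^ k = fls_const (inverse d ^ k)" for k
    by (simp add: fls_inverse_const fls_const_power)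
  show "pf_left (inverse (fls_const d)) p c w = fls_const (pf_left (inverse d) p c w)"
  "pf_right (inverse (fls_const d)) p c w = fls_const (pf_right (inverse d) p c w)"
    unfolding pf_left_def pf_right_def 1 2 3 fls_const_mult_const by (rule refl)+
qed

lemma sum_sum_eq_const_mult:
  fixes s :: "'a::comm_semiring_0"
  assumes "\<And>j w. j \<in> J \<Longrightarrow> w \<in> W j \<Longrightarrow> c j w = s * d j w"
  shows "(\<Sum>j\<in>J. f j * (\<Sum>w\<in>W j. c j w)) = s * (\<Sum>j\<in>J. f j * (\<Sum>w\<in>W j. d j w))"
  using assms by (simp add: sum_distrib_left mult.left_commute cong: sum.cong)

lemma sum_sum_divide:
  fixes y :: "'a::field"
  shows "y * (r * (\<Sum>j\<in>J. f j * (\<Sum>w\<in>W j. c j w * (1 / d j w)))) =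
    r * (\<Sum>j\<in>J. f j * (\<Sum>w\<in>W j. c j w * (y / d j w)))"
  by (simp add: sum_distrib_left mult_ac)

text \<open>Expanding both factors as in \<open>principal_functional_two_factors\<close> would raise
  the exponents of \<open>m\<close> and \<open>n\<close> together, whereas in \<open>R_sum\<close>
  only one of them is raised and \<open>m + n\<close> takes up the rest. Since the two factors
  differ by the constant \<open>m + n\<close>, partial fractions first separate them, and only then
  is each expanded at the pole.\<close>

lemma principal_functional_middle:
  assumes a: "a \<le> 2 * M" and m: "m \<noteq> 0" "n \<noteq> 0" "m + n \<noteq> 0" and pc: "p \<ge> 1" "c \<ge> 1"
  shows "principal_functional x M (inverse (fls_X ^ a) *
           (inverse ((fls_X + fls_const (- m)) ^ p) * inverse ((fls_X + fls_const n) ^ c))) =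
         2 * (-1) ^ p * (\<Sum>j = 0..a div 2. psi_const x j * (\<Sum>w = 0..p - 1.
            of_nat ((w + a - 2 * j) choose w) * of_nat ((p + c - 2 - w) choose (c - 1)) *
            (1 / (m ^ (a - 2 * j + w + 1) * (m + n) ^ (p + c - 1 - w))))) +
         2 * (-1) ^ (p + a) * (\<Sum>j = 0..a div 2. psi_const x j * (\<Sum>w = 0..c - 1.
            of_nat ((w + a - 2 * j) choose w) * of_nat ((p + c - 2 - w) choose (p - 1)) *
            (1 / (n ^ (a - 2 * j + w + 1) * (m + n) ^ (p + c - 1 - w)))))"
proof -
  let ?X = "inverse (fls_X ^ a) :: complex fls" and ?D = "inverse (m + n)"
  have "inverse ((fls_X + fls_const (- m)) ^ p) * inverse ((fls_X + fls_const n) ^ c) =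
       (\<Sum>w<p. pf_left (inverse (fls_const (m + n))) p c w * inverse ((fls_X + fls_const (- m)) ^ Suc w)) +
           (\<Sum>w<c. pf_right (inverse (fls_const (m + n))) p c w * inverse ((fls_X + fls_const n) ^ Suc w))"
  proof (rule two_poles_partial_fraction)
    show "fls_X + fls_const (- m) \<noteq> 0" "fls_X + fls_const n \<noteq> 0" by (rule fls_X_plus_const_neq_0)+
    show "fls_X + fls_const n - (fls_X + fls_const (- m)) = fls_const (m + n)"
      by (simp add: fls_plus_const algebra_simps)
  qed (use m pc in auto)
  then have eq: "?X * (inverse ((fls_X + fls_const (- m)) ^ p) * inverse ((fls_X + fls_const n) ^ c)) =
       (\<Sum>w<p. fls_const (pf_left ?D p c w) * (?X * inverse ((fls_X + fls_const (- m)) ^ Suc w))) +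
       (\<Sum>w<c. fls_const (pf_right ?D p c w) * (?X * inverse ((fls_X + fls_const n) ^ Suc w)))"
    unfolding fls_const_pf by (simp only: distrib_left sum_distrib_left mult_ac)
  have 1: "(\<Sum>w<p. pf_left ?D p c w * principal_functional x M (?X * inverse ((fls_X + fls_const (- m)) ^ Suc w))) =
     2 * (\<Sum>j = 0..a div 2. psi_const x j *
            (\<Sum>w<p. pf_left ?D p c w * linear_coeff (Suc w) (- m) (a - 2 * j)))"
    using m by (subst principal_functional_one_factor[OF a]) (auto simp: sum_distrib_left mult_ac intro: sum.swap)
  have 2: "(\<Sum>w<c. pf_right ?D p c w * principal_functional x M (?X * inverse ((fls_X + fls_const n) ^ Suc w))) =
     2 * (\<Sum>j = 0..a div 2. psi_const x j *
            (\<Sum>w<c. pf_right ?D p c w * linear_coeff (Suc w) n (a - 2 * j)))"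
    using m by (subst principal_functional_one_factor[OF a]) (auto simp: sum_distrib_left mult_ac intro: sum.swap)
  have 3: "pf_left ?D p c w * linear_coeff (Suc w) (- m) (a - 2 * j) =
      (-1) ^ p * (of_nat ((w + a - 2 * j) choose w) * of_nat ((p + c - 2 - w) choose (c - 1)) *
                  (1 / (m ^ (a - 2 * j + w + 1) * (m + n) ^ (p + c - 1 - w))))" if "w < p" "j \<le> a div 2" for w j
  proof -
    obtain e where e: "p = w + Suc e" using \<open>w < p\<close> by (metis add_Suc_right less_iff_Suc_add)
    obtain f where f: "a = f + 2 * j"
        using le_div_imp_mult_le[OF \<open>j \<le> a div 2\<close>] by (metis le_add_diff_inverse2)
    have b1: "(e + (c - 1)) choose e = (e + (c - 1)) choose (c - 1)"
      by (metis add_diff_cancel_left' binomial_symmetric le_add1)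
    have b2: "(f + w) choose f = (f + w) choose w"
      by (metis add_diff_cancel_left' binomial_symmetric le_add1)
    \<comment> \<open>The sign (-1)^(p - 1 - w) of \<open>pf_left\<close> and the sign (-1)^(w + 1)
      from \<open>linear_coeff_minus\<close> combine to a sign independent of
      \<open>w\<close>.\<close>
    have s: "(-1) ^ e * (-1) ^ Suc w = ((-1) ^ p :: complex)"
      unfolding e by (simp add: power_add)
    have "pf_left ?D p c w * linear_coeff (Suc w) (- m) (a - 2 * j) =
      ((-1) ^ e * (-1) ^ Suc w) * of_nat ((e + (c - 1)) choose e) * of_nat ((f + w) choose f) /
         (m ^ (f + w + 1) * (m + n) ^ (e + c))"
      unfolding linear_coeff_minus pf_left_def e f using pc
      by (simp add: divide_inverse power_inverse add_ac mult_ac)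
    then show ?thesis unfolding s b1 b2 using pc e f by (simp add: mult_ac add_ac)
  qed
  have 4: "pf_right ?D p c w * linear_coeff (Suc w) n (a - 2 * j) =
      (-1) ^ (p + a) * (of_nat ((w + a - 2 * j) choose w) * of_nat ((p + c - 2 - w) choose (p - 1)) *
                  (1 / (n ^ (a - 2 * j + w + 1) * (m + n) ^ (p + c - 1 - w))))" if "w < c" "j \<le> a div 2" for w j
  proof -
    obtain e where e: "c = w + Suc e" using \<open>w < c\<close> by (metis add_Suc_right less_iff_Suc_add)
    obtain f where f: "a = f + 2 * j"
        using le_div_imp_mult_le[OF \<open>j \<le> a div 2\<close>] by (metis le_add_diff_inverse2)
    have b1: "(e + (p - 1)) choose e = (e + (p - 1)) choose (p - 1)"
      by (metis add_diff_cancel_left' binomial_symmetric le_add1)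
    have b2: "(f + w) choose f = (f + w) choose w"
      by (metis add_diff_cancel_left' binomial_symmetric le_add1)
    \<comment> \<open>Here (-1)^p comes from \<open>pf_right\<close> and (-1)^(a - 2j) from
      \<open>linear_coeff\<close>.\<close>
    have s: "(-1) ^ p * (-1) ^ f = ((-1) ^ (p + a) :: complex)"
      unfolding f by (simp add: power_add)
    have "pf_right ?D p c w * linear_coeff (Suc w) n (a - 2 * j) =
      ((-1) ^ p * (-1) ^ f) * of_nat ((e + (p - 1)) choose e) * of_nat ((f + w) choose f) /
         (n ^ (f + w + 1) * (m + n) ^ (e + p))"
      unfolding linear_coeff_def pf_right_def e f using pc
      by (simp add: divide_inverse power_inverse add_ac mult_ac)
    then show ?thesis unfolding s b1 b2 using pc e f by (simp add: mult_ac add_ac)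
  qed
  have set: "{..<p} = {0..p - 1}" "{..<c} = {0..c - 1}" using pc by auto
  have 5: "(\<Sum>j = 0..a div 2. psi_const x j * (\<Sum>w<p. pf_left ?D p c w * linear_coeff (Suc w) (- m) (a - 2 * j))) =
     (-1) ^ p * (\<Sum>j = 0..a div 2. psi_const x j * (\<Sum>w<p.
            of_nat ((w + a - 2 * j) choose w) * of_nat ((p + c - 2 - w) choose (c - 1)) *
            (1 / (m ^ (a - 2 * j + w + 1) * (m + n) ^ (p + c - 1 - w)))))"
    by (intro sum_sum_eq_const_mult 3) auto
  have 6: "(\<Sum>j = 0..a div 2. psi_const x j * (\<Sum>w<c. pf_right ?D p c w * linear_coeff (Suc w) n (a - 2 * j))) =
     (-1) ^ (p + a) * (\<Sum>j = 0..a div 2. psi_const x j * (\<Sum>w<c.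
            of_nat ((w + a - 2 * j) choose w) * of_nat ((p + c - 2 - w) choose (p - 1)) *
            (1 / (n ^ (a - 2 * j + w + 1) * (m + n) ^ (p + c - 1 - w)))))"
    by (intro sum_sum_eq_const_mult 4) auto
  show ?thesis
    unfolding eq principal_functional_add principal_functional_sum 1 2 5 6 unfolding set by (simp only: mult.assoc)
qed

section \<open>The inner sum over l in closed form\<close>

lemma linear_coeff_mult:
  assumes "c \<ge> 1" "w \<le> N"
  shows "linear_coeff a u w * linear_coeff c v (N - w) =
     (-1) ^ N * of_nat ((w + a - 1) choose w) * of_nat ((N + c - w - 1) choose (c - 1)) / (u ^ (a + w) * v ^ (c + N - w))"
  "linear_coeff a (- u) w * linear_coeff c (- v) (N - w) =
     (-1) ^ (a + c) * of_nat ((w + a - 1) choose w) * of_nat ((N + c - w - 1) choose (c - 1)) / (u ^ (a + w) * v ^ (c + N - w))"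
proof -
  obtain e where e: "N = w + e" using assms by (metis le_Suc_ex)
  have b: "(e + (c - 1)) choose e = (e + (c - 1)) choose (c - 1)"
      by (metis add_diff_cancel_left' binomial_symmetric le_add1)
  show "linear_coeff a u w * linear_coeff c v (N - w) =
     (-1) ^ N * of_nat ((w + a - 1) choose w) * of_nat ((N + c - w - 1) choose (c - 1)) / (u ^ (a + w) * v ^ (c + N - w))"
    using assms b unfolding linear_coeff_def e by (simp add: power_add)
  show "linear_coeff a (- u) w * linear_coeff c (- v) (N - w) =
     (-1) ^ (a + c) * of_nat ((w + a - 1) choose w) * of_nat ((N + c - w - 1) choose (c - 1)) / (u ^ (a + w) * v ^ (c + N - w))"
    using assms b unfolding linear_coeff_minus e by (simp add: power_add)
qed

text \<open>The residue contributions of the poles in \<open>l\<close>: the first sum belongs to l =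
  0, the second to l = -m-n, and the last two to l = -m, split by partial fractions. A pole at e
  brings the factor \<open>x powi e\<close>, written without minus signs because x = 1 or x = -1.
  The layout is that of \<open>R_sum\<close> with each T replaced by its dependence on
  \<open>m\<close> and \<open>n\<close>.\<close>

definition inner_value :: "complex \<Rightarrow> nat \<Rightarrow> nat \<Rightarrow> nat \<Rightarrow> int \<Rightarrow> int \<Rightarrow> complex" where
  "inner_value x p a c m n =
     2 * (-1) ^ p * (\<Sum>j = 0..p div 2. psi_const x j * (\<Sum>w = 0..p - 2 * j.
        of_nat ((w + a - 1) choose w) * of_nat ((p + c - 2 * j - w - 1) choose (c - 1)) *
        (1 / (of_int m ^ (a + w) * of_int (m + n) ^ (p + c - 2 * j - w)))))
   + 2 * (-1) ^ (p + a) * (\<Sum>j = 0..c div 2. psi_const x j * (\<Sum>w = 0..c - 2 * j.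
        of_nat ((w + a - 1) choose w) * of_nat ((p + c - 2 * j - w - 1) choose (p - 1)) *
        (x powi (m + n) / (of_int n ^ (a + w) * of_int (m + n) ^ (p + c - 2 * j - w)))))
   + 2 * (-1) ^ p * (\<Sum>j = 0..a div 2. psi_const x j * (\<Sum>w = 0..p - 1.
        of_nat ((w + a - 2 * j) choose w) * of_nat ((p + c - 2 - w) choose (c - 1)) *
        (x powi m / (of_int m ^ (a - 2 * j + w + 1) * of_int (m + n) ^ (p + c - 1 - w)))))
   + 2 * (-1) ^ (p + a) * (\<Sum>j = 0..a div 2. psi_const x j * (\<Sum>w = 0..c - 1.
        of_nat ((w + a - 2 * j) choose w) * of_nat ((p + c - 2 - w) choose (p - 1)) *
        (x powi m / (of_int n ^ (a - 2 * j + w + 1) * of_int (m + n) ^ (p + c - 1 - w)))))"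

lemma symmetric_sum_three_poles:
  fixes x :: complex and m n :: int
  assumes x: "x = 1 \<or> x = -1" and mn: "m \<noteq> 0" "n \<noteq> 0" "m + n \<noteq> 0" and pos: "p \<ge> 1" "a \<ge> 1" "c \<ge> 1"
  shows "(\<lambda>N::nat. \<Sum>l\<in>{- int N..int N} - {0, - m, - m - n}.
            x powi l / (of_int l ^ p * of_int (l + m) ^ a * of_int (l + m + n) ^ c)) \<longlonglongrightarrow> inner_value x p a c m n"
proof -
  define k where "k = (\<lambda>y::int. if y = 0 then p else if y = - m then a else c)"
  let ?E = "{0, - m, - m - n}"
  \<comment> \<open>The total multiplicity; it satisfies the bound of
    \<open>lattice_partial_fraction\<close> and exceeds each single pole order.\<close>
  define M where "M = p + a + c"
  have d: "(- m) \<noteq> 0" "- m - n \<noteq> 0" "- m - n \<noteq> - m" "0 \<noteq> - m" "0 \<noteq> - m - n" "- m \<noteq> - m - n" using mn by auto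
  have k: "k 0 = p" "k (- m) = a" "k (- m - n) = c" using mn by (auto simp: k_def)
  have sumk: "sum k ?E = p + (a + c)" using d by (simp add: k)
  have prodE: "prod g ?E = g 0 * g (- m) * g (- m - n)" for g :: "int \<Rightarrow> 'z::comm_monoid_mult"
    using d by (simp add: mult_ac)
  have lim: "(\<lambda>N::nat. \<Sum>l\<in>{- int N..int N} - ?E. x powi l * (\<Prod>y\<in>?E. inverse (of_int (l - y) ^ k y)))
           \<longlonglongrightarrow> (\<Sum>e\<in>?E. x powi e * principal_functional x M (shift_prod k ?E e))"
    by (rule lattice_partial_fraction[OF x]) (use pos in \<open>auto simp: sumk M_def\<close>)
  have summand: "x powi l * (\<Prod>y\<in>?E. inverse (of_int (l - y) ^ k y)) =
      x powi l / (of_int l ^ p * of_int (l + m) ^ a * of_int (l + m + n) ^ c)" for l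
    unfolding prodE k by (simp add: divide_inverse algebra_simps)
  have total: "(\<Sum>e\<in>?E. x powi e * principal_functional x M (shift_prod k ?E e)) = inner_value x p a c m n"
  proof -
    have xm: "x powi (- m) = x powi m" "x powi (- m - n) = x powi (m + n)"
      using powi_sign(2)[OF x] by (simp, metis minus_add_distrib uminus_add_conv_diff add.commute)
    have F0: "shift_prod k ?E 0 = inverse (fls_X ^ p) * (inverse ((fls_X + fls_const (of_int m)) ^ a) *
        inverse ((fls_X + fls_const (of_int (m + n))) ^ c))"
      unfolding shift_prod_def prodE k by (simp add: algebra_simps)
    have F1: "shift_prod k ?E (- m) = inverse (fls_X ^ a) * (inverse ((fls_X + fls_const (- of_int m)) ^ p) *
        inverse ((fls_X + fls_const (of_int n)) ^ c))"
      unfolding shift_prod_def prodE k by (simp add: algebra_simps)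
    have F2: "shift_prod k ?E (- m - n) = inverse (fls_X ^ c) * (inverse ((fls_X + fls_const (- of_int n)) ^ a) *
        inverse ((fls_X + fls_const (- of_int (m + n))) ^ p))"
      unfolding shift_prod_def prodE k by (simp add: algebra_simps)
    have nz: "(of_int m :: complex) \<noteq> 0" "(of_int n :: complex) \<noteq> 0" "(of_int (m + n) :: complex) \<noteq> 0"
      using mn by (simp_all only: of_int_eq_0_iff not_False_eq_True)
    have nz': "(of_int m :: complex) + of_int n \<noteq> 0" using nz(3) by simp
    have P0: "principal_functional x M (shift_prod k ?E 0) =
       2 * (-1) ^ p * (\<Sum>j = 0..p div 2. psi_const x j * (\<Sum>w = 0..p - 2 * j.
        of_nat ((w + a - 1) choose w) * of_nat ((p + c - 2 * j - w - 1) choose (c - 1)) *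
        (1 / (of_int m ^ (a + w) * of_int (m + n) ^ (p + c - 2 * j - w)))))"
    proof -
      have "linear_coeff a (of_int m) w * linear_coeff c (of_int (m + n)) (p - 2 * j - w) =
         (-1) ^ p * (of_nat ((w + a - 1) choose w) * of_nat ((p + c - 2 * j - w - 1) choose (c - 1)) *
        (1 / (of_int m ^ (a + w) * of_int (m + n) ^ (p + c - 2 * j - w))))"
        if "j \<le> p div 2" "w \<le> p - 2 * j" for j w
      proof -
        obtain e where e: "p = e + 2 * j"
        using le_div_imp_mult_le[OF \<open>j \<le> p div 2\<close>] by (metis le_add_diff_inverse2)
        show ?thesis using that by (subst linear_coeff_mult(1)) (use pos in \<open>auto simp: e power_add add_ac\<close>)
      qed
      then have "(\<Sum>j = 0..p div 2. psi_const x j * (\<Sum>w = 0..p - 2 * j.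
          linear_coeff a (of_int m) w * linear_coeff c (of_int (m + n)) (p - 2 * j - w))) =
        (-1) ^ p * (\<Sum>j = 0..p div 2. psi_const x j * (\<Sum>w = 0..p - 2 * j.
          of_nat ((w + a - 1) choose w) * of_nat ((p + c - 2 * j - w - 1) choose (c - 1)) *
          (1 / (of_int m ^ (a + w) * of_int (m + n) ^ (p + c - 2 * j - w)))))"
        by (intro sum_sum_eq_const_mult) (simp only: atLeastAtMost_iff)
      moreover have "p \<le> 2 * M" by (simp add: M_def)
      ultimately show ?thesis unfolding F0 principal_functional_two_factors[OF \<open>p \<le> 2 * M\<close> nz(1,3)]
        by (simp only: mult.assoc)
    qed
    have P2: "principal_functional x M (shift_prod k ?E (- m - n)) =
       2 * (-1) ^ (p + a) * (\<Sum>j = 0..c div 2. psi_const x j * (\<Sum>w = 0..c - 2 * j.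
        of_nat ((w + a - 1) choose w) * of_nat ((p + c - 2 * j - w - 1) choose (p - 1)) *
        (1 / (of_int n ^ (a + w) * of_int (m + n) ^ (p + c - 2 * j - w)))))"
    proof -
      have "linear_coeff a (- of_int n) w * linear_coeff p (- of_int (m + n)) (c - 2 * j - w) =
         (-1) ^ (p + a) * (of_nat ((w + a - 1) choose w) * of_nat ((p + c - 2 * j - w - 1) choose (p - 1)) *
        (1 / (of_int n ^ (a + w) * of_int (m + n) ^ (p + c - 2 * j - w))))"
        if "j \<le> c div 2" "w \<le> c - 2 * j" for j w
      proof -
        obtain e where e: "c = e + 2 * j"
        using le_div_imp_mult_le[OF \<open>j \<le> c div 2\<close>] by (metis le_add_diff_inverse2)
        show ?thesis using that by (subst linear_coeff_mult(2)) (use pos in \<open>auto simp: e power_add add_ac\<close>)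
      qed
      then have "(\<Sum>j = 0..c div 2. psi_const x j * (\<Sum>w = 0..c - 2 * j.
          linear_coeff a (- of_int n) w * linear_coeff p (- of_int (m + n)) (c - 2 * j - w))) =
        (-1) ^ (p + a) * (\<Sum>j = 0..c div 2. psi_const x j * (\<Sum>w = 0..c - 2 * j.
          of_nat ((w + a - 1) choose w) * of_nat ((p + c - 2 * j - w - 1) choose (p - 1)) *
          (1 / (of_int n ^ (a + w) * of_int (m + n) ^ (p + c - 2 * j - w)))))"
        by (intro sum_sum_eq_const_mult) (simp only: atLeastAtMost_iff)
      moreover have "c \<le> 2 * M" by (simp add: M_def)
      moreover have "- complex_of_int n \<noteq> 0" "- complex_of_int (m + n) \<noteq> 0" using nz by (simp_all only: neg_equal_0_iff_equal not_False_eq_True)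
      ultimately show ?thesis unfolding F2
        by (subst principal_functional_two_factors) (assumption | simp only: mult.assoc)+
    qed
    have P1: "principal_functional x M (shift_prod k ?E (- m)) =
      2 * (-1) ^ p * (\<Sum>j = 0..a div 2. psi_const x j * (\<Sum>w = 0..p - 1.
        of_nat ((w + a - 2 * j) choose w) * of_nat ((p + c - 2 - w) choose (c - 1)) *
        (1 / (of_int m ^ (a - 2 * j + w + 1) * of_int (m + n) ^ (p + c - 1 - w)))))
   + 2 * (-1) ^ (p + a) * (\<Sum>j = 0..a div 2. psi_const x j * (\<Sum>w = 0..c - 1.
        of_nat ((w + a - 2 * j) choose w) * of_nat ((p + c - 2 - w) choose (p - 1)) *
        (1 / (of_int n ^ (a - 2 * j + w + 1) * of_int (m + n) ^ (p + c - 1 - w)))))"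
      unfolding F1 of_int_add
      by (rule principal_functional_middle) (use nz nz' pos in \<open>auto simp: M_def\<close>)
    have "(\<Sum>e\<in>?E. x powi e * principal_functional x M (shift_prod k ?E e)) =
       principal_functional x M (shift_prod k ?E 0) + x powi m * principal_functional x M (shift_prod k ?E (- m)) +
       x powi (m + n) * principal_functional x M (shift_prod k ?E (- m - n))"
      using d xm by (simp add: add_ac)
    then show ?thesis unfolding P0 P1 P2 inner_value_def distrib_left sum_sum_divide
      by (simp only: add_ac)
  qed
  from lim show ?thesis unfolding summand total .
qed

text \<open>The analogue for the summation over \<open>l\<close> in the series T. A single further
  factor remains at each pole, so no partial fractions are needed.\<close>

lemma symmetric_sum_two_poles:
  fixes x :: complex and m :: int
  assumes x: "x = 1 \<or> x = -1" and m: "m \<noteq> 0" and pos: "p \<ge> 1" "q \<ge> 1"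
  shows "(\<lambda>N::nat. \<Sum>l\<in>{- int N..int N} - {0, - m}.
            x powi l / (of_int l ^ p * of_int (l + m) ^ q)) \<longlonglongrightarrow>
       2 * (\<Sum>j = 0..p div 2. psi_const x j * linear_coeff q (of_int m) (p - 2 * j)) +
       x powi m * (2 * (\<Sum>j = 0..q div 2. psi_const x j * linear_coeff p (- of_int m) (q - 2 * j)))"
proof -
  define k where "k = (\<lambda>y::int. if y = 0 then p else q)"
  let ?E = "{0, - m}"
  define M where "M = p + q"
  have k: "k 0 = p" "k (- m) = q" using m by (auto simp: k_def)
  have sumk: "sum k ?E = p + q" using m by (simp add: k)
  have prodE: "prod g ?E = g 0 * g (- m)" for g :: "int \<Rightarrow> 'z::comm_monoid_mult"
    using m by simp
  have nz: "(of_int m :: complex) \<noteq> 0" using m by simp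
  have lim: "(\<lambda>N::nat. \<Sum>l\<in>{- int N..int N} - ?E. x powi l * (\<Prod>y\<in>?E. inverse (of_int (l - y) ^ k y)))
           \<longlonglongrightarrow> (\<Sum>e\<in>?E. x powi e * principal_functional x M (shift_prod k ?E e))"
    by (rule lattice_partial_fraction[OF x]) (use pos in \<open>auto simp: sumk M_def\<close>)
  have summand: "x powi l * (\<Prod>y\<in>?E. inverse (of_int (l - y) ^ k y)) =
      x powi l / (of_int l ^ p * of_int (l + m) ^ q)" for l
    unfolding prodE k by (simp add: divide_inverse algebra_simps)
  have total: "(\<Sum>e\<in>?E. x powi e * principal_functional x M (shift_prod k ?E e)) =
       2 * (\<Sum>j = 0..p div 2. psi_const x j * linear_coeff q (of_int m) (p - 2 * j)) +
       x powi m * (2 * (\<Sum>j = 0..q div 2. psi_const x j * linear_coeff p (- of_int m) (q - 2 * j)))"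
  proof -
    have F0: "shift_prod k ?E 0 = inverse (fls_X ^ p) * inverse ((fls_X + fls_const (of_int m)) ^ q)"
      unfolding shift_prod_def prodE k by (simp add: algebra_simps)
    have F1: "shift_prod k ?E (- m) = inverse (fls_X ^ q) * inverse ((fls_X + fls_const (- of_int m)) ^ p)"
      unfolding shift_prod_def prodE k by (simp add: algebra_simps)
    have "(\<Sum>e\<in>?E. x powi e * principal_functional x M (shift_prod k ?E e)) =
      principal_functional x M (shift_prod k ?E 0) + x powi m * principal_functional x M (shift_prod k ?E (- m))"
    using m powi_sign(2)[OF x] by simp
    moreover have "principal_functional x M (inverse (fls_X ^ p) * inverse ((fls_X + fls_const (of_int m)) ^ q)) =
     2 * (\<Sum>j = 0..p div 2. psi_const x j * linear_coeff q (of_int m) (p - 2 * j))"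
    by (rule principal_functional_one_factor) (use nz M_def in auto)
    moreover have "principal_functional x M (inverse (fls_X ^ q) * inverse ((fls_X + fls_const (- of_int m)) ^ p)) =
     2 * (\<Sum>j = 0..q div 2. psi_const x j * linear_coeff p (- of_int m) (q - 2 * j))"
    by (rule principal_functional_one_factor) (use nz M_def in auto)
    ultimately show ?thesis unfolding F0 F1 by (simp only:)
  qed
  from lim show ?thesis unfolding summand total .
qed

section \<open>Restriction of meromorphic functions to complex lines\<close>

lemma continuous_on_contour_integral_param:
  assumes cont: "continuous_on (S \<times> path_image g) (\<lambda>(w, t). f w t)"
    and g: "continuous_on {0..1} g" "continuous_on {0..1} (\<lambda>t. vector_derivative g (at t))"
  shows "continuous_on S (\<lambda>w. contour_integral g (f w))"
proof -
  have "continuous_on (S \<times> {0..1}) (\<lambda>z. (\<lambda>(w, t). f w t) (fst z, g (snd z)))"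
    by (rule continuous_on_compose2[OF cont])
       (auto intro!: continuous_intros continuous_on_compose2[OF g(1)] simp: path_image_def)
  then have "continuous_on (S \<times> cbox 0 1) (\<lambda>(w, t). f w (g t) * vector_derivative g (at t))"
    by (auto simp: case_prod_unfold intro!: continuous_on_mult continuous_on_compose2[OF g(2)] continuous_on_snd)
  then have "continuous_on S (\<lambda>w. integral (cbox 0 1) (\<lambda>t. f w (g t) * vector_derivative g (at t)))"
    by (rule integral_continuous_on_param)
  then show ?thesis by (simp add: contour_integral_integral)
qed

text \<open>Morera's theorem: integration over a triangle in \<open>w\<close> may be exchanged with
  integration over the circle, and the integral over the triangle vanishes by Cauchy's theorem for
  each fixed \<open>t\<close>.\<close>

lemma holomorphic_on_contour_integral_circlepath_param:
  fixes f :: "complex \<Rightarrow> complex \<Rightarrow> complex"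
  assumes S: "open S" and r: "r > 0"
    and cont: "continuous_on (S \<times> sphere z r) (\<lambda>(w, t). f w t)"
    and hol: "\<And>t. t \<in> sphere z r \<Longrightarrow> (\<lambda>w. f w t) holomorphic_on S"
  shows "(\<lambda>w. contour_integral (circlepath z r) (f w)) holomorphic_on S"
proof -
  let ?g = "circlepath z r"
  have im: "path_image ?g = sphere z r" using r by simp
  have vd: "continuous_on {0..1} (\<lambda>t. vector_derivative ?g (at t))"
    by (auto simp: vector_derivative_circlepath intro!: continuous_intros)
  have pc: "continuous_on {0..1} ?g" by (simp add: circlepath_def part_circlepath_def continuous_intros)
  have "(\<lambda>w. contour_integral ?g (f w)) analytic_on S"
  proof (rule Morera_triangle[OF _ S], goal_cases)
    case 1
    show ?case by (rule continuous_on_contour_integral_param) (use cont im pc vd in auto)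
  next
    case (2 a b c)
    show ?case
    proof
      assume sub: "convex hull {a, b, c} \<subseteq> S"
      have seg: "closed_segment a b \<subseteq> S" "closed_segment b c \<subseteq> S" "closed_segment c a \<subseteq> S"
        unfolding segment_convex_hull by (intro order_trans[OF hull_mono sub]; simp)+
      have vl: "continuous_on {0..1} (\<lambda>t. vector_derivative (linepath u v) (at t))" for u v :: complex
        by (auto intro!: continuous_intros)
      have swap: "contour_integral (linepath u v) (\<lambda>w. contour_integral ?g (f w)) =
         contour_integral ?g (\<lambda>t. contour_integral (linepath u v) (\<lambda>w. f w t))"
        if "closed_segment u v \<subseteq> S" for u v
        by (rule contour_integral_swap)
           (use that im vd vl in \<open>auto intro: continuous_on_subset[OF cont]\<close>)
      have int: "(\<lambda>t. contour_integral (linepath u v) (\<lambda>w. f w t)) contour_integrable_on ?g"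
        if "closed_segment u v \<subseteq> S" for u v
      proof (rule contour_integrable_continuous_circlepath)
        have "continuous_on (sphere z r \<times> closed_segment u v) (\<lambda>y. (\<lambda>(w, t). f w t) (snd y, fst y))"
          by (rule continuous_on_compose2[OF cont]) (use that in \<open>auto intro!: continuous_intros\<close>)
        then show "continuous_on (path_image ?g) (\<lambda>t. contour_integral (linepath u v) (\<lambda>w. f w t))"
          by (intro continuous_on_contour_integral_param)
             (use im vl in \<open>auto simp: case_prod_unfold intro: continuous_on_linepath\<close>)
      qed
      have "contour_integral (linepath a b) (\<lambda>w. contour_integral ?g (f w)) +
         contour_integral (linepath b c) (\<lambda>w. contour_integral ?g (f w)) +
         contour_integral (linepath c a) (\<lambda>w. contour_integral ?g (f w)) =
         contour_integral ?g (\<lambda>t. contour_integral (linepath a b) (\<lambda>w. f w t) +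
            contour_integral (linepath b c) (\<lambda>w. f w t) + contour_integral (linepath c a) (\<lambda>w. f w t))"
        using seg by (simp add: swap int contour_integral_add contour_integrable_add)
      also have "\<dots> = contour_integral ?g (\<lambda>t. 0)"
      proof (rule contour_integral_eq)
        fix t assume t: "t \<in> path_image ?g"
        have h: "(\<lambda>w. f w t) holomorphic_on convex hull {a, b, c}"
          using t im by (intro holomorphic_on_subset[OF hol sub]) blast
        have ci: "(\<lambda>w. f w t) contour_integrable_on linepath u v" if "closed_segment u v \<subseteq> S" for u v
        proof (intro contour_integrable_continuous_linepath holomorphic_on_imp_continuous_on)
          show "(\<lambda>w. f w t) holomorphic_on closed_segment u v"
            using t im by (intro holomorphic_on_subset[OF hol that]) blast
        qed
        have "((\<lambda>w. f w t) has_contour_integral 0) (linepath a b +++ linepath b c +++ linepath c a)"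
          by (rule Cauchy_theorem_triangle[OF h])
        then show "contour_integral (linepath a b) (\<lambda>w. f w t) +
            contour_integral (linepath b c) (\<lambda>w. f w t) + contour_integral (linepath c a) (\<lambda>w. f w t) = 0"
          using seg ci by (auto dest!: contour_integral_unique simp: add_ac)
      qed
      also have "\<dots> = 0" by simp
      finally show "contour_integral (linepath a b) (\<lambda>w. contour_integral ?g (f w)) +
         contour_integral (linepath b c) (\<lambda>w. contour_integral ?g (f w)) +
         contour_integral (linepath c a) (\<lambda>w. contour_integral ?g (f w)) = 0" .
    qed
  qed
  then show ?thesis by (rule analytic_imp_holomorphic)
qed

text \<open>Cauchy's formula writes the Taylor coefficients in \<open>t\<close> as integrals over a
  circle. Joint continuity and separate holomorphy thus suffice, without power series in two
  variables.\<close>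

lemma holomorphic_on_higher_deriv_param:
  fixes f :: "complex \<Rightarrow> complex \<Rightarrow> complex"
  assumes S: "open S" and R: "R > 0"
    and cont: "continuous_on (S \<times> ball 0 R) (\<lambda>(w, t). f w t)"
    and hol1: "\<And>t. t \<in> ball 0 R \<Longrightarrow> (\<lambda>w. f w t) holomorphic_on S"
    and hol2: "\<And>w. w \<in> S \<Longrightarrow> f w holomorphic_on ball 0 R"
  shows "(\<lambda>w. (deriv ^^ j) (f w) 0) holomorphic_on S"
proof -
  define r where "r = R / 2"
  have r: "0 < r" "r < R" using R by (auto simp: r_def)
  have sub: "cball 0 r \<subseteq> ball (0::complex) R" "sphere 0 r \<subseteq> ball (0::complex) R" using r by auto
  have "(\<lambda>w. contour_integral (circlepath 0 r) (\<lambda>t. f w t / t ^ Suc j)) holomorphic_on S"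
  proof (rule holomorphic_on_contour_integral_circlepath_param[OF S r(1)])
    have "continuous_on (S \<times> sphere 0 r) (\<lambda>(w, t). f w t)"
      by (rule continuous_on_subset[OF cont]) (use sub in auto)
    then show "continuous_on (S \<times> sphere 0 r) (\<lambda>(w, t). f w t / t ^ Suc j)"
      using r by (auto simp: case_prod_unfold intro!: continuous_intros)
    show "(\<lambda>w. f w t / t ^ Suc j) holomorphic_on S" if "t \<in> sphere 0 r" for t
      using that sub r hol1[of t] by (auto intro!: holomorphic_intros)
  qed
  then have "(\<lambda>w. contour_integral (circlepath 0 r) (\<lambda>t. f w t / t ^ Suc j) * (fact j / (2 * pi * \<i>))) holomorphic_on S"
    by (intro holomorphic_intros)
  then show ?thesis
  proof (rule holomorphic_transform)
    fix w assume w: "w \<in> S"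
    have "((\<lambda>u. f w u / (u - 0) ^ Suc j) has_contour_integral (2 * pi * \<i> / fact j * (deriv ^^ j) (f w) 0)) (circlepath 0 r)"
    proof (rule Cauchy_has_contour_integral_higher_derivative_circlepath)
      show "continuous_on (cball 0 r) (f w)"
        using hol2[OF w] sub by (meson continuous_on_subset holomorphic_on_imp_continuous_on)
      show "f w holomorphic_on ball 0 r"
        using hol2[OF w] r by (auto intro: holomorphic_on_subset)
    qed (use r in auto)
    then show "contour_integral (circlepath 0 r) (\<lambda>t. f w t / t ^ Suc j) * (fact j / (2 * pi * \<i>)) = (deriv ^^ j) (f w) 0"
      by (simp add: contour_integral_unique)
  qed
qed

lemma holomorphic_quotient_power_limit:
  assumes "f holomorphic_on ball 0 R" "R > 0" "\<And>j. j < m \<Longrightarrow> (deriv ^^ j) f 0 = 0"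
  shows "((\<lambda>t. f t / t ^ m) \<longlongrightarrow> (deriv ^^ m) f 0 / fact m) (at 0)"
proof -
  define a where "a = (\<lambda>n. (deriv ^^ (n + m)) f 0 / fact (n + m))"
  have "((\<lambda>t. f t / t ^ m) \<longlongrightarrow> a 0) (at 0)"
  proof (rule powser_limit_0_strong[OF assms(2)])
    fix t :: complex assume t: "t \<noteq> 0" "norm t < R"
    have "(\<lambda>n. (deriv ^^ n) f 0 / fact n * (t - 0) ^ n) sums f t"
      by (rule holomorphic_power_series[OF assms(1)]) (use t in auto)
    then have "(\<lambda>n. (deriv ^^ (n + m)) f 0 / fact (n + m) * t ^ (n + m)) sums f t"
      by (subst sums_zero_iff_shift) (use assms(3) in auto)
    then have "(\<lambda>n. (deriv ^^ (n + m)) f 0 / fact (n + m) * t ^ (n + m) / t ^ m) sums (f t / t ^ m)"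
      by (rule sums_divide)
    then show "(\<lambda>n. a n * t ^ n) sums (f t / t ^ m)"
      using t by (simp add: a_def power_add)
  qed
  then show ?thesis by (simp add: a_def)
qed

text \<open>Here \<open>m\<close> is the exact order of vanishing of \<open>h\<close>. A finite
  limit of the quotient forces \<open>g\<close> to vanish to order \<open>m\<close> at least;
  conversely the limit is then the quotient of the leading coefficients.\<close>

lemma quotient_limit:
  assumes hol: "g holomorphic_on ball 0 R" "h holomorphic_on ball 0 R" "R > 0"
    and h: "\<And>j. j < m \<Longrightarrow> (deriv ^^ j) h 0 = 0" "(deriv ^^ m) h 0 \<noteq> 0"
    and F: "\<And>t. t \<in> ball 0 R \<Longrightarrow> h t \<noteq> 0 \<Longrightarrow> F t = g t / h t"
  shows "(F \<longlongrightarrow> L) (at 0) \<Longrightarrow> j < m \<Longrightarrow> (deriv ^^ j) g 0 = 0"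
    and "(\<And>j. j < m \<Longrightarrow> (deriv ^^ j) g 0 = 0) \<Longrightarrow> (F \<longlongrightarrow> (deriv ^^ m) g 0 / (deriv ^^ m) h 0) (at 0)"
proof -
  have lh: "((\<lambda>t. h t / t ^ m) \<longlongrightarrow> (deriv ^^ m) h 0 / fact m) (at 0)"
    by (rule holomorphic_quotient_power_limit[OF hol(2,3) h(1)])
  have "eventually (\<lambda>t. h t / t ^ m \<noteq> 0) (at 0)"
    by (rule tendsto_imp_eventually_ne[OF lh]) (use h in auto)
  moreover have "eventually (\<lambda>t. t \<in> ball 0 R - {0}) (at 0)"
    by (rule eventually_at_in_open) (use hol in auto)
  ultimately have ev: "eventually (\<lambda>t. t \<in> ball 0 R \<and> t \<noteq> 0 \<and> h t \<noteq> 0) (at 0)"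
    by eventually_elim auto
  {
    assume L: "(F \<longlongrightarrow> L) (at 0)" and "j < m"
    show "(deriv ^^ j) g 0 = 0"
      using \<open>j < m\<close>
    proof (induction j rule: less_induct)
      case (less j)
      have "((\<lambda>t. g t / t ^ j) \<longlongrightarrow> (deriv ^^ j) g 0 / fact j) (at 0)"
        by (rule holomorphic_quotient_power_limit[OF hol(1,3)]) (use less in auto)
      \<comment> \<open>Near 0 this product equals g / t^j. For j < m the factor t^(m - j) sends it
        to 0, so the coefficient of \<open>g\<close> at t^j vanishes.\<close>
      moreover have "((\<lambda>t. F t * (h t / t ^ m * t ^ (m - j))) \<longlongrightarrow> L * ((deriv ^^ m) h 0 / fact m * 0 ^ (m - j))) (at 0)"
        by (intro tendsto_intros L lh)
      then have "((\<lambda>t. g t / t ^ j) \<longlongrightarrow> L * ((deriv ^^ m) h 0 / fact m * 0 ^ (m - j))) (at 0)"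
      proof (rule Lim_transform_eventually)
        show "eventually (\<lambda>t. F t * (h t / t ^ m * t ^ (m - j)) = g t / t ^ j) (at 0)"
          using ev
        proof eventually_elim
          case (elim t)
          have "t ^ m = t ^ j * t ^ (m - j)" using less.prems by (simp flip: power_add)
          then show ?case using elim F[of t] by (simp add: field_simps)
        qed
      qed
      ultimately have "(deriv ^^ j) g 0 / fact j = L * ((deriv ^^ m) h 0 / fact m * 0 ^ (m - j))"
        by (rule tendsto_unique[OF at_neq_bot])
      then show ?case using less.prems by (simp add: zero_power)
    qed
  }
  assume g: "\<And>j. j < m \<Longrightarrow> (deriv ^^ j) g 0 = 0"
  have "((\<lambda>t. (g t / t ^ m) / (h t / t ^ m)) \<longlongrightarrow> ((deriv ^^ m) g 0 / fact m) / ((deriv ^^ m) h 0 / fact m)) (at 0)"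
    by (intro tendsto_divide lh holomorphic_quotient_power_limit[OF hol(1,3) g]) (use h in auto)
  then have "(F \<longlongrightarrow> ((deriv ^^ m) g 0 / fact m) / ((deriv ^^ m) h 0 / fact m)) (at 0)"
    by (rule Lim_transform_eventually) (use ev in eventually_elim, simp add: F)
  then show "(F \<longlongrightarrow> (deriv ^^ m) g 0 / (deriv ^^ m) h 0) (at 0)" by simp
qed

text \<open>Although \<open>h w\<close> may vanish at t = 0 for every \<open>w\<close>, the limit t
  -> 0 is meromorphic in \<open>w\<close>: both numerator and denominator are divided by the power
  of \<open>t\<close> to which \<open>h\<close> vanishes for generic \<open>w\<close>. That
  \<open>g\<close> vanishes to the same order is known on \<open>S\<close> only and spreads to
  \<open>D\<close> by the identity theorem.\<close>

lemma limit_in_second_variable: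
  fixes g h F :: "complex \<Rightarrow> complex \<Rightarrow> complex"
  assumes D: "open D" "connected D" and R: "R > 0"
    and g: "continuous_on (D \<times> ball 0 R) (\<lambda>(w, t). g w t)"
           "\<And>t. t \<in> ball 0 R \<Longrightarrow> (\<lambda>w. g w t) holomorphic_on D"
           "\<And>w. w \<in> D \<Longrightarrow> g w holomorphic_on ball 0 R"
    and h: "continuous_on (D \<times> ball 0 R) (\<lambda>(w, t). h w t)"
           "\<And>t. t \<in> ball 0 R \<Longrightarrow> (\<lambda>w. h w t) holomorphic_on D"
           "\<And>w. w \<in> D \<Longrightarrow> h w holomorphic_on ball 0 R"
    and nz: "w1 \<in> D" "t1 \<in> ball 0 R" "h w1 t1 \<noteq> 0"
    and F: "\<And>w t. w \<in> D \<Longrightarrow> t \<in> ball 0 R \<Longrightarrow> h w t \<noteq> 0 \<Longrightarrow> F w t = g w t / h w t"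
    and S: "open S" "S \<noteq> {}" "S \<subseteq> D" "\<And>w. w \<in> S \<Longrightarrow> \<exists>L. (F w \<longlongrightarrow> L) (at 0)"
  shows "\<exists>a b. a holomorphic_on D \<and> b holomorphic_on D \<and> (\<exists>w\<in>D. b w \<noteq> 0) \<and>
           (\<forall>w\<in>D. b w \<noteq> 0 \<longrightarrow> (F w \<longlongrightarrow> a w / b w) (at 0))"
proof -
  define cg where "cg = (\<lambda>j w. (deriv ^^ j) (g w) 0)"
  define ch where "ch = (\<lambda>j w. (deriv ^^ j) (h w) 0)"
  have cg: "cg j holomorphic_on D" for j
    unfolding cg_def by (rule holomorphic_on_higher_deriv_param[OF D(1) R g])
  have ch: "ch j holomorphic_on D" for j
    unfolding ch_def by (rule holomorphic_on_higher_deriv_param[OF D(1) R h])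
  have "\<exists>j. \<exists>w\<in>D. ch j w \<noteq> 0"
  proof (rule ccontr)
    assume "\<not> ?thesis"
    then have "h w1 t1 = 0"
      using nz unfolding ch_def by (intro holomorphic_fun_eq_0_on_ball[OF h(3)]) auto
    then show False using nz by simp
  qed
  \<comment> \<open>The generic order of vanishing of \<open>h\<close> in \<open>t\<close>: lower
    coefficients are 0 on all of \<open>D\<close>, and the coefficient of index \<open>m\<close> is
    not identically 0.\<close>
  define m where "m = (LEAST j. \<exists>w\<in>D. ch j w \<noteq> 0)"
  have m: "\<exists>w\<in>D. ch m w \<noteq> 0" unfolding m_def by (rule LeastI_ex) fact
  have less_m: "ch j w = 0" if "j < m" "w \<in> D" for j w
    using not_less_Least[of j "\<lambda>j. \<exists>w\<in>D. ch j w \<noteq> 0"] that unfolding m_def by auto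
  define S' where "S' = {w \<in> S. ch m w \<noteq> 0}"
  have "continuous_on S (ch m)"
    by (rule continuous_on_subset[OF holomorphic_on_imp_continuous_on[OF ch] S(3)])
  then have S'o: "open S'"
  proof -
    have "openin (top_of_set S) (S \<inter> ch m -` (- {0}))"
      by (rule continuous_openin_preimage_gen[OF \<open>continuous_on S (ch m)\<close>]) auto
    moreover have "S' = S \<inter> ch m -` (- {0})" by (auto simp: S'_def)
    ultimately show ?thesis using S(1) by (simp add: openin_open_eq)
  qed
  have S'ne: "S' \<noteq> {}"
  proof
    assume "S' = {}"
    then have "ch m u = 0" if "u \<in> S" for u using that by (auto simp: S'_def)
    then have "ch m w = 0" if "w \<in> D" for w
      by (rule analytic_continuation_open[OF S(1) D(1) S(2) D(2) S(3) ch holomorphic_on_const _ that])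
    then show False using m by auto
  qed
  \<comment> \<open>On \<open>S'\<close> the order of \<open>h\<close> is exactly \<open>m\<close>
    and a finite limit exists, so the lower coefficients of \<open>g\<close> vanish there, and by
    the identity theorem on all of \<open>D\<close>.\<close>
  have gz: "cg j w = 0" if "j < m" "w \<in> D" for j w
  proof (rule analytic_continuation_open[OF S'o D(1) S'ne D(2) _ cg holomorphic_on_const _ that(2)])
    show "S' \<subseteq> D" using S(3) by (auto simp: S'_def)
    fix w assume w: "w \<in> S'"
    then have wD: "w \<in> D" and wS: "w \<in> S" and chw: "ch m w \<noteq> 0" using S(3) by (auto simp: S'_def)
    obtain L where L: "(F w \<longlongrightarrow> L) (at 0)" using S(4)[OF wS] by blast
    show "cg j w = 0" unfolding cg_def
    proof (rule quotient_limit(1)[OF g(3)[OF wD] h(3)[OF wD] R _ _ _ L that(1)])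
      show "(deriv ^^ i) (h w) 0 = 0" if "i < m" for i using less_m[OF that wD] by (simp add: ch_def)
      show "(deriv ^^ m) (h w) 0 \<noteq> 0" using chw by (simp add: ch_def)
    qed (rule F[OF wD])
  qed
  show ?thesis
  proof (intro exI conjI ballI impI)
    show "cg m holomorphic_on D" "ch m holomorphic_on D" "\<exists>w\<in>D. ch m w \<noteq> 0" by (fact cg ch m)+
    fix w assume w: "w \<in> D" "ch m w \<noteq> 0"
    show "(F w \<longlongrightarrow> cg m w / ch m w) (at 0)"
      unfolding cg_def ch_def
    proof (rule quotient_limit(2)[OF g(3)[OF w(1)] h(3)[OF w(1)] R])
      show "(deriv ^^ i) (h w) 0 = 0" if "i < m" for i using less_m[OF that w(1)] by (simp add: ch_def)
      show "(deriv ^^ i) (g w) 0 = 0" if "i < m" for i using gz[OF that w(1)] by (simp add: cg_def)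
      show "(deriv ^^ m) (h w) 0 \<noteq> 0" using w(2) by (simp add: ch_def)
    qed (rule F[OF w(1)])
  qed
qed

section \<open>Holomorphic functions of several variables along complex lines\<close>

lemma norm_vector_scalar_mult_complex: "norm (k *s (v :: complex ^ 'n)) = norm k * norm v"
  unfolding norm_vec_def by (simp add: L2_set_right_distrib norm_mult)

lemma bounded_linear_vector_scalar_mult: "bounded_linear (\<lambda>k. k *s (v :: complex ^ 'n))"
  by (rule bounded_linear_intro[of _ "norm v"])
     (auto simp: norm_vector_scalar_mult_complex vec_eq_iff distrib_left distrib_right mult.commute)

lemma bounded_linear_vector_scalar_mult_right: "bounded_linear (\<lambda>v. k *s (v :: complex ^ 'n))"
  by (rule bounded_linear_intro[of _ "norm k"])
     (auto simp: norm_vector_scalar_mult_complex vec_eq_iff distrib_left distrib_right mult.commute)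

lemma continuous_on_vector_scalar_mult [continuous_intros]:
  fixes v :: "complex ^ 'n"
  shows "continuous_on S f \<Longrightarrow> continuous_on S (\<lambda>x. f x *s v)"
  by (rule bounded_linear.continuous_on[OF bounded_linear_vector_scalar_mult])

text \<open>Compatibility of the derivative with complex scalars turns the real chain rule into a
  complex derivative along the line.\<close>

lemma holomorphic_vec_on_line:
  fixes f :: "complex ^ 'n \<Rightarrow> complex"
  assumes "holomorphic_vec_on f U" "\<And>t. t \<in> S \<Longrightarrow> y + t *s v \<in> U"
  shows "(\<lambda>t. f (y + t *s v)) holomorphic_on S"
  unfolding holomorphic_on_def
proof
  fix t assume "t \<in> S"
  then obtain D where D: "(f has_derivative D) (at (y + t *s v))" "\<And>k v. D (k *s v) = k * D v"
    using assms unfolding holomorphic_vec_on_def by blast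
  have "((\<lambda>t. y + t *s v) has_derivative (\<lambda>h. 0 + h *s v)) (at t within S)"
    by (intro has_derivative_add has_derivative_const bounded_linear_imp_has_derivative bounded_linear_vector_scalar_mult)
  then have "((\<lambda>t. f (y + t *s v)) has_derivative (\<lambda>h. D (0 + h *s v))) (at t within S)"
    by (rule has_derivative_compose[where f = "\<lambda>t. y + t *s v" and g = f and g' = D, OF _ D(1)])
  then have "((\<lambda>t. f (y + t *s v)) has_field_derivative D v) (at t within S)"
    by (simp add: has_field_derivative_def D(2) mult_commute_abs)
  then show "(\<lambda>t. f (y + t *s v)) field_differentiable at t within S"
    by (auto simp: field_differentiable_def)
qed

lemma holomorphic_vec_on_imp_continuous_on:
  assumes "holomorphic_vec_on f U"
  shows "continuous_on U f"
  using assms unfolding holomorphic_vec_on_def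
  by (metis continuous_at_imp_continuous_on has_derivative_continuous)

text \<open>The complex line from \<open>y'\<close> to \<open>x\<close> meets the ball in a convex
  set of parameters. The restriction of \<open>h\<close> to it vanishes near parameter 0, hence also
  at parameter 1, which is \<open>x\<close>.\<close>

lemma holomorphic_vec_on_zero_ball:
  fixes h :: "complex ^ 'n \<Rightarrow> complex"
  assumes h: "holomorphic_vec_on h (ball y r)" and N: "open N" "y' \<in> N" "y' \<in> ball y r"
    and z: "\<And>u. u \<in> N \<Longrightarrow> h u = 0" and x: "x \<in> ball y r"
  shows "h x = 0"
proof -
  define T where "T = (\<lambda>t. t *s (x - y')) -` ball (y - y') r"
  have T: "t \<in> T \<longleftrightarrow> y' + t *s (x - y') \<in> ball y r" for t
    by (simp add: T_def dist_norm algebra_simps)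
  have To: "open T" unfolding T_def
    by (rule open_vimage) (auto intro!: continuous_intros)
  have "convex T" unfolding T_def
    by (rule convex_linear_vimage[OF bounded_linear.linear[OF bounded_linear_vector_scalar_mult] convex_ball])
  then have Tc: "connected T" by (rule convex_connected)
  define N' where "N' = T \<inter> (\<lambda>t. y' + t *s (x - y')) -` N"
  have "open N'" unfolding N'_def
    by (intro open_Int To open_vimage N) (auto intro!: continuous_intros)
  moreover have "0 \<in> N'" using N by (simp add: N'_def T)
  moreover have "N' \<subseteq> T" by (auto simp: N'_def)
  moreover have "(\<lambda>t. h (y' + t *s (x - y'))) holomorphic_on T"
    by (rule holomorphic_vec_on_line[OF h]) (simp only: T)
  moreover have "1 \<in> T" using x by (simp add: T)
  moreover have "h (y' + t *s (x - y')) = 0" if "t \<in> N'" for t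
    using that z by (auto simp: N'_def)
  ultimately have "h (y' + 1 *s (x - y')) = 0"
    using analytic_continuation_open[of N' T "\<lambda>t. h (y' + t *s (x - y'))" "\<lambda>_. 0" 1] To Tc by auto
  then show ?thesis by simp
qed

text \<open>The interior of the zero set is open, and relatively closed in \<open>U\<close> by
  \<open>holomorphic_vec_on_zero_ball\<close>; connectedness then excludes a zero set with non-empty
  interior.\<close>

lemma holomorphic_vec_on_nonzero_dense:
  fixes h :: "complex ^ 'n \<Rightarrow> complex"
  assumes h: "holomorphic_vec_on h U" and U: "open U" "connected U" and nz: "w1 \<in> U" "h w1 \<noteq> 0"
    and B: "open B" "B \<noteq> {}" "B \<subseteq> U"
  shows "\<exists>y\<in>B. h y \<noteq> 0"
proof (rule ccontr)
  assume "\<not> ?thesis"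
  then have hB: "h y = 0" if "y \<in> B" for y using that by auto
  define Z where "Z = interior {y \<in> U. h y = 0}"
  have Zo: "open Z" by (simp add: Z_def)
  have ZU: "Z \<subseteq> U" "\<And>y. y \<in> Z \<Longrightarrow> h y = 0" using interior_subset by (fastforce simp: Z_def)+
  have BZ: "B \<subseteq> Z" unfolding Z_def using B hB by (intro interior_maximal) auto
  have "open (U - Z)"
    unfolding open_contains_ball
  proof
    fix y assume y: "y \<in> U - Z"
    then obtain r where r: "r > 0" "ball y r \<subseteq> U" using U open_contains_ball by blast
    have hol: "holomorphic_vec_on h (ball y r)" using h r unfolding holomorphic_vec_on_def by blast
    have "ball y r \<inter> Z = {}"
    proof (rule ccontr)
      assume "ball y r \<inter> Z \<noteq> {}"
      then obtain y' where y': "y' \<in> ball y r" "y' \<in> Z" by auto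
      have "h x = 0" if "x \<in> ball y r" for x
        by (rule holomorphic_vec_on_zero_ball[OF hol Zo y'(2) y'(1) ZU(2) that])
      then have "ball y r \<subseteq> Z" unfolding Z_def using r by (intro interior_maximal) auto
      moreover have "y \<in> ball y r" using r by simp
      ultimately show False using y by blast
    qed
    then show "\<exists>e>0. ball y e \<subseteq> U - Z" using r by auto
  qed
  then have "Z \<inter> U = {} \<or> (U - Z) \<inter> U = {}"
    by (intro connectedD[OF U(2) Zo]) auto
  then show False using BZ B nz ZU by blast
qed

text \<open>A local quotient g / h for \<open>G\<close> around the point with parameter
  \<open>w0\<close> on the line. The last clause thickens the line in every direction
  \<open>v\<close> of norm at most 1 with one and the same radius, because \<open>v\<close> is
  chosen only after all charts are fixed.\<close>

definition line_chart :: "(complex ^ 'n \<Rightarrow> complex) \<Rightarrow> complex ^ 'n \<Rightarrow> complex ^ 'n \<Rightarrow> complex \<Rightarrow> real \<Rightarrow>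
    (complex ^ 'n \<Rightarrow> complex) \<Rightarrow> (complex ^ 'n \<Rightarrow> complex) \<Rightarrow> (complex ^ 'n) set \<Rightarrow> bool" where
  "line_chart G z0 e w0 r g h U \<longleftrightarrow> r > 0 \<and> open U \<and> connected U \<and> holomorphic_vec_on g U \<and> holomorphic_vec_on h U \<and>
     (\<exists>y\<in>U. h y \<noteq> 0) \<and> (\<forall>y\<in>U. h y \<noteq> 0 \<longrightarrow> G y = g y / h y) \<and>
     (\<forall>w\<in>ball w0 r. \<forall>t\<in>ball 0 r. \<forall>v. norm v \<le> 1 \<longrightarrow> z0 + w *s e + t *s v \<in> U)"

lemma line_chart_exists:
  assumes "meromorphic_vec G"
  shows "\<exists>r g h U. line_chart G z0 e w0 r g h U"
proof -
  obtain U g h where U: "open U" "connected U" "z0 + w0 *s e \<in> U"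
        "holomorphic_vec_on g U" "holomorphic_vec_on h U" "\<exists>w\<in>U. h w \<noteq> 0"
        "\<forall>w\<in>U. h w \<noteq> 0 \<longrightarrow> G w = g w / h w"
    using assms unfolding meromorphic_vec_def by blast
  obtain \<epsilon> where \<epsilon>: "\<epsilon> > 0" "ball (z0 + w0 *s e) \<epsilon> \<subseteq> U" using U open_contains_ball by blast
  \<comment> \<open>Displacements of size \<open>r\<close> along \<open>e\<close> and along a vector
    of norm at most 1 together stay below r * (norm e + 1), which is the radius of the ball inside
    \<open>U\<close>.\<close>
  define r where "r = \<epsilon> / (norm e + 1)"
  have ne: "norm e + 1 > 0" by (smt (verit) norm_ge_zero)
  have r: "r > 0" "r * (norm e + 1) = \<epsilon>" unfolding r_def using ne \<epsilon> by auto
  have "z0 + w *s e + t *s v \<in> U" if *: "w \<in> ball w0 r" "t \<in> ball 0 r" "norm v \<le> 1" for w t v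
  proof -
    have "z0 + w *s e + t *s v - (z0 + w0 *s e) = (w - w0) *s e + t *s v"
      by (simp add: vec_eq_iff algebra_simps)
    then have "norm (z0 + w *s e + t *s v - (z0 + w0 *s e)) \<le> norm (w - w0) * norm e + norm t * norm v"
      by (metis norm_triangle_ineq norm_vector_scalar_mult_complex)
    also have "\<dots> < r * (norm e + 1)"
    proof -
      have "norm (w - w0) * norm e \<le> r * norm e" using *(1) by (intro mult_right_mono) (auto simp: dist_norm norm_minus_commute)
      moreover have "norm t * norm v \<le> norm t * 1" using * by (intro mult_left_mono) auto
      moreover have "norm t < r" using * by simp
      ultimately show ?thesis by (simp add: algebra_simps)
    qed
    finally have "z0 + w *s e + t *s v \<in> ball (z0 + w0 *s e) \<epsilon>"
      by (metis dist_commute dist_norm mem_ball r(2))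
    then show ?thesis using \<epsilon> by blast
  qed
  then show ?thesis unfolding line_chart_def using r U by blast
qed

text \<open>Baire's theorem: for one chart the admissible \<open>v\<close> form an open dense subset
  of the closed unit ball, and there are countably many charts. Non-vanishing at the single
  parameter \<open>r w / 2\<close> already prevents the denominator from vanishing identically on
  the plane spanned by the line and \<open>v\<close>.\<close>

lemma generic_direction:
  fixes G :: "complex ^ 'n \<Rightarrow> complex"
  assumes ch: "\<And>w. line_chart G z0 e w (r w) (g w) (h w) (U w)" and K: "countable K"
  shows "\<exists>v. norm v \<le> 1 \<and> (\<forall>w\<in>K. h w (z0 + w *s e + of_real (r w / 2) *s v) \<noteq> 0)"
proof -
  define V where "V = (\<lambda>w. {v \<in> cball 0 1. h w (z0 + w *s e + of_real (r w / 2) *s v) \<noteq> 0})"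
  have "cball 0 1 \<subseteq> closure (\<Inter> (V ` K))"
  proof (rule Baire)
    fix T assume "T \<in> V ` K"
    then obtain w where T: "T = V w" by auto
    define \<phi> where "\<phi> = (\<lambda>v. z0 + w *s e + of_real (r w / 2) *s v)"
    have r: "r w > 0" and U: "open (U w)" "connected (U w)" and h: "holomorphic_vec_on (h w) (U w)"
      and nz: "\<exists>y\<in>U w. h w y \<noteq> 0" using ch[of w] unfolding line_chart_def by blast+
    have half: "complex_of_real (r w / 2) \<in> ball 0 (r w)" using r by simp
    have \<phi>U: "\<phi> v \<in> U w" if "norm v \<le> 1" for v
    proof -
      have "\<forall>w'\<in>ball w (r w). \<forall>t\<in>ball 0 (r w). \<forall>v. norm v \<le> 1 \<longrightarrow> z0 + w' *s e + t *s v \<in> U w"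
        using ch[of w] unfolding line_chart_def by blast
      moreover have "w \<in> ball w (r w)" using r by simp
      ultimately show ?thesis unfolding \<phi>_def using half that by blast
    qed
    have c\<phi>: "continuous_on S \<phi>" for S
      unfolding \<phi>_def by (intro continuous_intros bounded_linear.continuous_on[OF bounded_linear_vector_scalar_mult_right])
    have "continuous_on (cball 0 1) (\<lambda>v. h w (\<phi> v))"
      by (rule continuous_on_compose2[OF holomorphic_vec_on_imp_continuous_on[OF h] c\<phi>]) (use \<phi>U in auto)
    then have "openin (top_of_set (cball 0 1)) (cball 0 1 \<inter> (\<lambda>v. h w (\<phi> v)) -` (- {0}))"
      by (rule continuous_openin_preimage_gen) auto
    moreover have "V w = cball 0 1 \<inter> (\<lambda>v. h w (\<phi> v)) -` (- {0})" by (auto simp: V_def \<phi>_def)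
    moreover have "cball 0 1 \<subseteq> closure (V w)"
    proof
      fix v :: "complex ^ 'n" assume v: "v \<in> cball 0 1"
      show "v \<in> closure (V w)"
        unfolding closure_iff_nhds_not_empty
      proof (intro allI impI)
        fix A N assume N: "N \<subseteq> A" "open N" "v \<in> N"
        \<comment> \<open>The neighbourhood is cut down to the open unit ball, so that its image is
          an open set inside \<open>U w\<close>.\<close>
        have "v \<in> closure (ball 0 1)" using v by simp
        then have "ball 0 1 \<inter> N \<noteq> {}" using N by (meson closure_iff_nhds_not_empty subset_refl)
        define N' where "N' = ball 0 1 \<inter> N"
        have N': "open N'" "N' \<noteq> {}" using N \<open>ball 0 1 \<inter> N \<noteq> {}\<close> by (auto simp: N'_def)
        define \<psi> where "\<psi> = (\<lambda>y. of_real (2 / r w) *s (y - (z0 + w *s e)))"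
        \<comment> \<open>\<open>\<psi>\<close> is the affine inverse of \<open>\<phi>\<close>;
          images under \<open>\<phi>\<close> are open because they are preimages under the
          continuous map \<open>\<psi>\<close>.\<close>
        have "\<phi> ` N' = \<psi> -` N'"
        proof -
          have c: "complex_of_real (2 / r w) * complex_of_real (r w / 2) = 1"
            using r by (simp flip: of_real_mult)
          have 1: "\<psi> (\<phi> v) = v" for v
            unfolding \<psi>_def \<phi>_def add_diff_cancel_left' vector_smult_assoc c by simp
          have 2: "\<phi> (\<psi> v) = v" for v
            unfolding \<psi>_def \<phi>_def vector_smult_assoc mult.commute[of "complex_of_real (r w / 2)"] c by simp
          show ?thesis
          proof (intro subset_antisym subsetI)
            fix y assume "y \<in> \<psi> -` N'"
            then have "\<psi> y \<in> N'" by simp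
            then show "y \<in> \<phi> ` N'" using 2[of y] by (metis imageI)
          next
            fix y assume "y \<in> \<phi> ` N'"
            then show "y \<in> \<psi> -` N'" using 1 by fastforce
          qed
        qed
        moreover have "open (\<psi> -` N')"
          by (rule open_vimage[OF N'(1)])
             (unfold \<psi>_def, intro continuous_intros bounded_linear.continuous_on[OF bounded_linear_vector_scalar_mult_right])
        moreover have "\<phi> ` N' \<subseteq> U w" using \<phi>U by (auto simp: N'_def)
        ultimately obtain y where "y \<in> \<phi> ` N'" "h w y \<noteq> 0"
          using holomorphic_vec_on_nonzero_dense[OF h U, of _ "\<phi> ` N'"] nz N' by (metis image_is_empty)
        then obtain x where "x \<in> N'" "h w (\<phi> x) \<noteq> 0" by blast
        then have "x \<in> V w \<inter> A" using N by (auto simp: V_def N'_def \<phi>_def)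
        then show "V w \<inter> A \<noteq> {}" by blast
      qed
    qed
    ultimately show "openin (top_of_set (cball 0 1)) T \<and> cball 0 1 \<subseteq> closure T"
      using T by simp
  qed (use K in auto)
  then have "0 \<in> closure (\<Inter> (V ` K))" by auto
  then have "\<Inter> (V ` K) \<noteq> {}" by (metis closure_empty empty_iff)
  then obtain v where v: "v \<in> \<Inter> (V ` K)" by (meson ex_in_conv)
  show ?thesis
  \<comment> \<open>An empty intersection is the whole space, and then the bound on the norm of
    \<open>v\<close> would be lost.\<close>
  proof (cases "K = {}")
    case True
    then show ?thesis by (intro exI[of _ 0]) auto
  next
    case False
    then show ?thesis using v by (intro exI[of _ v]) (auto simp: V_def)
  qed
qed

text \<open>A complex line may lie in the zero set of a local denominator. The restriction of \<open>G\<close> to the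
  line is therefore taken as a limit along a generic direction \<open>v\<close>; if this limit is finite near one
  point of the line, it is finite outside a discrete set.\<close>

lemma meromorphic_vec_line:
  fixes G :: "complex ^ 'n \<Rightarrow> complex"
  assumes G: "meromorphic_vec G"
    and W: "open W" "W \<noteq> {}" "\<And>w. w \<in> W \<Longrightarrow> isCont G (z0 + w *s e)"
  shows "\<exists>H. H meromorphic_on UNIV \<and> (\<forall>w. isCont G (z0 + w *s e) \<longrightarrow> H w = G (z0 + w *s e))"
proof -
  have "\<forall>w. \<exists>r g h U. line_chart G z0 e w r g h U" using line_chart_exists[OF G] by blast
  then obtain r g h U where ch: "\<And>w. line_chart G z0 e w (r w) (g w) (h w) (U w)" by metis
  have r: "r w > 0" for w using ch[of w] unfolding line_chart_def by blast
  \<comment> \<open>Countably many discs cover the plane, so that \<open>v\<close> has to avoid only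
    countably many denominators.\<close>
  obtain \<F> where \<F>: "\<F> \<subseteq> range (\<lambda>w. ball w (r w))" "countable \<F>" "\<Union>\<F> = \<Union>(range (\<lambda>w. ball w (r w)))"
    by (rule Lindelof[of "range (\<lambda>w. ball w (r w))"]) auto
  then obtain K where K: "countable K" "\<F> = (\<lambda>w. ball w (r w)) ` K"
    using countable_subset_image[of \<F> "\<lambda>w. ball w (r w)" UNIV] by blast
  have cover: "\<exists>k\<in>K. w \<in> ball k (r k)" for w
  proof -
    have "w \<in> \<Union>\<F>" unfolding \<F>(3) using r centre_in_ball by blast
    then show ?thesis unfolding K(2) by blast
  qed
  obtain v where v: "norm v \<le> 1" "\<And>w. w \<in> K \<Longrightarrow> h w (z0 + w *s e + of_real (r w / 2) *s v) \<noteq> 0"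
    using generic_direction[OF ch K(1)] by blast
  define F where "F = (\<lambda>w t. G (z0 + w *s e + t *s v))"
  define good where "good = (\<lambda>w. \<exists>L. (F w \<longlongrightarrow> L) (at 0))"
  define H where "H = (\<lambda>w. Lim (at 0) (F w))"
  have cont: "(F w \<longlongrightarrow> G (z0 + w *s e)) (at 0)" if "isCont G (z0 + w *s e)" for w
    unfolding F_def
  proof (rule isCont_tendsto_compose[OF that])
    have "((\<lambda>t. z0 + w *s e + t *s v) \<longlongrightarrow> z0 + w *s e + 0 *s v) (at 0)"
      by (intro tendsto_intros bounded_linear.tendsto[OF bounded_linear_vector_scalar_mult])
    then show "((\<lambda>t. z0 + w *s e + t *s v) \<longlongrightarrow> z0 + w *s e) (at 0)" by simp
  qed
  have local: "\<exists>a b. a holomorphic_on ball k (r k) \<and> b holomorphic_on ball k (r k) \<and> (\<exists>w\<in>ball k (r k). b w \<noteq> 0) \<and>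
           (\<forall>w\<in>ball k (r k). b w \<noteq> 0 \<longrightarrow> (F w \<longlongrightarrow> a w / b w) (at 0))"
    if k: "k \<in> K" and S: "open S" "S \<noteq> {}" "S \<subseteq> ball k (r k)" "\<And>w. w \<in> S \<Longrightarrow> good w" for k S
  proof -
    have U: "z0 + w *s e + t *s v \<in> U k" if "w \<in> ball k (r k)" "t \<in> ball 0 (r k)" for w t
      using ch[of k] v that unfolding line_chart_def by blast
    have hol: "continuous_on (ball k (r k) \<times> ball 0 (r k)) (\<lambda>(w, t). f (z0 + w *s e + t *s v))"
      "\<And>t. t \<in> ball 0 (r k) \<Longrightarrow> (\<lambda>w. f (z0 + w *s e + t *s v)) holomorphic_on ball k (r k)"
      "\<And>w. w \<in> ball k (r k) \<Longrightarrow> (\<lambda>t. f (z0 + w *s e + t *s v)) holomorphic_on ball 0 (r k)"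
      if f: "holomorphic_vec_on f (U k)" for f
    proof -
      show "continuous_on (ball k (r k) \<times> ball 0 (r k)) (\<lambda>(w, t). f (z0 + w *s e + t *s v))"
        unfolding case_prod_unfold
        by (rule continuous_on_compose2[OF holomorphic_vec_on_imp_continuous_on[OF f]])
           (use U in \<open>auto intro!: continuous_intros\<close>)
      show "(\<lambda>w. f (z0 + w *s e + t *s v)) holomorphic_on ball k (r k)" if t: "t \<in> ball 0 (r k)" for t
      proof -
        have eq: "z0 + w *s e + t *s v = (z0 + t *s v) + w *s e" for w by simp
        show ?thesis unfolding eq
          by (rule holomorphic_vec_on_line[OF f]) (use U t in \<open>simp only: eq[symmetric]\<close>)
      qed
      show "(\<lambda>t. f (z0 + w *s e + t *s v)) holomorphic_on ball 0 (r k)" if w: "w \<in> ball k (r k)" for w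
        by (rule holomorphic_vec_on_line[OF f]) (use U w in blast)
    qed
    have gh: "holomorphic_vec_on (g k) (U k)" "holomorphic_vec_on (h k) (U k)"
      "\<And>y. y \<in> U k \<Longrightarrow> h k y \<noteq> 0 \<Longrightarrow> G y = g k y / h k y"
      using ch[of k] unfolding line_chart_def by blast+
    show ?thesis
    proof (rule limit_in_second_variable[OF _ _ r hol[OF gh(1)] hol[OF gh(2)]])
      show "k \<in> ball k (r k)" "complex_of_real (r k / 2) \<in> ball 0 (r k)" using r[of k] by auto
      show "h k (z0 + k *s e + complex_of_real (r k / 2) *s v) \<noteq> 0" by (rule v(2)[OF k])
      show "F w t = g k (z0 + w *s e + t *s v) / h k (z0 + w *s e + t *s v)"
        if "w \<in> ball k (r k)" "t \<in> ball 0 (r k)" "h k (z0 + w *s e + t *s v) \<noteq> 0" for w t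
        unfolding F_def using gh(3) U that by blast
      show "\<exists>L. (F w \<longlongrightarrow> L) (at 0)" if "w \<in> S" for w using S(4)[OF that] unfolding good_def .
    qed (use S in auto)
  qed
  \<comment> \<open>The points around which the limit is finite in a punctured neighbourhood. This
    set turns out to be open, closed and non-empty, hence the whole plane.\<close>
  define E where "E = {w. eventually good (at w)}"
  have E_nbhd: "\<exists>S. open S \<and> w \<in> S \<and> (\<forall>y\<in>S. y \<noteq> w \<longrightarrow> good y)" if "w \<in> E" for w
    using that by (simp add: E_def eventually_at_topological)
  have E_punct: "\<exists>S. open S \<and> S \<noteq> {} \<and> S \<subseteq> A \<and> (\<forall>w\<in>S. good w)" if w: "w \<in> E" "open A" "w \<in> A" for w A
  proof -
    obtain S where S: "open S" "w \<in> S" "\<And>y. y \<in> S \<Longrightarrow> y \<noteq> w \<Longrightarrow> good y"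
      using E_nbhd[OF w(1)] by blast
    have "(S \<inter> A) - {w} \<noteq> {}"
    proof
      assume "(S \<inter> A) - {w} = {}"
      then have "S \<inter> A = {w}" using S w by auto
      then show False using not_open_singleton[of w] S that by (metis open_Int)
    qed
    then show ?thesis using S w by (intro exI[of _ "S \<inter> A - {w}"]) (auto intro: open_delete)
  qed
  \<comment> \<open>As soon as \<open>E\<close> meets the disc of a chart, \<open>local\<close>
    represents the limit as a quotient on the whole disc, which therefore lies in \<open>E\<close>.
    Hence the complement of \<open>E\<close> is open as well.\<close>
  have loc2: "w \<in> E \<and> (\<exists>a b. a analytic_on {w} \<and> b analytic_on {w} \<and> eventually (\<lambda>x. H x = a x / b x) (at w))"
    if k: "k \<in> K" "w \<in> ball k (r k)" and ne: "E \<inter> ball k (r k) \<noteq> {}" for k w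
  proof -
    obtain w' where "w' \<in> E" "w' \<in> ball k (r k)" using ne by auto
    then obtain S where S: "open S" "S \<noteq> {}" "S \<subseteq> ball k (r k)" "\<And>w. w \<in> S \<Longrightarrow> good w"
      using E_punct[of w' "ball k (r k)"] by auto
    obtain a b where ab: "a holomorphic_on ball k (r k)" "b holomorphic_on ball k (r k)" "\<exists>w\<in>ball k (r k). b w \<noteq> 0"
           "\<And>w. w\<in>ball k (r k) \<Longrightarrow> b w \<noteq> 0 \<Longrightarrow> (F w \<longlongrightarrow> a w / b w) (at 0)"
      using local[OF k(1) S] by blast
    have "eventually (\<lambda>x. b x \<noteq> 0 \<and> x \<in> ball k (r k)) (at w)"
    proof -
      obtain w1 where "w1 \<in> ball k (r k)" "b w1 \<noteq> 0" using ab(3) by blast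
      then show ?thesis using non_zero_neighbour_alt[OF ab(2) open_ball connected_ball k(2)] by blast
    qed
    then have ev: "eventually (\<lambda>x. (F x \<longlongrightarrow> a x / b x) (at 0)) (at w)"
      by eventually_elim (use ab in auto)
    have "w \<in> E" unfolding E_def good_def using ev by (auto elim: eventually_mono)
    moreover have "eventually (\<lambda>x. H x = a x / b x) (at w)"
      using ev by eventually_elim (auto simp: H_def intro: tendsto_Lim)
    moreover have "a analytic_on {w}" "b analytic_on {w}"
      using ab(1,2) k(2) open_ball unfolding analytic_at by blast+
    ultimately show ?thesis by blast
  qed
  have "\<exists>T. open T \<and> w \<in> T \<and> T \<subseteq> E" if w: "w \<in> E" for w
  proof -
    obtain S where S: "open S" "w \<in> S" "\<And>y. y \<in> S \<Longrightarrow> y \<noteq> w \<Longrightarrow> good y"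
      using E_nbhd[OF w] by blast
    have "y \<in> E" if y: "y \<in> S" for y
    proof (cases "y = w")
      case False
      have "open (S - {w})" using S by (auto intro: open_delete)
      moreover have "y \<in> S - {w}" "\<forall>u\<in>S - {w}. u \<noteq> y \<longrightarrow> good u" using False y S by auto
      ultimately show ?thesis unfolding E_def eventually_at_topological mem_Collect_eq by metis
    next
      case True
      then show ?thesis using w by simp
    qed
    then show ?thesis using S(1,2) by blast
  qed
  then have "open E" by (metis open_subopen)
  have "\<exists>T. open T \<and> w \<in> T \<and> T \<subseteq> - E" if w: "w \<in> - E" for w
  proof -
    obtain k where k: "k \<in> K" "w \<in> ball k (r k)" using cover by blast
    then have "E \<inter> ball k (r k) = {}" using loc2[OF k] w by blast
    then show ?thesis using k by (intro exI[of _ "ball k (r k)"]) auto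
  qed
  then have "open (- E)" by (metis open_subopen)
  have "E \<noteq> {}"
  proof -
    obtain w where w: "w \<in> W" using W by auto
    have "good y" if "y \<in> W" for y using cont[OF W(3)[OF that]] unfolding good_def by blast
    then have "w \<in> E" unfolding E_def eventually_at_topological mem_Collect_eq using W(1) w by metis
    then show ?thesis by blast
  qed
  then have "E = UNIV"
    using \<open>open E\<close> \<open>open (- E)\<close> connectedD[of "UNIV :: complex set" E "- E"] connected_UNIV by auto
  then have quot: "\<exists>a b. a analytic_on {w} \<and> b analytic_on {w} \<and> eventually (\<lambda>x. H x = a x / b x) (at w)" for w
    using cover[of w] loc2[of _ w] by blast
  have "H meromorphic_on {w}" for w
  proof -
    obtain a b where ab: "a analytic_on {w}" "b analytic_on {w}" "eventually (\<lambda>x. H x = a x / b x) (at w)"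
      using quot by blast
    have "(\<lambda>x. a x / b x) meromorphic_on {w}" using ab by (intro meromorphic_intros analytic_on_imp_meromorphic_on)
    then show ?thesis using ab(3) by (subst meromorphic_on_cong) auto
  qed
  then have "H meromorphic_on UNIV" by (metis meromorphic_on_meromorphic_at)
  moreover have "H w = G (z0 + w *s e)" if "isCont G (z0 + w *s e)" for w
    unfolding H_def by (rule tendsto_Lim[OF _ cont[OF that]]) simp
  ultimately show ?thesis by blast
qed

section \<open>The Riemann zeta-function and its alternating variant\<close>

text \<open>The iterated differences of z^(-s) with step 1, signed for Euler's transformation of the
  alternating series.\<close>

fun diff_powr :: "nat \<Rightarrow> complex \<Rightarrow> complex \<Rightarrow> complex" where
  "diff_powr 0 s z = z powr (- s)"
| "diff_powr (Suc k) s z = diff_powr k s z - diff_powr k s (z + 1)"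

lemma Re_pos_not_nonpos: "Re z > 0 \<Longrightarrow> z \<notin> \<real>\<^sub>\<le>\<^sub>0"
  by (auto simp: complex_nonpos_Reals_iff)

lemma diff_powr_has_field_derivative:
  assumes "Re z > 0"
  shows "(diff_powr k s has_field_derivative (- s * diff_powr k (s + 1) z)) (at z within S)"
  using assms
proof (induction k arbitrary: z S)
  case 0
  have "((\<lambda>z. z powr (- s)) has_field_derivative (- s * z powr (- s - 1))) (at z within S)"
    by (rule has_field_derivative_at_within[OF has_field_derivative_powr[OF Re_pos_not_nonpos[OF 0]]])
  moreover have "diff_powr 0 s = (\<lambda>z. z powr (- s))" by (rule ext) simp
  moreover have "- (s + 1) = - s - 1" by simp
  ultimately show ?case by (simp only: diff_powr.simps(1))
next
  case (Suc k)
  have 1: "(diff_powr k s has_field_derivative (- s * diff_powr k (s + 1) z)) (at z within S)"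
    by (rule Suc.IH) fact
  have "(diff_powr k s has_field_derivative (- s * diff_powr k (s + 1) (z + 1))) (at (z + 1))"
    by (rule Suc.IH) (use Suc.prems in simp)
  then have "((\<lambda>z. diff_powr k s (z + 1)) has_field_derivative (- s * diff_powr k (s + 1) (z + 1))) (at z within S)"
    by (rule has_field_derivative_at_within[OF DERIV_shift[THEN iffD1]])
  from DERIV_diff[OF 1 this]
  have D: "((\<lambda>z. diff_powr k s z - diff_powr k s (z + 1)) has_field_derivative
      (- s * diff_powr k (s + 1) z - - s * diff_powr k (s + 1) (z + 1))) (at z within S)" .
  have f: "diff_powr (Suc k) s = (\<lambda>z. diff_powr k s z - diff_powr k s (z + 1))"
    by (intro ext diff_powr.simps(2))
  have e: "- s * diff_powr (Suc k) (s + 1) z = - s * diff_powr k (s + 1) z - - s * diff_powr k (s + 1) (z + 1)"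
    unfolding diff_powr.simps(2) by (rule right_diff_distrib)
  show ?case unfolding e f by (rule D)
qed

text \<open>Each difference gains one power of \<open>x\<close>, by the mean value inequality.\<close>

lemma norm_diff_powr_le:
  assumes "x \<ge> 1" "Re s + real k \<ge> 0"
  shows "norm (diff_powr k s (of_real x)) \<le> (\<Prod>j<k. norm s + real j) * x powr (- (Re s + real k))"
  using assms
proof (induction k arbitrary: s x)
  case 0
  then show ?case by (simp add: norm_powr_real_powr)
next
  case (Suc k)
  define B where "B = norm s * ((\<Prod>j<k. norm s + 1 + real j) * x powr (- (Re s + 1 + real k)))"
  let ?S = "closed_segment (of_real x) (of_real (x + 1) :: complex)"
  have S: "\<exists>\<xi>. z = of_real \<xi> \<and> \<xi> \<ge> x" if "z \<in> ?S" for z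
    using that unfolding closed_segment_of_real by (auto simp: closed_segment_eq_real_ivl)
  have "norm (diff_powr k s (of_real x) - diff_powr k s (of_real (x + 1))) \<le> B * norm (of_real x - of_real (x + 1) :: complex)"
  proof (rule field_differentiable_bound[OF convex_closed_segment])
    fix z assume "z \<in> ?S"
    then obtain \<xi> where \<xi>: "z = of_real \<xi>" "\<xi> \<ge> x" using S by blast
    show "(diff_powr k s has_field_derivative (- s * diff_powr k (s + 1) z)) (at z within ?S)"
      by (rule diff_powr_has_field_derivative) (use \<xi> Suc.prems in simp)
    have "norm (diff_powr k (s + 1) z) \<le> (\<Prod>j<k. norm (s + 1) + real j) * \<xi> powr (- (Re (s + 1) + real k))"
      unfolding \<xi>(1) by (rule Suc.IH) (use Suc.prems \<xi> in auto)
    also have "\<dots> \<le> (\<Prod>j<k. norm s + 1 + real j) * x powr (- (Re s + 1 + real k))"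
    proof (intro mult_mono prod_mono conjI)
      show "norm (s + 1) + real j \<le> norm s + 1 + real j" for j
        using norm_triangle_ineq[of s 1] by simp
      show "\<xi> powr (- (Re (s + 1) + real k)) \<le> x powr (- (Re s + 1 + real k))"
        using \<xi> Suc.prems by (simp add: powr_mono2')
    qed (auto intro: prod_nonneg)
    finally show "norm (- s * diff_powr k (s + 1) z) \<le> B"
      unfolding B_def by (simp add: norm_mult mult_left_mono)
  qed auto
  then have "norm (diff_powr (Suc k) s (of_real x)) \<le> B" by (simp add: norm_minus_commute)
  \<comment> \<open>The factor \<open>norm s\<close> supplies the index 0 of the product and the
    shifted product the remaining ones.\<close>
  also have "B = (\<Prod>j<Suc k. norm s + real j) * x powr (- (Re s + real (Suc k)))"
  proof -
    have "(\<Prod>j<Suc k. norm s + real j) = norm s * (\<Prod>j<k. norm s + 1 + real j)"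
      by (subst prod.lessThan_Suc_shift) (simp add: add_ac)
    moreover have "- (Re s + 1 + real k) = - (Re s + real (Suc k))" by simp
    ultimately show ?thesis unfolding B_def by (simp only: mult.assoc)
  qed
  finally show ?case .
qed

lemma holomorphic_on_diff_powr: "z \<noteq> 0 \<Longrightarrow> Re z > 0 \<Longrightarrow> (\<lambda>s. diff_powr k s z) holomorphic_on S"
proof (induction k arbitrary: z)
  case (Suc k)
  have "z + 1 \<noteq> 0" using Suc.prems by (auto simp: complex_eq_iff)
  then have "(\<lambda>s. diff_powr k s z) holomorphic_on S" "(\<lambda>s. diff_powr k s (z + 1)) holomorphic_on S"
    using Suc.prems by (auto intro!: Suc.IH)
  then show ?case by (auto intro!: holomorphic_intros)
qed (auto intro!: holomorphic_intros)

definition eta_term :: "nat \<Rightarrow> complex \<Rightarrow> nat \<Rightarrow> complex" where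
  "eta_term k s n = (-1) ^ n * diff_powr k s (of_nat (Suc n))"

text \<open>Euler's transformation of the alternating zeta series, stopped after \<open>k\<close>
  steps: the first terms of the accelerated series plus a remainder of k-th differences, which
  converges absolutely for Re s > 1 - k.\<close>

definition eta_stage :: "nat \<Rightarrow> complex \<Rightarrow> complex" where
  "eta_stage k s = (\<Sum>j<k. diff_powr j s 1 / 2 ^ Suc j) + (\<Sum>n. eta_term k s n) / 2 ^ k"

lemma norm_eta_term_le:
  assumes "Re s + real k \<ge> 0"
  shows "norm (eta_term k s n) \<le> (\<Prod>j<k. norm s + real j) * real (Suc n) powr (- (Re s + real k))"
  using norm_diff_powr_le[of "real (Suc n)" s k] assms
  by (simp add: eta_term_def norm_mult norm_power)

lemma summable_Suc_powr: "a < -1 \<Longrightarrow> summable (\<lambda>n. real (Suc n) powr a)"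
  by (subst summable_Suc_iff) (simp add: summable_real_powr_iff)

lemma summable_eta_term:
  assumes "Re s > 1 - real k"
  shows "summable (eta_term k s)"
proof (rule summable_comparison_test')
  show "summable (\<lambda>n. (\<Prod>j<k. norm s + real j) * real (Suc n) powr (- (Re s + real k)))"
    using assms by (intro summable_mult summable_Suc_powr) auto
  show "norm (eta_term k s n) \<le> (\<Prod>j<k. norm s + real j) * real (Suc n) powr (- (Re s + real k))" for n
    using assms by (intro norm_eta_term_le) auto
qed

text \<open>Adding the remainder series to its own shift replaces k-th differences by (k+1)-st ones
  and doubles the sum except for its first term, which moves into the finite part.\<close>

lemma eta_stage_Suc:
  assumes "Re s > 1 - real k"
  shows "eta_stage (Suc k) s = eta_stage k s"
proof -
  have S: "eta_term k s sums (\<Sum>n. eta_term k s n)" by (rule summable_sums[OF summable_eta_term[OF assms]])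
  then have S1: "(\<lambda>n. eta_term k s (Suc n)) sums ((\<Sum>n. eta_term k s n) - eta_term k s 0)"
    by (simp add: sums_Suc_iff)
  have "(\<lambda>n. eta_term k s n + eta_term k s (Suc n)) sums ((\<Sum>n. eta_term k s n) + ((\<Sum>n. eta_term k s n) - eta_term k s 0))"
    by (rule sums_add[OF S S1])
  moreover have "eta_term k s n + eta_term k s (Suc n) = eta_term (Suc k) s n" for n
    by (simp add: eta_term_def algebra_simps)
  ultimately have "(\<Sum>n. eta_term (Suc k) s n) = 2 * (\<Sum>n. eta_term k s n) - diff_powr k s 1"
    by (simp add: sums_iff eta_term_def)
  then show ?thesis unfolding eta_stage_def by (simp add: diff_divide_distrib)
qed

lemma eta_stage_mono:
  assumes "Re s > 1 - real k" "k \<le> k'"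
  shows "eta_stage k' s = eta_stage k s"
  using assms(2)
proof (induction k' rule: dec_induct)
  case (step i)
  then show ?case using eta_stage_Suc[of i s] assms(1) by simp
qed simp

text \<open>Weierstrass' test on closed discs, with the majorant provided by
  \<open>norm_eta_term_le\<close>.\<close>

lemma eta_stage_holomorphic: "eta_stage k holomorphic_on {s. Re s > 1 - real k}"
proof -
  have op: "open {s. Re s > 1 - real k}" by (rule open_halfspace_Re_gt)
  have "(\<lambda>s. \<Sum>n. eta_term k s n) holomorphic_on {s. Re s > 1 - real k}"
  proof (rule holomorphic_uniform_sequence[OF op])
    show "(\<lambda>s. \<Sum>i<n. eta_term k s i) holomorphic_on {s. Re s > 1 - real k}" for n
      unfolding eta_term_def by (intro holomorphic_intros holomorphic_on_diff_powr) (auto simp del: of_nat_Suc)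
  next
    fix s0 :: complex assume s0: "s0 \<in> {s. Re s > 1 - real k}"
    then obtain d where d: "d > 0" "cball s0 d \<subseteq> {s. Re s > 1 - real k}"
      using op open_contains_cball by blast
    \<comment> \<open>The least real part on the disc. The leftmost point of the disc still lies in
      the half-plane, so the majorant converges.\<close>
    define \<sigma> where "\<sigma> = Re s0 - d"
    have "s0 - of_real d \<in> cball s0 d" using d by (simp add: dist_norm)
    then have "s0 - of_real d \<in> {s. Re s > 1 - real k}" using d(2) by (rule subsetD[rotated])
    then have \<sigma>: "\<sigma> > 1 - real k" by (simp add: \<sigma>_def)
    define B where "B = norm s0 + d"
    have "uniform_limit (cball s0 d) (\<lambda>n s. \<Sum>i<n. eta_term k s i) (\<lambda>s. \<Sum>n. eta_term k s n) sequentially"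
    proof (rule Weierstrass_m_test)
      show "summable (\<lambda>n. (\<Prod>j<k. B + real j) * real (Suc n) powr (- (\<sigma> + real k)))"
        using \<sigma> by (intro summable_mult summable_Suc_powr) auto
      fix n s assume s: "s \<in> cball s0 d"
      have "norm s \<le> B" using s norm_triangle_ineq2[of s s0] by (simp add: B_def dist_norm norm_minus_commute)
      have "Re s0 - Re s \<le> d" using s abs_Re_le_cmod[of "s0 - s"] by (simp add: dist_norm)
      then have "Re s \<ge> \<sigma>" by (simp add: \<sigma>_def)
      have "norm (eta_term k s n) \<le> (\<Prod>j<k. norm s + real j) * real (Suc n) powr (- (Re s + real k))"
        using s d by (intro norm_eta_term_le) (auto simp: subset_iff less_imp_le)
      also have "\<dots> \<le> (\<Prod>j<k. B + real j) * real (Suc n) powr (- (\<sigma> + real k))"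
        using \<open>norm s \<le> B\<close> \<open>Re s \<ge> \<sigma>\<close> order_trans[OF norm_ge_zero \<open>norm s \<le> B\<close>] by (intro mult_mono prod_mono conjI powr_mono prod_nonneg) auto
      finally show "norm (eta_term k s n) \<le> (\<Prod>j<k. B + real j) * real (Suc n) powr (- (\<sigma> + real k))" .
    qed
    then show "\<exists>d>0. cball s0 d \<subseteq> {s. Re s > 1 - real k} \<and>
        uniform_limit (cball s0 d) (\<lambda>n s. \<Sum>i<n. eta_term k s i) (\<lambda>s. \<Sum>n. eta_term k s n) sequentially"
      using d by blast
  qed
  then show ?thesis unfolding eta_stage_def
    by (intro holomorphic_intros holomorphic_on_diff_powr) auto
qed

text \<open>The Dirichlet eta function. The chosen number of steps is large enough for convergence
  at \<open>s\<close>; by \<open>eta_eq_stage\<close> every other sufficient number gives the same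
  value.\<close>

definition eta :: "complex \<Rightarrow> complex" where
  "eta s = eta_stage (nat \<lceil>2 - Re s\<rceil>) s"

lemma eta_eq_stage:
  assumes "Re s > 1 - real k"
  shows "eta s = eta_stage k s"
proof -
  define k0 where "k0 = nat \<lceil>2 - Re s\<rceil>"
  have k0: "Re s > 1 - real k0" unfolding k0_def by linarith
  show ?thesis
    using eta_stage_mono[OF k0, of "max k k0"] eta_stage_mono[OF assms, of "max k k0"]
    by (simp add: eta_def k0_def)
qed

lemma eta_holomorphic: "eta holomorphic_on A"
proof -
  have "eta analytic_on {s}" for s
  proof -
    define k where "k = nat \<lceil>2 - Re s\<rceil>"
    have k: "Re s > 1 - real k" unfolding k_def by linarith
    have "eta holomorphic_on {s. Re s > 1 - real k}"
      using eta_stage_holomorphic[of k] by (rule holomorphic_transform) (simp add: eta_eq_stage)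
    then show ?thesis using k open_halfspace_Re_gt[of "1 - real k"] by (auto simp: analytic_at)
  qed
  then show ?thesis by (meson analytic_imp_holomorphic analytic_on_analytic_at)
qed

lemma diff_powr_Suc_0:
  assumes "Re z > 0"
  shows "diff_powr (Suc k) 0 z = 0"
  using assms
proof (induction k arbitrary: z)
  case 0
  then have "z \<noteq> 0" "z + 1 \<noteq> 0" by (auto simp: complex_eq_iff)
  then show ?case by simp
next
  case (Suc k)
  have "diff_powr (Suc k) 0 z = 0" "diff_powr (Suc k) 0 (z + 1) = 0"
    using Suc.prems by (auto intro!: Suc.IH simp del: diff_powr.simps)
  then show ?case by (subst diff_powr.simps(2)) (simp only: diff_self)
qed

text \<open>At s = 0 all proper differences vanish, so only the initial term 1/2 of the accelerated
  series survives. Two steps are taken because stage \<open>k\<close> needs 0 > 1 - k.\<close>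

lemma eta_0: "eta 0 = 1 / 2"
proof -
  have "eta 0 = eta_stage (Suc (Suc 0)) 0" by (rule eta_eq_stage) simp
  moreover have "eta_term (Suc (Suc 0)) 0 = (\<lambda>_. 0)"
    unfolding eta_term_def by (rule ext, subst diff_powr_Suc_0) simp_all
  ultimately show ?thesis
    using diff_powr_Suc_0[of 1 0] unfolding eta_stage_def sum.lessThan_Suc by (simp del: diff_powr.simps(2))
qed

lemma eta_sums:
  assumes "Re s > 1"
  shows "(\<lambda>n. (-1) ^ n * of_nat (Suc n) powr (- s)) sums eta s"
proof -
  have "eta s = eta_stage 0 s" by (rule eta_eq_stage) (use assms in simp)
  then have e: "eta s = (\<Sum>n. eta_term 0 s n)" by (simp add: eta_stage_def)
  have "summable (eta_term 0 s)" by (rule summable_eta_term) (use assms in simp)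
  then have "eta_term 0 s sums eta s" unfolding e by (rule summable_sums)
  moreover have "eta_term 0 s = (\<lambda>n. (-1) ^ n * of_nat (Suc n) powr (- s))"
    unfolding eta_term_def diff_powr.simps(1) by (rule refl)
  ultimately show ?thesis by simp
qed

section \<open>Dirichlet series with a sign character\<close>

lemma norm_powr_of_pos_int: "m \<ge> 1 \<Longrightarrow> norm ((of_int m :: complex) powr s) = of_int m powr Re s"
  using norm_powr_real_powr[of "complex_of_int m" s] by simp

lemma summable_on_int_powr:
  assumes "\<sigma> > (1::real)"
  shows "(\<lambda>m::int. 1 / of_int m powr \<sigma>) summable_on {1..}"
proof -
  have "(\<lambda>n. real (Suc n) powr (- \<sigma>)) summable_on UNIV"
    by (rule summable_nonneg_imp_summable_on) (use summable_Suc_powr[of "- \<sigma>"] assms in auto)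
  then have "(\<lambda>n. 1 / real_of_int (int (Suc n)) powr \<sigma>) summable_on UNIV"
    unfolding powr_minus_divide of_int_of_nat_eq .
  moreover have "(\<lambda>n. 1 / real_of_int (int (Suc n)) powr \<sigma>) summable_on UNIV \<longleftrightarrow>
      (\<lambda>m::int. 1 / of_int m powr \<sigma>) summable_on {1..}"
    by (rule summable_on_reindex_bij_witness[of _ "\<lambda>m. nat (m - 1)" "\<lambda>n. int (Suc n)"]) auto
  ultimately show ?thesis by blast
qed

lemma abs_summable_sign_series:
  fixes x :: complex
  assumes x: "x = 1 \<or> x = -1" and s: "Re s > 1"
  shows "(\<lambda>m::int. norm (x powi m / of_int m powr s)) summable_on {1..}"
proof -
  have "norm (x powi m / of_int m powr s) = 1 / of_int m powr Re s" if "m \<in> {1..}" for m :: int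
    using x that by (auto simp: norm_divide norm_power_int norm_powr_of_pos_int)
  then have "(\<lambda>m::int. norm (x powi m / of_int m powr s)) summable_on {1..} \<longleftrightarrow>
     (\<lambda>m::int. 1 / of_int m powr Re s) summable_on {1..}"
    by (rule summable_on_cong)
  then show ?thesis using summable_on_int_powr[OF s] by blast
qed

text \<open>The continuation of the sum of x^m / m^s over m >= 1: zeta for \<open>x = 1\<close> and
  phi for \<open>x = -1\<close>. The second series starts with -1, hence minus \<open>eta\<close>.
  Where the denominator vanishes the value is a mere default, which is why
  \<open>Riemann_zeta_eq\<close> involves \<open>remove_sings\<close>.\<close>

definition sign_L :: "complex \<Rightarrow> complex \<Rightarrow> complex" where
  "sign_L x s = (if x = 1 then eta s / (1 - 2 powr (1 - s)) else - eta s)"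

lemma two_powr_neq_1:
  assumes "Re s > 1"
  shows "1 - 2 powr (1 - s) \<noteq> (0::complex)"
proof
  assume "1 - 2 powr (1 - s) = (0::complex)"
  then have "norm ((2::complex) powr (1 - s)) = 1" by simp
  then have "2 powr (1 - Re s) = (1::real)" using norm_powr_real_powr[of 2 "1 - s"] by simp
  then show False using assms by simp
qed

lemma has_sum_eta:
  assumes s: "Re s > 1"
  shows "((\<lambda>m::int. (-1) powi m / of_int m powr s) has_sum (- eta s)) {1..}"
proof -
  define f where "f = (\<lambda>m::int. (-1) powi m / (of_int m :: complex) powr s)"
  have "f summable_on {1..}"
    unfolding f_def by (rule abs_summable_summable[OF abs_summable_sign_series]) (use s in auto)
  then have "(f has_sum infsum f {1..}) {1..}" by (rule has_sum_infsum)
  moreover have "((\<lambda>n. f (int (Suc n))) has_sum infsum f {1..}) UNIV \<longleftrightarrow> (f has_sum infsum f {1..}) {1..}"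
    by (rule has_sum_reindex_bij_witness[of _ "\<lambda>m. nat (m - 1)" "\<lambda>n. int (Suc n)"]) auto
  ultimately have "(\<lambda>n. f (int (Suc n))) sums infsum f {1..}" by (intro has_sum_imp_sums) blast
  moreover have "(\<lambda>n. - ((-1) ^ n * of_nat (Suc n) powr (- s))) sums - eta s"
    by (rule sums_minus[OF eta_sums[OF s]])
  moreover have "f (int (Suc n)) = - ((-1) ^ n * of_nat (Suc n) powr (- s))" for n
    unfolding f_def power_int_of_nat by (simp add: powr_minus_divide del: of_nat_Suc)
  ultimately have "infsum f {1..} = - eta s" using sums_unique2 by simp
  then show ?thesis using \<open>(f has_sum infsum f {1..}) {1..}\<close> by (simp add: f_def)
qed

lemma of_int_double_powr: "m \<ge> 1 \<Longrightarrow> (of_int (2 * m) :: complex) powr s = 2 powr s * of_int m powr s"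
  using powr_times_real[of "2" "of_int m" s] by simp

text \<open>Adding the alternating series to the plain one leaves twice the even terms, that is 2 *
  2^(-s) times the plain series. The resulting linear equation is solved for the plain
  series.\<close>

lemma has_sum_sign_L:
  fixes x :: complex
  assumes x: "x = 1 \<or> x = -1" and s: "Re s > 1"
  shows "((\<lambda>m::int. x powi m / of_int m powr s) has_sum sign_L x s) {1..}"
proof (cases "x = 1")
  case True
  define f where "f = (\<lambda>m::int. 1 / (of_int m :: complex) powr s)"
  define Z where "Z = infsum f {1..}"
  have "f summable_on {1..}"
    using abs_summable_summable[OF abs_summable_sign_series[of 1 s]] s by (simp add: f_def)
  then have Z: "(f has_sum Z) {1..}" by (simp add: Z_def)
  have "((\<lambda>m. (2 * 2 powr (- s)) * f m) has_sum (2 * 2 powr (- s) * Z)) {1..}"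
    by (rule has_sum_cmult_right[OF Z])
  moreover have "((\<lambda>m. (2 * 2 powr (- s)) * f m) has_sum (2 * 2 powr (- s) * Z)) {1..} \<longleftrightarrow>
     ((\<lambda>m. (1 + (-1) powi m) * f m) has_sum (2 * 2 powr (- s) * Z)) {m\<in>{1..}. even m}"
    by (rule has_sum_reindex_bij_witness[of _ "\<lambda>m. m div 2" "\<lambda>m. 2 * m"])
       (auto simp: f_def of_int_double_powr powr_minus_divide simp del: of_int_mult elim!: evenE)
  ultimately have "((\<lambda>m. (1 + (-1) powi m) * f m) has_sum (2 * 2 powr (- s) * Z)) {m\<in>{1..}. even m}"
    by blast
  then have "((\<lambda>m. (1 + (-1) powi m) * f m) has_sum (2 * 2 powr (- s) * Z)) {1..}"
    by (subst has_sum_cong_neutral[of "{m\<in>{1..}. even m}"]) (auto simp: power_int_minus_left)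
  moreover have "((\<lambda>m. f m + (-1) powi m / of_int m powr s) has_sum (Z + - eta s)) {1..}"
    by (rule has_sum_add[OF Z has_sum_eta[OF s]])
  then have "((\<lambda>m. (1 + (-1) powi m) * f m) has_sum (Z + - eta s)) {1..}"
    by (simp add: f_def add_divide_distrib)
  ultimately have "2 * 2 powr (- s) * Z = Z + - eta s" by (rule has_sum_unique)
  moreover have "2 powr (1 - s) = 2 * (2::complex) powr (- s)" by (simp add: powr_diff powr_minus_divide)
  ultimately have "(1 - 2 powr (1 - s)) * Z = eta s" by (simp add: algebra_simps)
  then have "Z = sign_L 1 s" using two_powr_neq_1[OF s] by (simp add: sign_L_def field_simps)
  then show ?thesis using Z True by (simp add: f_def)
next
  case False
  then show ?thesis using has_sum_eta[OF s] x by (auto simp: sign_L_def)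
qed

lemma sign_L_meromorphic: "sign_L x meromorphic_on A"
proof -
  have "(\<lambda>s. eta s) analytic_on A" by (metis eta_holomorphic analytic_on_holomorphic open_UNIV subset_UNIV)
  then have "(\<lambda>s. eta s) meromorphic_on A" by (rule analytic_on_imp_meromorphic_on)
  moreover have "(\<lambda>s. 1 - 2 powr (1 - s) :: complex) meromorphic_on A"
    by (intro analytic_on_imp_meromorphic_on analytic_intros) auto
  ultimately show ?thesis unfolding sign_L_def by (cases "x = 1") (auto intro!: meromorphic_intros)
qed

lemma sign_L_analytic:
  assumes "x = 1 \<Longrightarrow> 1 - 2 powr (1 - s) \<noteq> (0::complex)"
  shows "sign_L x analytic_on {s}"
proof -
  have "(\<lambda>s. eta s) analytic_on {s}" by (metis eta_holomorphic analytic_on_holomorphic open_UNIV subset_UNIV)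
  moreover have "(\<lambda>s. 1 - 2 powr (1 - s) :: complex) analytic_on {s}"
    by (intro analytic_intros) auto
  ultimately show ?thesis using assms unfolding sign_L_def by (cases "x = 1") (auto intro!: analytic_intros)
qed

section \<open>Uniqueness of the continuation from a half-plane\<close>

lemma meromorphic_eq_halfplane:
  assumes F: "F meromorphic_on UNIV" and M: "M meromorphic_on UNIV"
    and eq: "\<And>s. Re s > 1 \<Longrightarrow> F s = M s"
  shows "eventually (\<lambda>s. F s = M s) (at z)"
proof -
  have d: "(\<lambda>s. F s - M s) meromorphic_on UNIV" using F M by (intro meromorphic_intros)
  \<comment> \<open>A meromorphic function on the plane is constantly 0 or avoids 0, both up to a
    sparse set. The second case fails near 2, a point inside the half-plane of agreement.\<close>
  have "\<not> (\<forall>\<^sub>\<approx>s\<in>UNIV. F s - M s \<noteq> 0)"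
  proof
    assume "\<forall>\<^sub>\<approx>s\<in>UNIV. F s - M s \<noteq> 0"
    then have "eventually (\<lambda>s. F s - M s \<noteq> 0) (at 2)"
      by (rule eventually_cosparse_imp_eventually_at) simp
    moreover have "eventually (\<lambda>s. Re s > 1) (at 2)"
      using eventually_at_in_open'[OF open_halfspace_Re_gt[of 1], of 2] by simp
    ultimately have "eventually (\<lambda>s::complex. False) (at 2)" by eventually_elim (use eq in auto)
    then show False by simp
  qed
  then have "\<forall>\<^sub>\<approx>s\<in>UNIV. F s - M s = 0"
    using meromorphic_imp_constant_or_avoid[OF d open_UNIV connected_UNIV, of 0] by blast
  then have "eventually (\<lambda>s. F s - M s = 0) (at z)"
    by (rule eventually_cosparse_imp_eventually_at) simp
  then show ?thesis by eventually_elim simp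
qed

text \<open>A nicely meromorphic function is fixed by \<open>remove_sings\<close>, and
  \<open>remove_sings\<close> depends only on the values in punctured neighbourhoods, where both
  functions agree.\<close>

lemma nicely_meromorphic_eqI:
  assumes F: "F nicely_meromorphic_on UNIV" and M: "M meromorphic_on UNIV"
    and eq: "\<And>s. Re s > 1 \<Longrightarrow> F s = M s"
  shows "F = remove_sings M"
proof
  fix z
  have "F meromorphic_on UNIV" using F by (simp add: nicely_meromorphic_on_def)
  then have "remove_sings F z = remove_sings M z"
    by (rule remove_sings_cong[OF meromorphic_eq_halfplane[OF _ M eq] refl])
  moreover have "remove_sings F z = F z"
    using F remove_sings_at_pole[of F z] remove_sings_eqI[of F "F z" z]
    unfolding nicely_meromorphic_on_def by (metis UNIV_I)
  ultimately show "F z = remove_sings M z" by simp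
qed

text \<open>Makes the definite description usable: existence comes from an explicit
  \<open>M\<close>, uniqueness from \<open>nicely_meromorphic_eqI\<close>.\<close>

lemma mero_continuation_eq:
  assumes M: "M meromorphic_on UNIV" "M analytic_on {s. Re s > 1}" and eq: "\<And>s. Re s > 1 \<Longrightarrow> f s = M s"
  shows "mero_continuation f = remove_sings M"
  unfolding mero_continuation_def
proof (rule the_equality)
  have 1: "remove_sings M s = M s" if "Re s > 1" for s
    using M(2) that by (intro remove_sings_at_analytic) (auto intro: analytic_on_subset)
  then show "remove_sings M nicely_meromorphic_on UNIV \<and> (\<forall>s. Re s > 1 \<longrightarrow> remove_sings M s = f s)"
    using eq by (auto intro: remove_sings_nicely_meromorphic M)
  show "F = remove_sings M" if "F nicely_meromorphic_on UNIV \<and> (\<forall>s. Re s > 1 \<longrightarrow> F s = f s)" for F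
    using that eq by (intro nicely_meromorphic_eqI M) auto
qed

lemma Riemann_zeta_eq: "Riemann_zeta = remove_sings (sign_L 1)"
  unfolding Riemann_zeta_def
proof (rule mero_continuation_eq[OF sign_L_meromorphic])
  show "sign_L 1 analytic_on {s. Re s > 1}"
    by (subst analytic_on_analytic_at) (auto intro!: sign_L_analytic dest: two_powr_neq_1)
  fix s :: complex assume s: "Re s > 1"
  have "((\<lambda>m::int. 1 / of_int m powr s) has_sum sign_L 1 s) {1..}"
    using has_sum_sign_L[of 1 s] s by simp
  moreover have "((\<lambda>n::nat. 1 / of_nat n powr s) has_sum sign_L 1 s) {1..} \<longleftrightarrow>
     ((\<lambda>m::int. 1 / of_int m powr s) has_sum sign_L 1 s) {1..}"
    by (rule has_sum_reindex_bij_witness[of _ nat int]) auto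
  ultimately have "((\<lambda>n::nat. 1 / of_nat n powr s) has_sum sign_L 1 s) {1..}" by blast
  then show "(\<Sum>\<^sub>\<infinity>n\<in>{1::nat..}. 1 / of_nat n powr s) = sign_L 1 s" by (rule infsumI)
qed

lemma Riemann_zeta_eq_sign_L: "1 - 2 powr (1 - s) \<noteq> (0::complex) \<Longrightarrow> Riemann_zeta s = sign_L 1 s"
  unfolding Riemann_zeta_eq by (intro remove_sings_at_analytic sign_L_analytic)

lemma Riemann_zeta_0: "Riemann_zeta 0 = - 1 / 2" "zeta_phi 0 = - 1 / 2"
proof -
  show "Riemann_zeta 0 = - 1 / 2"
    by (subst Riemann_zeta_eq_sign_L) (auto simp: sign_L_def eta_0)
  then show "zeta_phi 0 = - 1 / 2" by (simp add: zeta_phi_def)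
qed

lemma zeta_phi_eq: "Re s > 1 \<Longrightarrow> zeta_phi s = sign_L (-1) s"
  using two_powr_neq_1[of s] unfolding zeta_phi_def
  by (subst Riemann_zeta_eq_sign_L) (auto simp: sign_L_def field_simps)

section \<open>The functions \<open>T\<close>\<close>

lemma psi_const_eq_sign_L:
  assumes x: "x = 1 \<or> x = -1" and j: "j \<ge> 1"
  shows "psi_const x j = sign_L x (of_nat (2 * j))"
proof -
  define f where "f = (\<lambda>m::int. x powi m / of_int m powr (of_nat (2 * j)))"
  have "(f has_sum sign_L x (of_nat (2 * j))) {1..}"
    unfolding f_def by (rule has_sum_sign_L[OF x]) (use j in simp)
  moreover have "((\<lambda>n. f (int (Suc n))) has_sum sign_L x (of_nat (2 * j))) UNIV \<longleftrightarrow>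
      (f has_sum sign_L x (of_nat (2 * j))) {1..}"
    by (rule has_sum_reindex_bij_witness[of _ "\<lambda>m. nat (m - 1)" "\<lambda>n. int (Suc n)"]) auto
  ultimately have "(\<lambda>n. f (int (Suc n))) sums sign_L x (of_nat (2 * j))" by (intro has_sum_imp_sums) blast
  moreover have "f (int (Suc n)) = x ^ Suc n / of_nat (Suc n) ^ (2 * j)" for n
  proof -
    have "(of_nat (Suc n) :: complex) powr of_nat (2 * j) = of_nat (Suc n) ^ (2 * j)"
      by (rule powr_nat') (simp del: of_nat_Suc)
    then show ?thesis unfolding f_def power_int_of_nat of_int_of_nat_eq by (simp only:)
  qed
  ultimately have "(\<lambda>n. x ^ Suc n / of_nat (Suc n) ^ (2 * j)) sums sign_L x (of_nat (2 * j))" by (simp only:)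
  then show ?thesis using j unfolding psi_const_def by (simp add: sums_iff)
qed

text \<open>For j = 0 this is zeta(0) = -1/2, which justifies the value set by hand in
  \<open>psi_const\<close>.\<close>

lemma Riemann_zeta_even: "Riemann_zeta (of_nat (2 * j)) = psi_const 1 j"
proof (cases "j = 0")
  case True
  then show ?thesis using Riemann_zeta_0 by (simp add: psi_const_def)
next
  case False
  then have big: "Re (of_nat (2 * j)) > 1" by simp
  have "psi_const 1 j = sign_L 1 (of_nat (2 * j))"
    by (rule psi_const_eq_sign_L) (use False in auto)
  then show ?thesis by (simp only: Riemann_zeta_eq_sign_L[OF two_powr_neq_1[OF big]])
qed

lemma zeta_phi_even: "zeta_phi (of_nat (2 * j)) = psi_const (-1) j"
proof (cases "j = 0")
  case True
  then show ?thesis using Riemann_zeta_0 by (simp add: psi_const_def)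
next
  case False
  then have big: "Re (of_nat (2 * j)) > 1" by simp
  have "psi_const (-1) j = sign_L (-1) (of_nat (2 * j))"
    by (rule psi_const_eq_sign_L) (use False in auto)
  then show ?thesis by (simp only: zeta_phi_eq[OF big])
qed

text \<open>The majorant of the lattice sums. Its value at 0 is 1 / 0 = 0, so it can be summed over
  all integers, and linear changes of variables need not keep track of excluded points.\<close>

definition inv_square :: "int \<Rightarrow> real" where
  "inv_square l = 1 / of_int l ^ 2"

lemma inv_square_nonneg [simp]: "inv_square l \<ge> 0"
  by (simp add: inv_square_def)

lemma inv_square_summable: "inv_square summable_on UNIV"
proof -
  have "(\<lambda>m::int. 1 / of_int m powr 2 :: real) summable_on {1..} \<longleftrightarrow> inv_square summable_on {1..}"
    by (rule summable_on_cong) (simp add: inv_square_def)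
  then have pos: "inv_square summable_on {1..}" using summable_on_int_powr[of 2] by simp
  have "inv_square summable_on {1..} \<longleftrightarrow> inv_square summable_on {..-1}"
    by (rule summable_on_reindex_bij_witness[of _ uminus uminus]) (auto simp: inv_square_def)
  with pos have neg: "inv_square summable_on {..-1}" by blast
  have "inv_square summable_on {0}" by simp
  then have "inv_square summable_on ({1..} \<union> {..-1} \<union> {0})"
    by (intro summable_on_union pos neg)
  moreover have "{1..} \<union> {..-1} \<union> {0::int} = UNIV" by auto
  ultimately show ?thesis by simp
qed

lemma summable_on_times_nonneg:
  fixes f :: "'a \<Rightarrow> real" and g :: "'b \<Rightarrow> real"
  assumes f: "f summable_on A" "\<And>x. x \<in> A \<Longrightarrow> f x \<ge> 0" and g: "g summable_on B" "\<And>x. x \<in> B \<Longrightarrow> g x \<ge> 0"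
  shows "(\<lambda>(x, y). f x * g y) summable_on A \<times> B"
proof (rule summable_on_SigmaI)
  show "((\<lambda>y. (\<lambda>(x, y). f x * g y) (x, y)) has_sum f x * infsum g B) B" for x
    using has_sum_cmult_right[OF has_sum_infsum[OF g(1)], of "f x"] by simp
  show "(\<lambda>x. f x * infsum g B) summable_on A" by (rule summable_on_cmult_left[OF f(1)])
qed (use f g in auto)

text \<open>With exponents 1 neither factor is summable alone. The inequality between the geometric
  and the arithmetic mean trades the product of two linear forms for a sum of squares, each summable
  in one variable.\<close>

lemma pair_bound:
  assumes "u \<noteq> 0" "v \<noteq> 0" "p \<ge> 1" "q \<ge> 1"
  shows "1 / (\<bar>real_of_int u\<bar> ^ p * \<bar>real_of_int v\<bar> ^ q) \<le> inv_square u + inv_square v"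
proof -
  define U V where "U = \<bar>real_of_int u\<bar>" and "V = \<bar>real_of_int v\<bar>"
  have U: "U \<ge> 1" "V \<ge> 1" using assms by (auto simp: U_def V_def simp flip: of_int_abs)
  have "U ^ 1 \<le> U ^ p" "V ^ 1 \<le> V ^ q" using U assms by (intro power_increasing; simp)+
  then have "U * V \<le> U ^ p * V ^ q" using U by (intro mult_mono) auto
  then have "1 / (U ^ p * V ^ q) \<le> 1 / (U * V)" using U by (intro divide_left_mono mult_pos_pos) auto
  also have "\<dots> = (1 / U) * (1 / V)" by simp
  also have "\<dots> \<le> (1 / U) ^ 2 + (1 / V) ^ 2"
  proof -
    have "0 \<le> 1 / U * (1 / V)" using U by simp
    then show ?thesis using sum_squares_bound[of "1 / U" "1 / V"] by linarith
  qed
  also have "\<dots> = inv_square u + inv_square v"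
    by (simp add: inv_square_def U_def V_def power_divide)
  finally show ?thesis unfolding U_def V_def .
qed

definition T_index :: "(int \<times> int) set" where
  "T_index = {(l, m). l \<noteq> 0 \<and> 1 \<le> m \<and> l + m \<noteq> 0}"

definition T_term :: "nat \<Rightarrow> complex \<Rightarrow> nat \<Rightarrow> complex \<times> complex \<Rightarrow> int \<times> int \<Rightarrow> complex" where
  "T_term p s q u = (\<lambda>(l, m). fst u powi l * snd u powi m / (of_int l ^ p * of_int m powr s * of_int (l + m) ^ q))"

lemma T_series_altdef: "T_series p s q u = infsum (T_term p s q u) T_index"
  unfolding T_series_def T_term_def T_index_def ..

definition sign_pair :: "complex \<times> complex \<Rightarrow> bool" where
  "sign_pair u \<longleftrightarrow> (fst u = 1 \<or> fst u = -1) \<and> (snd u = 1 \<or> snd u = -1)"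

text \<open>The forms \<open>l\<close> and \<open>l + m\<close> are paired, while \<open>m\<close>
  is controlled by Re s > 1. The part with \<open>l + m\<close> reduces to the part with
  \<open>l\<close> by translating \<open>l\<close>.\<close>

lemma T_term_abs_summable:
  assumes u: "sign_pair u" and pq: "p \<ge> 1" "q \<ge> 1" and s: "Re s > 1"
  shows "(\<lambda>i. norm (T_term p s q u i)) summable_on T_index"
proof -
  define g where "g = (\<lambda>m::int. 1 / real_of_int m powr Re s)"
  have g: "g summable_on {1..}" unfolding g_def by (rule summable_on_int_powr[OF s])
  have S1: "(\<lambda>(l, m). inv_square l * g m) summable_on UNIV \<times> {1..}"
    by (rule summable_on_times_nonneg[OF inv_square_summable _ g]) (auto simp: g_def)
  have "(\<lambda>(l, m). inv_square (l + m) * g m) summable_on UNIV \<times> {1..} \<longleftrightarrow>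
        (\<lambda>(l, m). inv_square l * g m) summable_on UNIV \<times> {1..}"
    by (rule summable_on_reindex_bij_witness[of _ "\<lambda>(l, m). (l - m, m)" "\<lambda>(l, m). (l + m, m)"]) auto
  with S1 have S2: "(\<lambda>(l, m). inv_square (l + m) * g m) summable_on UNIV \<times> {1..}" by blast
  have "(\<lambda>i. (\<lambda>(l, m). inv_square l * g m) i + (\<lambda>(l, m). inv_square (l + m) * g m) i) summable_on UNIV \<times> {1..}"
    by (rule summable_on_add[OF S1 S2])
  then have "(\<lambda>i. (\<lambda>(l, m). inv_square l * g m) i + (\<lambda>(l, m). inv_square (l + m) * g m) i) summable_on T_index"
    by (rule summable_on_subset) (auto simp: T_index_def)
  then show ?thesis
  proof (rule summable_on_comparison_test)
    fix i assume "i \<in> T_index"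
    then obtain l m where i: "i = (l, m)" "l \<noteq> 0" "1 \<le> m" "l + m \<noteq> 0" by (auto simp: T_index_def)
    have "norm (T_term p s q u i) = 1 / (\<bar>real_of_int l\<bar> ^ p * \<bar>real_of_int (l + m)\<bar> ^ q) * g m"
    proof -
      have "norm (fst u powi l) = 1" "norm (snd u powi m) = 1"
        using u powi_sign(4) by (auto simp: sign_pair_def)
      then show ?thesis using i
        by (simp add: T_term_def norm_mult norm_divide norm_power norm_powr_of_pos_int g_def norm_of_int del: of_int_add)
    qed
    also have "\<dots> \<le> (inv_square l + inv_square (l + m)) * g m"
      using pair_bound[OF i(2,4) pq] by (intro mult_right_mono) (auto simp: g_def)
    finally show "norm (T_term p s q u i) \<le> (\<lambda>(l, m). inv_square l * g m) i + (\<lambda>(l, m). inv_square (l + m) * g m) i"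
      by (simp add: i distrib_right)
  qed simp
qed

lemma T_term_has_sum:
  assumes "sign_pair u" "p \<ge> 1" "q \<ge> 1" "Re s > 1"
  shows "(T_term p s q u has_sum T_series p s q u) T_index"
  unfolding T_series_altdef
  by (rule has_sum_infsum[OF abs_summable_summable[OF T_term_abs_summable[OF assms]]])

text \<open>Links unordered summation with the residue formula: once a family is summable, its sum
  can be computed along symmetric windows.\<close>

lemma has_sum_of_symmetric_limit:
  fixes f :: "int \<Rightarrow> complex"
  assumes f: "f summable_on (UNIV - E)" and E: "finite E"
    and lim: "(\<lambda>N::nat. sum f ({- int N..int N} - E)) \<longlonglongrightarrow> L"
  shows "(f has_sum L) (UNIV - E)"
proof -
  have S: "(f has_sum infsum f (UNIV - E)) (UNIV - E)" using f by simp
  have "filterlim (\<lambda>N::nat. {- int N..int N} - E) (finite_subsets_at_top (UNIV - E)) sequentially"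
    unfolding filterlim_finite_subsets_at_top
  proof (intro allI impI)
    fix X :: "int set" assume X: "finite X \<and> X \<subseteq> UNIV - E"
    show "eventually (\<lambda>N::nat. finite ({- int N..int N} - E) \<and> X \<subseteq> {- int N..int N} - E \<and> {- int N..int N} - E \<subseteq> UNIV - E) sequentially"
      using eventually_ge_at_top[of "nat (Max (insert 0 (abs ` X)))"]
    proof eventually_elim
      case (elim N)
      have bnd: "\<bar>y\<bar> \<le> int N" if "y \<in> X" for y
      proof -
        have "\<bar>y\<bar> \<le> Max (insert 0 (abs ` X))" using X that by (intro Max_ge) auto
        then show ?thesis using elim by linarith
      qed
      have "X \<subseteq> {- int N..int N}"
      proof
        fix y assume "y \<in> X"
        then have "\<bar>y\<bar> \<le> int N" by (rule bnd)
        then show "y \<in> {- int N..int N}" unfolding atLeastAtMost_iff by linarith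
      qed
      then show ?case using X by auto
    qed
  qed
  then have "(\<lambda>N::nat. sum f ({- int N..int N} - E)) \<longlonglongrightarrow> infsum f (UNIV - E)"
    using S unfolding has_sum_def by (rule filterlim_compose[rotated])
  then have "infsum f (UNIV - E) = L" using lim by (rule LIMSEQ_unique)
  then show ?thesis using S by simp
qed

text \<open>What the sum over \<open>l\<close> by residues leaves: the first sum comes from the pole
  l = 0 and the second from l = -m, whose extra factor \<open>x powi m\<close> merges the two signs
  into \<open>fst u * snd u\<close>.\<close>

definition T_cont :: "nat \<Rightarrow> nat \<Rightarrow> complex \<times> complex \<Rightarrow> complex \<Rightarrow> complex" where
  "T_cont p q u s =
     (\<Sum>j = 0..p div 2. 2 * psi_const (fst u) j * (-1) ^ (p - 2 * j) * of_nat ((p - 2 * j + q - 1) choose (p - 2 * j)) *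
        sign_L (snd u) (s + of_nat (q + (p - 2 * j)))) +
     (\<Sum>j = 0..q div 2. 2 * psi_const (fst u) j * (-1) ^ p * of_nat ((q - 2 * j + p - 1) choose (q - 2 * j)) *
        sign_L (fst u * snd u) (s + of_nat (p + (q - 2 * j))))"

lemma has_sum_finite_sum:
  fixes f :: "'i \<Rightarrow> 'a \<Rightarrow> complex"
  assumes "\<And>i. i \<in> I \<Longrightarrow> (f i has_sum S i) A"
  shows "((\<lambda>x. \<Sum>i\<in>I. f i x) has_sum (\<Sum>i\<in>I. S i)) A"
  using assms by (induction I rule: infinite_finite_induct) (auto intro: has_sum_add)

lemma sign_L_shift_has_sum:
  assumes y: "y = 1 \<or> y = -1" and s: "Re s > 1"
  shows "((\<lambda>m::int. y powi m / of_int m powr s * (1 / of_int m ^ k)) has_sum sign_L y (s + of_nat k)) {1..}"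
proof -
  have "((\<lambda>m::int. y powi m / of_int m powr (s + of_nat k)) has_sum sign_L y (s + of_nat k)) {1..}"
    by (rule has_sum_sign_L[OF y]) (use s in simp)
  moreover have "y powi m / of_int m powr (s + of_nat k) = y powi m / of_int m powr s * (1 / of_int m ^ k)"
    if "m \<in> {1..}" for m :: int
    using that by (simp add: powr_add powr_nat')
  then have "((\<lambda>m::int. y powi m / of_int m powr (s + of_nat k)) has_sum sign_L y (s + of_nat k)) {1..} \<longleftrightarrow>
      ((\<lambda>m::int. y powi m / of_int m powr s * (1 / of_int m ^ k)) has_sum sign_L y (s + of_nat k)) {1..}"
    by (rule has_sum_cong)
  ultimately show ?thesis by blast
qed

text \<open>Absolute convergence permits summing over \<open>l\<close> first;
  \<open>symmetric_sum_two_poles\<close> gives the inner sums, and the outer sums over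
  \<open>m\<close> are Dirichlet series at shifted arguments.\<close>

lemma T_series_eq_T_cont:
  assumes u: "sign_pair u" and pq: "p \<ge> 1" "q \<ge> 1" and s: "Re s > 1"
  shows "T_series p s q u = T_cont p q u s"
proof -
  define x y where "x = fst u" and "y = snd u"
  have x: "x = 1 \<or> x = -1" and y: "y = 1 \<or> y = -1" and xy: "x * y = 1 \<or> x * y = -1"
    using u by (auto simp: sign_pair_def x_def y_def)
  define h where "h = (\<lambda>m::int. 2 * (\<Sum>j = 0..p div 2. psi_const x j * linear_coeff q (of_int m) (p - 2 * j)) +
       x powi m * (2 * (\<Sum>j = 0..q div 2. psi_const x j * linear_coeff p (- of_int m) (q - 2 * j))))"
  define f where "f = (\<lambda>(m, l). T_term p s q u (l, m))"
  have bij: "(f has_sum V) (Sigma {1..} (\<lambda>m. UNIV - {0, - m})) \<longleftrightarrow> (T_term p s q u has_sum V) T_index" for V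
    by (rule has_sum_reindex_bij_witness[of _ "\<lambda>(l, m). (m, l)" "\<lambda>(m, l). (l, m)"])
       (auto simp: T_index_def f_def)
  have f: "(f has_sum T_series p s q u) (Sigma {1..} (\<lambda>m. UNIV - {0, - m}))"
    unfolding bij by (rule T_term_has_sum[OF u pq s])
  have "((\<lambda>m. y powi m / of_int m powr s * h m) has_sum T_series p s q u) {1..}"
  proof (rule has_sum_SigmaD[OF f])
    fix m :: int assume m: "m \<in> {1..}"
    have mp: "(of_int m :: complex) powr s \<noteq> 0" using m by simp
    define F where "F = (\<lambda>l. x powi l / (of_int l ^ p * of_int (l + m) ^ q))"
    have eq: "f (m, l) = y powi m / of_int m powr s * F l" for l
      by (simp add: f_def T_term_def F_def x_def y_def mult_ac)
    have "(\<lambda>(m, l). f (m, l)) summable_on (Sigma {1..} (\<lambda>m. UNIV - {0, - m}))"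
      using f by (auto simp: summable_on_def)
    from summable_on_SigmaD1[OF this m] have "(\<lambda>l. y powi m / of_int m powr s * F l) summable_on (UNIV - {0, - m})"
      unfolding eq .
    \<comment> \<open>Summability of the inner sum is inherited from the double series after
      division by this non-zero weight.\<close>
    moreover have "y powi m / of_int m powr s \<noteq> 0" using powi_sign(1)[OF y] mp by simp
    ultimately have Fs: "F summable_on (UNIV - {0, - m})"
      using summable_on_cmult_right'[of "y powi m / of_int m powr s" F "UNIV - {0, - m}"] by blast
    have "(F has_sum h m) (UNIV - {0, - m})"
      unfolding F_def h_def
    proof (rule has_sum_of_symmetric_limit)
      show "(\<lambda>l. x powi l / (of_int l ^ p * of_int (l + m) ^ q)) summable_on UNIV - {0, - m}"
        using Fs unfolding F_def .
      show "(\<lambda>N::nat. \<Sum>l\<in>{- int N..int N} - {0, - m}. x powi l / (of_int l ^ p * of_int (l + m) ^ q)) \<longlonglongrightarrow>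
         2 * (\<Sum>j = 0..p div 2. psi_const x j * linear_coeff q (of_int m) (p - 2 * j)) +
         x powi m * (2 * (\<Sum>j = 0..q div 2. psi_const x j * linear_coeff p (- of_int m) (q - 2 * j)))"
        by (rule symmetric_sum_two_poles[OF x _ pq]) (use m in simp)
    qed simp
    then show "((\<lambda>l. f (m, l)) has_sum y powi m / of_int m powr s * h m) (UNIV - {0, - m})"
      unfolding eq by (rule has_sum_cmult_right)
  qed
  moreover have "((\<lambda>m. y powi m / of_int m powr s * h m) has_sum T_cont p q u s) {1..}"
  proof -
    define A where "A = (\<lambda>j. 2 * psi_const x j * (-1) ^ (p - 2 * j) * of_nat ((p - 2 * j + q - 1) choose (p - 2 * j)))"
    define B where "B = (\<lambda>j. 2 * psi_const x j * (-1) ^ p * of_nat ((q - 2 * j + p - 1) choose (q - 2 * j)))"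
    have "((\<lambda>m. (\<Sum>j = 0..p div 2. A j * (y powi m / of_int m powr s * (1 / of_int m ^ (q + (p - 2 * j))))) +
                (\<Sum>j = 0..q div 2. B j * ((x * y) powi m / of_int m powr s * (1 / of_int m ^ (p + (q - 2 * j))))))
            has_sum T_cont p q u s) {1..}"
      unfolding T_cont_def A_def B_def x_def[symmetric] y_def[symmetric]
      by (intro has_sum_add has_sum_finite_sum has_sum_cmult_right sign_L_shift_has_sum y xy s)
    moreover have "(\<Sum>j = 0..p div 2. A j * (y powi m / of_int m powr s * (1 / of_int m ^ (q + (p - 2 * j))))) +
                (\<Sum>j = 0..q div 2. B j * ((x * y) powi m / of_int m powr s * (1 / of_int m ^ (p + (q - 2 * j))))) =
          y powi m / of_int m powr s * h m" for m
      unfolding h_def A_def B_def linear_coeff_minus distrib_left sum_distrib_left power_int_mult_distrib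
      unfolding linear_coeff_def
      by (intro arg_cong2[of _ _ _ _ "(+)"] sum.cong refl) (simp_all add: mult_ac)
    ultimately show ?thesis by (simp only:)
  qed
  ultimately show ?thesis by (rule has_sum_unique)
qed

lemma sign_L_shift_meromorphic: "(\<lambda>s. sign_L x (s + c)) meromorphic_on A"
  by (rule meromorphic_on_compose[OF sign_L_meromorphic[of x UNIV]]) (auto intro!: analytic_intros)

lemma sign_L_shift_analytic:
  assumes "Re c \<ge> 0"
  shows "(\<lambda>s. sign_L x (s + c)) analytic_on {s. Re s > 1}"
proof -
  have "sign_L x \<circ> (\<lambda>s. s + c) analytic_on {s. Re s > 1}"
  proof (rule analytic_on_compose)
    show "sign_L x analytic_on (\<lambda>s. s + c) ` {s. 1 < Re s}"
    proof (subst analytic_on_analytic_at, intro ballI)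
      fix z assume "z \<in> (\<lambda>s. s + c) ` {s. 1 < Re s}"
      then have "Re z > 1" using assms by auto
      then show "sign_L x analytic_on {z}" by (intro sign_L_analytic two_powr_neq_1)
    qed
  qed (auto intro!: analytic_intros)
  then show ?thesis by (simp add: o_def)
qed

lemma T_fun_eq:
  assumes "sign_pair u" "p \<ge> 1" "q \<ge> 1"
  shows "T_fun p s q u = remove_sings (T_cont p q u) s"
proof -
  have "mero_continuation (\<lambda>s. T_series p s q u) = remove_sings (T_cont p q u)"
  proof (rule mero_continuation_eq)
    show "T_cont p q u meromorphic_on UNIV" unfolding T_cont_def
      by (intro meromorphic_intros sign_L_shift_meromorphic)
    show "T_cont p q u analytic_on {s. Re s > 1}" unfolding T_cont_def
      by (intro analytic_intros sign_L_shift_analytic) auto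
  qed (intro T_series_eq_T_cont assms)
  then show ?thesis unfolding T_fun_def by simp
qed

lemma T_fun_meromorphic:
  assumes "sign_pair u" "p \<ge> 1" "q \<ge> 1"
  shows "(\<lambda>s. T_fun p (s + c) q u) meromorphic_on UNIV"
proof -
  have "remove_sings (T_cont p q u) meromorphic_on UNIV"
    unfolding T_cont_def by (intro meromorphic_intros sign_L_shift_meromorphic)
  then show ?thesis unfolding T_fun_eq[OF assms]
    by (rule meromorphic_on_compose) (auto intro!: analytic_intros)
qed

lemma T_fun_eq_T_series:
  assumes "sign_pair u" "p \<ge> 1" "q \<ge> 1" "Re s > 1"
  shows "T_fun p s q u = T_series p s q u"
proof -
  have "T_cont p q u analytic_on {s. Re s > 1}" unfolding T_cont_def
      by (intro analytic_intros sign_L_shift_analytic) auto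
  then have "T_cont p q u analytic_on {s}" using assms by (auto intro: analytic_on_subset)
  then show ?thesis using assms by (simp add: T_fun_eq T_series_eq_T_cont)
qed

section \<open>Summation over the weight lattice\<close>

text \<open>The six linear forms correspond to the positive roots of A_3. Only \<open>n\<close> is
  restricted to positive values: its exponent is complex, whereas a sign of the other forms costs
  just a power of -1.\<close>

definition root_index :: "(int \<times> int \<times> int) set" where
  "root_index = {(l, m, n). 1 \<le> n \<and> l \<noteq> 0 \<and> m \<noteq> 0 \<and> l + m \<noteq> 0 \<and> m + n \<noteq> 0 \<and> l + m + n \<noteq> 0}"

definition root_term :: "nat \<Rightarrow> nat \<Rightarrow> nat \<Rightarrow> nat \<Rightarrow> nat \<Rightarrow> complex \<Rightarrow> int \<times> int \<times> int \<Rightarrow> complex" where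
  "root_term p q a b c s = (\<lambda>(l, m, n).
     1 / (of_int l ^ p * of_int m ^ q * of_int n powr s *
          of_int (l + m) ^ a * of_int (m + n) ^ b * of_int (l + m + n) ^ c))"

text \<open>The forms \<open>l\<close> and \<open>l + m + n\<close> are paired, and likewise
  \<open>m\<close> and \<open>m + n\<close>; \<open>n\<close> is controlled by Re s > 1. Multiplying
  out gives four products of squares.\<close>

lemma root_term_abs_summable:
  assumes pos: "p \<ge> 1" "q \<ge> 1" "a \<ge> 1" "b \<ge> 1" "c \<ge> 1" and s: "Re s > 1"
  shows "(\<lambda>i. norm (root_term p q a b c s i)) summable_on root_index"
proof -
  define g where "g = (\<lambda>n::int. 1 / real_of_int n powr Re s)"
  have g: "g summable_on {1..}" unfolding g_def by (rule summable_on_int_powr[OF s])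
  have g0: "g n \<ge> 0" for n by (simp add: g_def)
  define A where "A = (UNIV :: int set) \<times> (UNIV :: int set) \<times> {1::int..}"
  have S0: "(\<lambda>(l, m, n). inv_square l * (inv_square m * g n)) summable_on A"
  proof -
    have "(\<lambda>(m, n). inv_square m * g n) summable_on UNIV \<times> {1..}"
      by (rule summable_on_times_nonneg[OF inv_square_summable _ g]) (auto simp: g0)
    then have "(\<lambda>(l, i). inv_square l * (\<lambda>(m, n). inv_square m * g n) i) summable_on UNIV \<times> (UNIV \<times> {1..})"
      by (rule summable_on_times_nonneg[OF inv_square_summable, rotated]) (auto simp: g0)
    then show ?thesis unfolding A_def by (simp add: case_prod_unfold)
  qed
  \<comment> \<open>For i and j in {0, 1} these are the four products; a shear of the lattice
    carries each of them to the product with i = j = 0.\<close>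
  have shear: "(\<lambda>(l, m, n). inv_square (l + i * (m + n)) * (inv_square (m + j * n) * g n)) summable_on A" for i j :: int
  proof -
    have "(\<lambda>(l, m, n). inv_square (l + i * (m + n)) * (inv_square (m + j * n) * g n)) summable_on A \<longleftrightarrow>
       (\<lambda>(l, m, n). inv_square l * (inv_square m * g n)) summable_on A"
      by (rule summable_on_reindex_bij_witness[of _ "\<lambda>(l, m, n). (l - i * (m - j * n + n), m - j * n, n)" "\<lambda>(l, m, n). (l + i * (m + n), m + j * n, n)"])
         (auto simp: A_def algebra_simps)
    then show ?thesis using S0 by blast
  qed
  define D where "D = (\<lambda>(l, m, n). (inv_square l + inv_square (l + m + n)) * ((inv_square m + inv_square (m + n)) * g n))"
  have "(\<lambda>x. ((\<lambda>(l, m, n). inv_square (l + 0 * (m + n)) * (inv_square (m + 0 * n) * g n)) x +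
              (\<lambda>(l, m, n). inv_square (l + 0 * (m + n)) * (inv_square (m + 1 * n) * g n)) x) +
             ((\<lambda>(l, m, n). inv_square (l + 1 * (m + n)) * (inv_square (m + 0 * n) * g n)) x +
              (\<lambda>(l, m, n). inv_square (l + 1 * (m + n)) * (inv_square (m + 1 * n) * g n)) x)) summable_on A"
    by (intro summable_on_add shear)
  also have "(\<lambda>x. ((\<lambda>(l, m, n). inv_square (l + 0 * (m + n)) * (inv_square (m + 0 * n) * g n)) x +
              (\<lambda>(l, m, n). inv_square (l + 0 * (m + n)) * (inv_square (m + 1 * n) * g n)) x) +
             ((\<lambda>(l, m, n). inv_square (l + 1 * (m + n)) * (inv_square (m + 0 * n) * g n)) x +
              (\<lambda>(l, m, n). inv_square (l + 1 * (m + n)) * (inv_square (m + 1 * n) * g n)) x)) = D"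
    by (rule ext) (simp add: D_def case_prod_unfold algebra_simps)
  finally have "D summable_on root_index"
    by (rule summable_on_subset) (auto simp: root_index_def A_def)
  then show ?thesis
  proof (rule summable_on_comparison_test)
    fix i assume "i \<in> root_index"
    then obtain l m n where i: "i = (l, m, n)" "1 \<le> n" "l \<noteq> 0" "m \<noteq> 0" "l + m \<noteq> 0" "m + n \<noteq> 0" "l + m + n \<noteq> 0"
      by (auto simp: root_index_def)
    define U V W X Y where "U = \<bar>real_of_int l\<bar> ^ p" and "V = \<bar>real_of_int m\<bar> ^ q" and "W = \<bar>real_of_int (l + m)\<bar> ^ a"
      and "X = \<bar>real_of_int (m + n)\<bar> ^ b" and "Y = \<bar>real_of_int (l + m + n)\<bar> ^ c"
    have ge1: "\<bar>real_of_int k\<bar> \<ge> 1" if "k \<noteq> 0" for k using that by (simp flip: of_int_abs)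
    have W: "W \<ge> 1" unfolding W_def using ge1[OF i(5)] by (rule one_le_power)
    have pos': "U > 0" "V > 0" "X > 0" "Y > 0" unfolding U_def V_def X_def Y_def
      using i by (simp_all del: of_int_add)
    have "norm (root_term p q a b c s i) = 1 / (U * V * (of_int n powr Re s) * W * X * Y)"
      using i(2) unfolding i(1) root_term_def U_def V_def W_def X_def Y_def prod.case
      by (simp only: norm_divide norm_mult norm_power norm_of_int norm_powr_of_pos_int norm_one)
    also have "\<dots> = (1 / (U * Y)) * ((1 / (V * X)) * g n) * (1 / W)"
      by (simp add: g_def mult_ac)
    also have "\<dots> \<le> (1 / (U * Y)) * ((1 / (V * X)) * g n) * 1"
      using W pos' g0[of n] by (intro mult_left_mono) auto
    also have "\<dots> \<le> (inv_square l + inv_square (l + m + n)) * ((inv_square m + inv_square (m + n)) * g n)"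
      unfolding mult_1_right
    proof (intro mult_mono g0 order_refl)
      show "1 / (U * Y) \<le> inv_square l + inv_square (l + m + n)"
        unfolding U_def Y_def by (rule pair_bound[OF i(3,7) pos(1,5)])
      show "1 / (V * X) \<le> inv_square m + inv_square (m + n)"
        unfolding V_def X_def by (rule pair_bound[OF i(4,6) pos(2,4)])
    qed (use pos' g0[of n] in auto)
    finally show "norm (root_term p q a b c s i) \<le> D i"
      by (simp add: i(1) D_def)
  qed simp
qed

text \<open>Covers both right-hand sides by one sign \<open>x\<close>. The function T is a parameter
  so that the same expression can be formed from the single summands of T and from their
  sums.\<close>

definition R_gen :: "complex \<Rightarrow> (nat \<Rightarrow> complex \<Rightarrow> nat \<Rightarrow> complex \<times> complex \<Rightarrow> complex) \<Rightarrow>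
    nat \<Rightarrow> nat \<Rightarrow> nat \<Rightarrow> nat \<Rightarrow> nat \<Rightarrow> complex \<Rightarrow> complex" where
  "R_gen x T p q a b c s =
     2 * (-1) ^ p * (\<Sum>j = 0..p div 2. psi_const x j * (\<Sum>w = 0..p - 2 * j.
        of_nat ((w + a - 1) choose w) * of_nat ((p + c - 2 * j - w - 1) choose (c - 1)) *
        T (q + a + w) s (p + b + c - 2 * j - w) (1, x)))
   + 2 * (-1) ^ (p + a) * (\<Sum>j = 0..c div 2. psi_const x j * (\<Sum>w = 0..c - 2 * j.
        of_nat ((w + a - 1) choose w) * of_nat ((p + c - 2 * j - w - 1) choose (p - 1)) *
        T q (s + of_nat (a + w)) (p + b + c - 2 * j - w) (x, 1)))
   + 2 * (-1) ^ p * (\<Sum>j = 0..a div 2. psi_const x j * (\<Sum>w = 0..p - 1.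
        of_nat ((w + a - 2 * j) choose w) * of_nat ((p + c - 2 - w) choose (c - 1)) *
        T (q + a - 2 * j + w + 1) s (p + b + c - 1 - w) (x, x)))
   + 2 * (-1) ^ (p + a) * (\<Sum>j = 0..a div 2. psi_const x j * (\<Sum>w = 0..c - 1.
        of_nat ((w + a - 2 * j) choose w) * of_nat ((p + c - 2 - w) choose (p - 1)) *
        T q (s + of_nat (a - 2 * j + w + 1)) (p + b + c - 1 - w) (x, x)))"

lemma J0_eq_R_gen: "J0 p q a b c s = R_gen 1 T_fun p q a b c s"
  unfolding J0_def R_sum_def R_gen_def Riemann_zeta_even ..

lemma J2_eq_R_gen: "J2 p q a b c s = R_gen (-1) T_fun p q a b c s"
  unfolding J2_def R_sum_def R_gen_def zeta_phi_even ..

lemma sum_sum_mult_cong: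
  fixes y :: "'a::comm_semiring_0"
  assumes "\<And>j w. j \<in> J \<Longrightarrow> w \<in> W j \<Longrightarrow> y * e j w = e' j w"
  shows "y * (r * (\<Sum>j\<in>J. f j * (\<Sum>w\<in>W j. c j w * e j w))) = r * (\<Sum>j\<in>J. f j * (\<Sum>w\<in>W j. c j w * e' j w))"
proof -
  have "r * (\<Sum>j\<in>J. f j * (\<Sum>w\<in>W j. c j w * e' j w)) = r * (\<Sum>j\<in>J. f j * (\<Sum>w\<in>W j. c j w * (y * e j w)))"
    using assms by (intro arg_cong[of _ _ "\<lambda>z. r * z"] sum.cong refl arg_cong2[of _ _ _ _ "(*)"]) auto
  then show ?thesis by (simp add: sum_distrib_left mult_ac)
qed

text \<open>Shows where the sign pairs of \<open>J2\<close> come from. The weight contributes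
  \<open>x powi n\<close>, and the poles 0, -m-n and -m contribute 1, \<open>x powi (m + n)\<close>
  and \<open>x powi m\<close>. As x^2 = 1, the products are x^n, x^m and x^(m+n), that is the pairs
  \<open>(1, x)\<close>, \<open>(x, 1)\<close> and \<open>(x, x)\<close>.\<close>

lemma weight_times_inner_value:
  fixes x :: complex and m n :: int
  assumes x: "x = 1 \<or> x = -1" and n: "n \<ge> 1" and pos: "p \<ge> 1" "a \<ge> 1" "c \<ge> 1"
  shows "x powi n / (of_int m ^ q * of_int n powr s * of_int (m + n) ^ b) * inner_value x p a c m n =
     R_gen x (\<lambda>P S Q u. T_term P S Q u (m, n)) p q a b c s"
proof -
  have np: "of_int n powr (s + of_nat k) = of_int n powr s * of_int n ^ k" for k
    using n by (simp add: powr_add powr_nat')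
  have xx: "x powi n * x powi (m + n) = x powi m" "x powi n * x powi m = x powi m * x powi n"
    using powi_sign(1,3)[OF x] by (simp_all add: power_int_add mult_ac)
  show ?thesis
    unfolding inner_value_def R_gen_def distrib_left
  proof (intro arg_cong2[of _ _ _ _ "(+)"] sum_sum_mult_cong)
    fix j w assume "j \<in> {0..p div 2}" "w \<in> {0..p - 2 * j}"
    then have e: "p + b + c - 2 * j - w = b + (p + c - 2 * j - w)" using pos by auto
    show "x powi n / (of_int m ^ q * of_int n powr s * of_int (m + n) ^ b) * (1 / (of_int m ^ (a + w) * of_int (m + n) ^ (p + c - 2 * j - w))) =
        T_term (q + a + w) s (p + b + c - 2 * j - w) (1, x) (m, n)"
      unfolding T_term_def e by (simp add: power_add mult_ac)
  next
    fix j w assume "j \<in> {0..c div 2}" "w \<in> {0..c - 2 * j}"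
    then have e: "p + b + c - 2 * j - w = b + (p + c - 2 * j - w)" using pos by auto
    show "x powi n / (of_int m ^ q * of_int n powr s * of_int (m + n) ^ b) * (x powi (m + n) / (of_int n ^ (a + w) * of_int (m + n) ^ (p + c - 2 * j - w))) =
        T_term q (s + of_nat (a + w)) (p + b + c - 2 * j - w) (x, 1) (m, n)"
      unfolding T_term_def e prod.case fst_conv snd_conv np times_divide_times_eq xx by (simp add: power_add mult_ac)
  next
    fix j w assume jw: "j \<in> {0..a div 2}" "w \<in> {0..p - 1}"
    have e: "p + b + c - 1 - w = b + (p + c - 1 - w)" using jw pos by auto
    have e2: "q + a - 2 * j + w + 1 = q + (a - 2 * j + w + 1)" using le_div_imp_mult_le[of j a] jw by auto
    show "x powi n / (of_int m ^ q * of_int n powr s * of_int (m + n) ^ b) * (x powi m / (of_int m ^ (a - 2 * j + w + 1) * of_int (m + n) ^ (p + c - 1 - w))) =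
        T_term (q + a - 2 * j + w + 1) s (p + b + c - 1 - w) (x, x) (m, n)"
      unfolding T_term_def e e2 prod.case fst_conv snd_conv times_divide_times_eq xx power_add[of _ q] power_add[of _ b] by (simp add: mult_ac)
  next
    fix j w assume jw: "j \<in> {0..a div 2}" "w \<in> {0..c - 1}"
    have e: "p + b + c - 1 - w = b + (p + c - 1 - w)" using jw pos by auto
    show "x powi n / (of_int m ^ q * of_int n powr s * of_int (m + n) ^ b) * (x powi m / (of_int n ^ (a - 2 * j + w + 1) * of_int (m + n) ^ (p + c - 1 - w))) =
        T_term q (s + of_nat (a - 2 * j + w + 1)) (p + b + c - 1 - w) (x, x) (m, n)"
      unfolding T_term_def e prod.case fst_conv snd_conv np times_divide_times_eq xx power_add[of _ b] by (simp add: mult_ac)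
  qed
qed

text \<open>\<open>R_gen\<close> is a finite linear combination of values of T. What has to be
  checked is that all arguments stay in the range of absolute convergence, in particular that no
  truncated difference of exponents reaches 0.\<close>

lemma R_gen_has_sum:
  assumes x: "x = 1 \<or> x = -1" and pos: "p \<ge> 1" "q \<ge> 1" "a \<ge> 1" "b \<ge> 1" "c \<ge> 1" and s: "Re s > 1"
    and T: "\<And>P S Q u. sign_pair u \<Longrightarrow> P \<ge> 1 \<Longrightarrow> Q \<ge> 1 \<Longrightarrow> Re S > 1 \<Longrightarrow> ((\<lambda>i. T i P S Q u) has_sum V P S Q u) A"
  shows "((\<lambda>i. R_gen x (T i) p q a b c s) has_sum R_gen x V p q a b c s) A"
proof -
  have sp: "sign_pair (1, x)" "sign_pair (x, 1)" "sign_pair (x, x)" using x by (auto simp: sign_pair_def)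
  have "1 \<le> p + b + c - 2 * j - w" if "j \<in> {0..p div 2}" "w \<in> {0..p - 2 * j}" for j w
    using that pos by auto
  moreover have "1 \<le> p + b + c - 2 * j - w" if "j \<in> {0..c div 2}" "w \<in> {0..c - 2 * j}" for j w
    using that pos by auto
  moreover have "1 \<le> p + b + c - 1 - w" if "w \<in> {0..p - 1} \<or> w \<in> {0..c - 1}" for w
    using that pos by auto
  moreover have "1 \<le> q + a + w" "1 \<le> q + a - 2 * j + w + 1" for j w using pos by auto
  moreover have "Re (s + of_nat k) > 1" for k using s by simp
  ultimately show ?thesis
    unfolding R_gen_def
    by (intro has_sum_add has_sum_cmult_right has_sum_finite_sum T sp s pos) blast+
qed

text \<open>The triple series is arranged over the pairs \<open>(m, n)\<close> in
  \<open>T_index\<close>, with \<open>l\<close> avoiding the three poles; after the sum over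
  \<open>l\<close> the remaining double series consists of summands of T.\<close>

lemma root_sum_eq_R_gen:
  assumes x: "x = 1 \<or> x = -1" and pos: "p \<ge> 1" "q \<ge> 1" "a \<ge> 1" "b \<ge> 1" "c \<ge> 1" and s: "Re s > 1"
  shows "((\<lambda>(l, m, n). x powi (l + n) * root_term p q a b c s (l, m, n)) has_sum R_gen x T_fun p q a b c s) root_index"
proof -
  define f where "f = (\<lambda>(l, m, n). x powi (l + n) * root_term p q a b c s (l, m, n))"
  have abs: "(\<lambda>i. norm (f i)) summable_on root_index"
  proof -
    have "norm (f i) = norm (root_term p q a b c s i)" for i
      using powi_sign(4)[OF x] by (auto simp: f_def norm_mult split: prod.splits)
    then show ?thesis using root_term_abs_summable[OF pos s] by simp
  qed
  define S where "S = infsum f root_index"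
  have fS: "(f has_sum S) root_index" unfolding S_def
    by (intro has_sum_infsum abs_summable_summable[OF abs])
  define E where "E = (\<lambda>i::int \<times> int. {0, - fst i, - fst i - snd i})"
  define h where "h = (\<lambda>(i::int \<times> int, l). f (l, fst i, snd i))"
  have bij: "(h has_sum S) (Sigma T_index (\<lambda>i. UNIV - E i)) \<longleftrightarrow> (f has_sum S) root_index"
    by (rule has_sum_reindex_bij_witness[of _ "\<lambda>(l, m, n). ((m, n), l)" "\<lambda>((m, n), l). (l, m, n)"])
       (auto simp: T_index_def root_index_def E_def h_def)
  then have hS: "(h has_sum S) (Sigma T_index (\<lambda>i. UNIV - E i))" using fS by blast
  have "((\<lambda>i. R_gen x (\<lambda>P S Q u. T_term P S Q u i) p q a b c s) has_sum S) T_index"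
  proof (rule has_sum_SigmaD[OF hS])
    fix i assume i: "i \<in> T_index"
    obtain m n where mn: "i = (m, n)" by (cases i)
    have m: "m \<noteq> 0" "n \<ge> 1" "m + n \<noteq> 0" using i mn by (auto simp: T_index_def)
    define W where "W = x powi n / (of_int m ^ q * of_int n powr s * of_int (m + n) ^ b)"
    have nz: "(of_int m :: complex) \<noteq> 0" "(of_int n :: complex) powr s \<noteq> 0" "(of_int (m + n) :: complex) \<noteq> 0"
      using m by (simp_all only: of_int_eq_0_iff powr_eq_0_iff not_False_eq_True)
    have W0: "W \<noteq> 0" unfolding W_def using nz powi_sign(1)[OF x] by (simp del: of_int_add)
    define F where "F = (\<lambda>l. x powi l / (of_int l ^ p * of_int (l + m) ^ a * of_int (l + m + n) ^ c))"
    have eq: "h (i, l) = W * F l" for l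
      unfolding h_def mn f_def root_term_def W_def F_def prod.case fst_conv snd_conv
      using powi_sign(1)[OF x] by (simp add: power_int_add mult_ac del: of_int_add)
    have "(\<lambda>(i, l). h (i, l)) summable_on (Sigma T_index (\<lambda>i. UNIV - E i))"
      using hS by (auto simp: summable_on_def)
    from summable_on_SigmaD1[OF this i] have "(\<lambda>l. W * F l) summable_on (UNIV - E i)"
      unfolding eq .
    then have Fs: "F summable_on (UNIV - E i)"
      using summable_on_cmult_right'[OF W0, of F] by blast
    have Ei: "E i = {0, - m, - m - n}" by (simp add: E_def mn)
    have "(F has_sum inner_value x p a c m n) (UNIV - E i)"
    proof (rule has_sum_of_symmetric_limit[OF Fs])
      show "(\<lambda>N::nat. sum F ({- int N..int N} - E i)) \<longlonglongrightarrow> inner_value x p a c m n"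
        unfolding Ei F_def by (rule symmetric_sum_three_poles[OF x]) (use m pos in auto)
    qed (simp add: Ei)
    then have "((\<lambda>l. h (i, l)) has_sum W * inner_value x p a c m n) (UNIV - E i)"
      unfolding eq by (rule has_sum_cmult_right)
    moreover have "W * inner_value x p a c m n = R_gen x (\<lambda>P S Q u. T_term P S Q u i) p q a b c s"
      unfolding W_def mn by (rule weight_times_inner_value[OF x]) (use m pos in auto)
    ultimately show "((\<lambda>l. h (i, l)) has_sum R_gen x (\<lambda>P S Q u. T_term P S Q u i) p q a b c s) (UNIV - E i)"
      by (simp only:)
  qed
  moreover have "((\<lambda>i. R_gen x (\<lambda>P S Q u. T_term P S Q u i) p q a b c s) has_sum R_gen x T_fun p q a b c s) T_index"
  proof (rule R_gen_has_sum[OF x pos s])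
    fix P Q :: nat and S :: complex and u assume *: "sign_pair u" "P \<ge> 1" "Q \<ge> 1" "Re S > 1"
    show "((\<lambda>i. T_term P S Q u i) has_sum T_fun P S Q u) T_index"
      using T_term_has_sum[OF *] T_fun_eq_T_series[OF *] by simp
  qed
  ultimately have "S = R_gen x T_fun p q a b c s" by (rule has_sum_unique)
  then show ?thesis using fS by (simp only: f_def)
qed

lemma R_gen_meromorphic:
  assumes x: "x = 1 \<or> x = -1" and pos: "p \<ge> 1" "q \<ge> 1" "a \<ge> 1" "b \<ge> 1" "c \<ge> 1"
  shows "(\<lambda>s. R_gen x T_fun p q a b c s) meromorphic_on UNIV"
proof -
  have T0: "(\<lambda>s. T_fun P s Q u) meromorphic_on UNIV" if "sign_pair u" "P \<ge> 1" "Q \<ge> 1" for P Q u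
    using T_fun_meromorphic[OF that, of 0] by simp
  show ?thesis unfolding R_gen_def
    by (intro meromorphic_on_add meromorphic_on_mult meromorphic_on_const meromorphic_on_sum T0 T_fun_meromorphic)
       (use x pos in \<open>auto simp: sign_pair_def\<close>)
qed

section \<open>Decomposition into Weyl chambers\<close>

lemma vector_6:
  fixes x1 x2 x3 x4 x5 x6 :: "'a::zero"
  shows "(vector [x1, x2, x3, x4, x5, x6] :: 'a ^ 6) $ 1 = x1" "(vector [x1, x2, x3, x4, x5, x6] :: 'a ^ 6) $ 2 = x2"
    "(vector [x1, x2, x3, x4, x5, x6] :: 'a ^ 6) $ 3 = x3" "(vector [x1, x2, x3, x4, x5, x6] :: 'a ^ 6) $ 4 = x4"
    "(vector [x1, x2, x3, x4, x5, x6] :: 'a ^ 6) $ 5 = x5" "(vector [x1, x2, x3, x4, x5, x6] :: 'a ^ 6) $ 6 = x6"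
  unfolding vector_def by simp_all

definition even_index :: "(int \<times> int \<times> int) set" where
  "even_index = {(l, m, n). (l, m, n) \<in> root_index \<and> even (l + n)}"

text \<open>The twelve Weyl chambers on which the coroot coordinate \<open>n\<close> is positive, numbered as the summands
  of \<open>S_terms\<close>.\<close>

definition chamber :: "int \<times> int \<times> int \<Rightarrow> nat" where
  "chamber = (\<lambda>(l, m, n).
     if m > 0 then (if l > 0 then 0 else if l + m > 0 then 1 else if l + m + n > 0 then 2 else 3)
     else if l + m > 0 then (if m + n > 0 then 4 else 5)
     else if l > 0 then (if l + m + n > 0 then (if m + n > 0 then 6 else 7) else 8)
     else if m + n > 0 then (if l + m + n > 0 then 9 else 10) else 11)"

text \<open>For integers, non-zero and not positive means at most -1. In this form the case
  distinctions of \<open>chamber\<close> become linear arithmetic.\<close>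

lemma root_index_signs:
  assumes "(l, m, n) \<in> root_index"
  shows "1 \<le> n \<and> (l \<le> 0 \<longrightarrow> l \<le> - 1) \<and> (m \<le> 0 \<longrightarrow> m \<le> - 1) \<and> (l + m \<le> 0 \<longrightarrow> l + m \<le> - 1) \<and>
    (m + n \<le> 0 \<longrightarrow> m + n \<le> - 1) \<and> (l + m + n \<le> 0 \<longrightarrow> l + m + n \<le> - 1)"
  using assms unfolding root_index_def by auto

lemma SO6_term_int:
  assumes "1 \<le> u" "1 \<le> v" "1 \<le> w"
  shows "SO6_term z (nat u, nat v, nat w) =
     1 / (of_int u powr vec_nth z 1 * of_int v powr vec_nth z 2 * of_int w powr vec_nth z 3 *
          of_int (u + v) powr vec_nth z 4 * of_int (v + w) powr vec_nth z 5 * of_int (u + v + w) powr vec_nth z 6)"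
proof -
  have "of_nat (nat u) = (of_int u :: complex)" "of_nat (nat v) = (of_int v :: complex)" "of_nat (nat w) = (of_int w :: complex)"
    using assms by simp_all
  then show ?thesis unfolding SO6_term_def prod.case of_nat_add of_int_add by (simp only:)
qed

lemma of_int_powr_of_nat: "k \<ge> 1 \<Longrightarrow> (of_int k :: complex) powr of_nat n = of_int k ^ n"
  by (rule powr_nat') simp

text \<open>Meant for positive capitals, the absolute values of the linear forms, with sign
  exponents 0 or 1. \<open>n\<close> has no sign, since it is raised to a complex power.\<close>

lemma root_term_signs:
  assumes "l = (-1) ^ e1 * L" "m = (-1) ^ e2 * M" "n = N" "l + m = (-1) ^ e3 * X" "m + n = (-1) ^ e4 * Y" "l + m + n = (-1) ^ e5 * Z"
  shows "root_term p q a b c s (l, m, n) = (-1) ^ (e1 * p + e2 * q + e3 * a + e4 * b + e5 * c) *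
     (1 / (of_int L ^ p * of_int M ^ q * of_int N powr s * of_int X ^ a * of_int Y ^ b * of_int Z ^ c))"
proof -
  have pw: "(of_int ((-1) ^ e * K) :: complex) ^ r = (-1) ^ (e * r) * of_int K ^ r" for e r K
    by (simp add: power_mult_distrib power_mult)
  have inv: "1 / ((-1) ^ r :: complex) = (-1) ^ r" for r
    by (cases "even r") auto
  have "root_term p q a b c s (l, m, n) =
     1 / ((-1) ^ (e1 * p + e2 * q + e3 * a + e4 * b + e5 * c)) *
     (1 / (of_int L ^ p * of_int M ^ q * of_int N powr s * of_int X ^ a * of_int Y ^ b * of_int Z ^ c))"
    unfolding root_term_def prod.case assms(6) unfolding assms(5) unfolding assms(4) unfolding assms(1-3) pw
    by (simp add: power_add mult_ac)
  then show ?thesis unfolding inv .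
qed

lemmas SO6_term_simps = SO6_term_int vector_6 of_int_powr_of_nat add_ac mult_ac

context
  fixes G :: "complex ^ 6 \<Rightarrow> complex" and p q a b c :: nat and s :: complex
  assumes G: "is_zeta_SO6 G" and pos: "p \<ge> 1" "q \<ge> 1" "a \<ge> 1" "b \<ge> 1" "c \<ge> 1" and s: "Re s > 1"
begin

text \<open>The maps \<open>l\<close>, \<open>m\<close>, \<open>n\<close> express a point of the
  chamber by its positive coordinates, and \<open>u\<close>, \<open>v\<close>, \<open>w\<close> are
  their inverses. The linear forms are permuted up to sign and the parity condition is preserved, so
  the part of the series over the chamber is, up to sign, the SO(6) series at the exponent vector
  \<open>e\<close>.\<close>

lemma chamber_has_sum:
  fixes l m n u v w :: "int \<Rightarrow> int \<Rightarrow> int \<Rightarrow> int"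
  assumes root_term_eq: "\<And>x y z. 1 \<le> x \<Longrightarrow> 1 \<le> y \<Longrightarrow> 1 \<le> z \<Longrightarrow>
        root_term p q a b c s (l x y z, m x y z, n x y z) = (-1) ^ k * SO6_term e (nat x, nat y, nat z)"
    and mem: "\<And>x y z. 1 \<le> x \<Longrightarrow> 1 \<le> y \<Longrightarrow> 1 \<le> z \<Longrightarrow>
        (l x y z, m x y z, n x y z) \<in> root_index \<and> chamber (l x y z, m x y z, n x y z) = j"
    and parity: "\<And>x y z. even (l x y z + n x y z) \<longleftrightarrow> even (x + z)"
    and inv1: "\<And>x y z. u (l x y z) (m x y z) (n x y z) = x \<and> v (l x y z) (m x y z) (n x y z) = y \<and>
        w (l x y z) (m x y z) (n x y z) = z"
    and inv2: "\<And>x y z. l (u x y z) (v x y z) (w x y z) = x \<and> m (u x y z) (v x y z) (w x y z) = y \<and>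
        n (u x y z) (v x y z) (w x y z) = z"
    and ge_1: "\<And>x y z. (x, y, z) \<in> root_index \<Longrightarrow> chamber (x, y, z) = j \<Longrightarrow>
        1 \<le> u x y z \<and> 1 \<le> v x y z \<and> 1 \<le> w x y z"
  shows "(root_term p q a b c s has_sum (-1) ^ k * G e) {i \<in> even_index. chamber i = j}"
proof -
  let ?R = "{i \<in> even_index. chamber i = j}" and ?f = "root_term p q a b c s"
  define to where "to = (\<lambda>(x, y, z). (l (int x) (int y) (int z), m (int x) (int y) (int z), n (int x) (int y) (int z)))"
  define from' where "from' = (\<lambda>(x, y, z). (nat (u x y z), nat (v x y z), nat (w x y z)))"
  have par: "x mod 2 = z mod 2 \<longleftrightarrow> even (int x + int z)" for x z :: nat by presburger
  have w: "\<And>y. y \<in> SO6_index \<Longrightarrow> from' (to y) = y" "\<And>y. y \<in> SO6_index \<Longrightarrow> to y \<in> ?R"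
     "\<And>y. y \<in> ?R \<Longrightarrow> to (from' y) = y" "\<And>y. y \<in> ?R \<Longrightarrow> from' y \<in> SO6_index"
     "\<And>y. y \<in> SO6_index \<Longrightarrow> ?f (to y) = (-1) ^ k * SO6_term e y"
  proof -
    fix i assume "i \<in> SO6_index"
    then obtain x y z where i: "i = (x, y, z)" "1 \<le> int x" "1 \<le> int y" "1 \<le> int z" "even (int x + int z)"
      by (cases i) (auto simp: SO6_index_def par)
    show "from' (to i) = i" using inv1[of "int x" "int y" "int z"] by (simp add: from'_def to_def i(1))
    show "to i \<in> ?R" using mem[OF i(2-4)] parity[of "int x" "int y" "int z"] i(5)
      by (simp add: to_def i(1) even_index_def)
    show "?f (to i) = (-1) ^ k * SO6_term e i" using root_term_eq[OF i(2-4)] by (simp add: to_def i(1))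
  next
    fix i assume "i \<in> ?R"
    then obtain x y z where i: "i = (x, y, z)" "(x, y, z) \<in> root_index" "even (x + z)" "chamber (x, y, z) = j"
      by (cases i) (auto simp: even_index_def)
    note ge = ge_1[OF i(2,4)]
    have "even (u x y z + w x y z)"
      using parity[of "u x y z" "v x y z" "w x y z"] inv2[of x y z] i(3) by simp
    then show "from' i \<in> SO6_index" using ge by (simp add: from'_def i(1) SO6_index_def par Suc_le_eq even_nat_iff)
    show "to (from' i) = i" using inv2[of x y z] ge by (simp add: from'_def to_def i(1))
  qed
  \<comment> \<open>Absolute convergence at \<open>e\<close> is inherited from the root sum; by
    \<open>is_zeta_SO6\<close> it is what makes \<open>G e\<close> the value of the series.\<close>
  have "(\<lambda>y. norm (SO6_term e y)) summable_on SO6_index \<longleftrightarrow> (\<lambda>y. norm (?f y)) summable_on ?R"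
    by (rule summable_on_reindex_bij_witness[of _ from' to]) (use w in \<open>auto simp: norm_mult norm_power\<close>)
  moreover have "(\<lambda>y. norm (?f y)) summable_on ?R"
    by (rule summable_on_subset[OF root_term_abs_summable[OF pos s]]) (auto simp: even_index_def)
  ultimately have abs: "(\<lambda>y. norm (SO6_term e y)) summable_on SO6_index" by blast
  then have "G e = infsum (SO6_term e) SO6_index" using G unfolding is_zeta_SO6_def by blast
  then have "(SO6_term e has_sum G e) SO6_index" using abs_summable_summable[OF abs] by simp
  then have "((\<lambda>y. (-1) ^ k * SO6_term e y) has_sum (-1) ^ k * G e) SO6_index" by (rule has_sum_cmult_right)
  moreover have "((\<lambda>y. (-1) ^ k * SO6_term e y) has_sum (-1) ^ k * G e) SO6_index \<longleftrightarrow> (?f has_sum (-1) ^ k * G e) ?R"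
    by (rule has_sum_reindex_bij_witness[of _ from' to]) (use w in auto)
  ultimately show ?thesis by blast
qed

text \<open>This and the eleven lemmas after it follow one pattern. The maps are the coordinates of
  the chamber and their inverses. The instance of \<open>root_term_signs\<close> lists sign and
  absolute value of l, m, l + m, m + n and l + m + n; reading off which form became u, v, w, u + v,
  v + w or u + v + w gives the order of the exponents.\<close>

lemma chamber_0:
  "(root_term p q a b c s has_sum (-1) ^ (0) * G (vector [of_nat p, of_nat q, s, of_nat a, of_nat b, of_nat c])) {i \<in> even_index. chamber i = 0}"
  apply (rule chamber_has_sum[where l = "\<lambda>u v w. u" and m = "\<lambda>u v w. v" and n = "\<lambda>u v w. w"
      and u = "\<lambda>l m n. l" and v = "\<lambda>l m n. m" and w = "\<lambda>l m n. n"])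
  subgoal for u v w
    by (subst root_term_signs[of _ 0 u _ 0 v _ w 0 "u + v" 0 "v + w" 0 "u + v + w"]) (simp_all add: SO6_term_simps del: of_int_add)
      apply (simp add: root_index_def chamber_def)
     apply presburger
    apply simp
   apply simp
  apply (drule root_index_signs; simp only: chamber_def prod.case not_less split: if_split_asm; auto)
  done

lemma chamber_1:
  "(root_term p q a b c s has_sum (-1) ^ (p) * G (vector [of_nat p, of_nat a, s, of_nat q, of_nat c, of_nat b])) {i \<in> even_index. chamber i = 1}"
  apply (rule chamber_has_sum[where l = "\<lambda>u v w. - u" and m = "\<lambda>u v w. u + v" and n = "\<lambda>u v w. w"
      and u = "\<lambda>l m n. - l" and v = "\<lambda>l m n. l + m" and w = "\<lambda>l m n. n"])
  subgoal for u v w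
    by (subst root_term_signs[of _ 1 u _ 0 "u + v" _ w 0 v 0 "u + v + w" 0 "v + w"]) (simp_all add: SO6_term_simps del: of_int_add)
      apply (simp add: root_index_def chamber_def)
     apply presburger
    apply simp
   apply simp
  apply (drule root_index_signs; simp only: chamber_def prod.case not_less split: if_split_asm; auto)
  done

lemma chamber_2:
  "(root_term p q a b c s has_sum (-1) ^ (p + a) * G (vector [of_nat q, of_nat a, of_nat c, of_nat p, s, of_nat b])) {i \<in> even_index. chamber i = 2}"
  apply (rule chamber_has_sum[where l = "\<lambda>u v w. - u - v" and m = "\<lambda>u v w. u" and n = "\<lambda>u v w. v + w"
      and u = "\<lambda>l m n. m" and v = "\<lambda>l m n. - l - m" and w = "\<lambda>l m n. l + m + n"])
  subgoal for u v w
    by (subst root_term_signs[of _ 1 "u + v" _ 0 u _ "v + w" 1 v 0 "u + v + w" 0 w]) (simp_all add: SO6_term_simps del: of_int_add)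
      apply (simp add: root_index_def chamber_def)
     apply presburger
    apply simp
   apply simp
  apply (drule root_index_signs; simp only: chamber_def prod.case not_less split: if_split_asm; auto)
  done

lemma chamber_3:
  "(root_term p q a b c s has_sum (-1) ^ (p + a + c) * G (vector [of_nat q, s, of_nat c, of_nat b, of_nat a, of_nat p])) {i \<in> even_index. chamber i = 3}"
  apply (rule chamber_has_sum[where l = "\<lambda>u v w. - u - v - w" and m = "\<lambda>u v w. u" and n = "\<lambda>u v w. v"
      and u = "\<lambda>l m n. m" and v = "\<lambda>l m n. n" and w = "\<lambda>l m n. - l - m - n"])
  subgoal for u v w
    by (subst root_term_signs[of _ 1 "u + v + w" _ 0 u _ v 1 "v + w" 0 "u + v" 1 w]) (simp_all add: SO6_term_simps del: of_int_add)
      apply (simp add: root_index_def chamber_def)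
     apply presburger
    apply simp
   apply simp
  apply (drule root_index_signs; simp only: chamber_def prod.case not_less split: if_split_asm; auto)
  done

lemma chamber_4:
  "(root_term p q a b c s has_sum (-1) ^ (q) * G (vector [of_nat a, of_nat q, of_nat b, of_nat p, s, of_nat c])) {i \<in> even_index. chamber i = 4}"
  apply (rule chamber_has_sum[where l = "\<lambda>u v w. u + v" and m = "\<lambda>u v w. - v" and n = "\<lambda>u v w. v + w"
      and u = "\<lambda>l m n. l + m" and v = "\<lambda>l m n. - m" and w = "\<lambda>l m n. m + n"])
  subgoal for u v w
    by (subst root_term_signs[of _ 0 "u + v" _ 1 v _ "v + w" 0 u 0 w 0 "u + v + w"]) (simp_all add: SO6_term_simps del: of_int_add)
      apply (simp add: root_index_def chamber_def)
     apply presburger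
    apply simp
   apply simp
  apply (drule root_index_signs; simp only: chamber_def prod.case not_less split: if_split_asm; auto)
  done

lemma chamber_5:
  "(root_term p q a b c s has_sum (-1) ^ (q + b) * G (vector [of_nat a, s, of_nat b, of_nat c, of_nat q, of_nat p])) {i \<in> even_index. chamber i = 5}"
  apply (rule chamber_has_sum[where l = "\<lambda>u v w. u + v + w" and m = "\<lambda>u v w. - v - w" and n = "\<lambda>u v w. v"
      and u = "\<lambda>l m n. l + m" and v = "\<lambda>l m n. n" and w = "\<lambda>l m n. - m - n"])
  subgoal for u v w
    by (subst root_term_signs[of _ 0 "u + v + w" _ 1 "v + w" _ v 0 u 1 w 0 "u + v"]) (simp_all add: SO6_term_simps del: of_int_add)
      apply (simp add: root_index_def chamber_def)
     apply presburger
    apply simp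
   apply simp
  apply (drule root_index_signs; simp only: chamber_def prod.case not_less split: if_split_asm; auto)
  done

lemma chamber_6:
  "(root_term p q a b c s has_sum (-1) ^ (q + a) * G (vector [of_nat a, of_nat p, of_nat b, of_nat q, of_nat c, s])) {i \<in> even_index. chamber i = 6}"
  apply (rule chamber_has_sum[where l = "\<lambda>u v w. v" and m = "\<lambda>u v w. - u - v" and n = "\<lambda>u v w. u + v + w"
      and u = "\<lambda>l m n. - l - m" and v = "\<lambda>l m n. l" and w = "\<lambda>l m n. m + n"])
  subgoal for u v w
    by (subst root_term_signs[of _ 0 v _ 1 "u + v" _ "u + v + w" 1 u 0 w 0 "v + w"]) (simp_all add: SO6_term_simps del: of_int_add)
      apply (simp add: root_index_def chamber_def)
     apply presburger
    apply simp
   apply simp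
  apply (drule root_index_signs; simp only: chamber_def prod.case not_less split: if_split_asm; auto)
  done

lemma chamber_7:
  "(root_term p q a b c s has_sum (-1) ^ (q + a + b) * G (vector [of_nat a, of_nat c, of_nat b, s, of_nat p, of_nat q])) {i \<in> even_index. chamber i = 7}"
  apply (rule chamber_has_sum[where l = "\<lambda>u v w. v + w" and m = "\<lambda>u v w. - u - v - w" and n = "\<lambda>u v w. u + v"
      and u = "\<lambda>l m n. - l - m" and v = "\<lambda>l m n. l + m + n" and w = "\<lambda>l m n. - m - n"])
  subgoal for u v w
    by (subst root_term_signs[of _ 0 "v + w" _ 1 "u + v + w" _ "u + v" 1 u 1 w 0 v]) (simp_all add: SO6_term_simps del: of_int_add)
      apply (simp add: root_index_def chamber_def)
     apply presburger
    apply simp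
   apply simp
  apply (drule root_index_signs; simp only: chamber_def prod.case not_less split: if_split_asm; auto)
  done

lemma chamber_8:
  "(root_term p q a b c s has_sum (-1) ^ (q + a + b + c) * G (vector [s, of_nat c, of_nat p, of_nat a, of_nat b, of_nat q])) {i \<in> even_index. chamber i = 8}"
  apply (rule chamber_has_sum[where l = "\<lambda>u v w. w" and m = "\<lambda>u v w. - u - v - w" and n = "\<lambda>u v w. u"
      and u = "\<lambda>l m n. n" and v = "\<lambda>l m n. - l - m - n" and w = "\<lambda>l m n. l"])
  subgoal for u v w
    by (subst root_term_signs[of _ 0 w _ 1 "u + v + w" _ u 1 "u + v" 1 "v + w" 1 v]) (simp_all add: SO6_term_simps del: of_int_add)
      apply (simp add: root_index_def chamber_def)
     apply presburger
    apply simp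
   apply simp
  apply (drule root_index_signs; simp only: chamber_def prod.case not_less split: if_split_asm; auto)
  done

lemma chamber_9:
  "(root_term p q a b c s has_sum (-1) ^ (p + q + a) * G (vector [of_nat q, of_nat p, of_nat c, of_nat a, of_nat b, s])) {i \<in> even_index. chamber i = 9}"
  apply (rule chamber_has_sum[where l = "\<lambda>u v w. - v" and m = "\<lambda>u v w. - u" and n = "\<lambda>u v w. u + v + w"
      and u = "\<lambda>l m n. - m" and v = "\<lambda>l m n. - l" and w = "\<lambda>l m n. l + m + n"])
  subgoal for u v w
    by (subst root_term_signs[of _ 1 v _ 1 u _ "u + v + w" 1 "u + v" 0 "v + w" 0 w]) (simp_all add: SO6_term_simps del: of_int_add)
      apply (simp add: root_index_def chamber_def)
     apply presburger
    apply simp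
   apply simp
  apply (drule root_index_signs; simp only: chamber_def prod.case not_less split: if_split_asm; auto)
  done

lemma chamber_10:
  "(root_term p q a b c s has_sum (-1) ^ (p + q + a + c) * G (vector [of_nat q, of_nat b, of_nat c, s, of_nat p, of_nat a])) {i \<in> even_index. chamber i = 10}"
  apply (rule chamber_has_sum[where l = "\<lambda>u v w. - v - w" and m = "\<lambda>u v w. - u" and n = "\<lambda>u v w. u + v"
      and u = "\<lambda>l m n. - m" and v = "\<lambda>l m n. m + n" and w = "\<lambda>l m n. - l - m - n"])
  subgoal for u v w
    by (subst root_term_signs[of _ 1 "v + w" _ 1 u _ "u + v" 1 "u + v + w" 0 v 1 w]) (simp_all add: SO6_term_simps del: of_int_add)
      apply (simp add: root_index_def chamber_def)
     apply presburger
    apply simp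
   apply simp
  apply (drule root_index_signs; simp only: chamber_def prod.case not_less split: if_split_asm; auto)
  done

lemma chamber_11:
  "(root_term p q a b c s has_sum (-1) ^ (p + q + a + b + c) * G (vector [s, of_nat b, of_nat p, of_nat q, of_nat c, of_nat a])) {i \<in> even_index. chamber i = 11}"
  apply (rule chamber_has_sum[where l = "\<lambda>u v w. - w" and m = "\<lambda>u v w. - u - v" and n = "\<lambda>u v w. u"
      and u = "\<lambda>l m n. n" and v = "\<lambda>l m n. - m - n" and w = "\<lambda>l m n. - l"])
  subgoal for u v w
    by (subst root_term_signs[of _ 1 w _ 1 "u + v" _ u 1 "u + v + w" 1 v 1 "v + w"]) (simp_all add: SO6_term_simps del: of_int_add)
      apply (simp add: root_index_def chamber_def)
     apply presburger
    apply simp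
   apply simp
  apply (drule root_index_signs; simp only: chamber_def prod.case not_less split: if_split_asm; auto)
  done

end

section \<open>Assembly of the chambers and the relation for Re s > 1\<close>

lemma has_sum_fibers:
  fixes f :: "'a \<Rightarrow> complex" and c :: "'a \<Rightarrow> 'k"
  assumes K: "finite K" "\<And>i. i \<in> A \<Longrightarrow> c i \<in> K" and f: "\<And>k. k \<in> K \<Longrightarrow> (f has_sum V k) {i \<in> A. c i = k}"
  shows "(f has_sum (\<Sum>k\<in>K. V k)) A"
proof -
  have "((\<lambda>i. if c i = k then f i else 0) has_sum V k) A" if "k \<in> K" for k
  proof -
    have "((\<lambda>i. if c i = k then f i else 0) has_sum V k) A \<longleftrightarrow> (f has_sum V k) {i \<in> A. c i = k}"
      by (rule has_sum_cong_neutral) auto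
    then show ?thesis using f[OF that] by blast
  qed
  then have "((\<lambda>i. \<Sum>k\<in>K. if c i = k then f i else 0) has_sum (\<Sum>k\<in>K. V k)) A"
    by (rule has_sum_finite_sum)
  moreover have "(\<Sum>k\<in>K. if c i = k then f i else 0) = f i" if "i \<in> A" for i
    using K that by simp
  then have "((\<lambda>i. \<Sum>k\<in>K. if c i = k then f i else 0) has_sum (\<Sum>k\<in>K. V k)) A \<longleftrightarrow> (f has_sum (\<Sum>k\<in>K. V k)) A"
    by (rule has_sum_cong)
  ultimately show ?thesis by blast
qed

lemma length_S_terms: "length (S_terms p q a b c s) = 12"
  by (simp add: S_terms_def Let_def)

lemma S_sum_altdef:
  "S_sum F p q a b c s = (\<Sum>k<12. (-1) ^ fst (S_terms p q a b c s ! k) * F (snd (S_terms p q a b c s ! k)))"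
  unfolding S_sum_def by (simp add: sum_list_sum_nth length_S_terms atLeast0LessThan case_prod_unfold)

lemma less_12_cases: "k < (12::nat) \<Longrightarrow> k \<in> {0, 1, 2, 3, 4, 5, 6, 7, 8, 9, 10, 11}"
  unfolding insert_iff empty_iff by presburger

lemma S_sum_has_sum:
  assumes G: "is_zeta_SO6 G" and pos: "p \<ge> 1" "q \<ge> 1" "a \<ge> 1" "b \<ge> 1" "c \<ge> 1" and s: "Re s > 1"
  shows "(root_term p q a b c s has_sum S_sum G p q a b c s) even_index"
  unfolding S_sum_altdef
proof (rule has_sum_fibers[where c = chamber])
  show "chamber i \<in> {..<12}" for i by (cases i) (auto simp: chamber_def)
  fix k :: nat assume "k \<in> {..<12}"
  note ch = chamber_0[OF G pos s] chamber_1[OF G pos s] chamber_2[OF G pos s] chamber_3[OF G pos s]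
    chamber_4[OF G pos s] chamber_5[OF G pos s] chamber_6[OF G pos s] chamber_7[OF G pos s]
    chamber_8[OF G pos s] chamber_9[OF G pos s] chamber_10[OF G pos s] chamber_11[OF G pos s]
  have "k \<in> {0, 1, 2, 3, 4, 5, 6, 7, 8, 9, 10, 11}" using less_12_cases \<open>k \<in> {..<12}\<close> by blast
  then show "(root_term p q a b c s has_sum (-1) ^ fst (S_terms p q a b c s ! k) * G (snd (S_terms p q a b c s ! k)))
          {i \<in> even_index. chamber i = k}"
    by (elim insertE emptyE; simp only: S_terms_def Let_def)
       (insert ch, simp_all)
qed simp

text \<open>The factors 1 and (-1)^(l + n) add up to 2 on \<open>even_index\<close> and to 0 on the
  rest of \<open>root_index\<close>.\<close>

lemma S_sum_eq_halfplane:
  assumes G: "is_zeta_SO6 G" and pos: "p \<ge> 1" "q \<ge> 1" "a \<ge> 1" "b \<ge> 1" "c \<ge> 1" and s: "Re s > 1"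
  shows "S_sum G p q a b c s = (J0 p q a b c s + J2 p q a b c s) / 2"
proof -
  let ?R = "root_term p q a b c s"
  have "((\<lambda>i. (\<lambda>(l, m, n). 1 powi (l + n) * ?R (l, m, n)) i + (\<lambda>(l, m, n). (-1) powi (l + n) * ?R (l, m, n)) i)
     has_sum (J0 p q a b c s + J2 p q a b c s)) root_index"
    unfolding J0_eq_R_gen J2_eq_R_gen
    by (intro has_sum_add root_sum_eq_R_gen pos s) auto
  moreover have "((\<lambda>i. (\<lambda>(l, m, n). 1 powi (l + n) * ?R (l, m, n)) i + (\<lambda>(l, m, n). (-1) powi (l + n) * ?R (l, m, n)) i)
     has_sum V) root_index \<longleftrightarrow> ((\<lambda>i. 2 * ?R i) has_sum V) even_index" for V
    by (rule has_sum_cong_neutral) (auto simp: even_index_def power_int_minus_left split: if_splits)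
  moreover have "((\<lambda>i. 2 * ?R i) has_sum 2 * S_sum G p q a b c s) even_index"
    by (rule has_sum_cmult_right[OF S_sum_has_sum[OF assms]])
  ultimately have "2 * S_sum G p q a b c s = J0 p q a b c s + J2 p q a b c s"
    using has_sum_unique by blast
  then show ?thesis by (simp add: field_simps)
qed

section \<open>The functional relation\<close>

text \<open>The bound 5/6 on the real parts, used from here on, could be any number between 1/2 and
  1: below 1, so that exponents equal to 1 lie inside an open region; above 1/2, so that twice the
  bound, here 5/3, exceeds 1.\<close>

lemma SO6_bound_summable:
  "(\<lambda>(l, m, n). real l powr (- (5/3)) * (real m powr (- (5/3)) * real n powr (- (5/3)))) summable_on SO6_index"
proof -
  define g where "g = (\<lambda>n::nat. real n powr (- (5/3)))"
  have "summable g" unfolding g_def by (subst summable_real_powr_iff) simp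
  then have "g summable_on UNIV" by (rule summable_nonneg_imp_summable_on) (simp add: g_def)
  then have g: "g summable_on {1..}" by (rule summable_on_subset) simp
  have g0: "g n \<ge> 0" for n by (simp add: g_def)
  have "(\<lambda>(m, n). g m * g n) summable_on {1..} \<times> {1..}"
    by (rule summable_on_times_nonneg[OF g _ g]) (auto simp: g0)
  then have "(\<lambda>(l, i). g l * (\<lambda>(m, n). g m * g n) i) summable_on {1..} \<times> ({1..} \<times> {1..})"
    by (rule summable_on_times_nonneg[OF g, rotated]) (auto simp: g0)
  then have "(\<lambda>(l, m, n). g l * (g m * g n)) summable_on {1..} \<times> {1..} \<times> {1..}"
    by (simp add: case_prod_unfold)
  then show ?thesis unfolding g_def by (rule summable_on_subset) (auto simp: SO6_index_def)
qed

text \<open>The estimates l + m >= l, m + n >= m and l + m + n >= n distribute the six factors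
  evenly, two to each variable.\<close>

lemma norm_SO6_term_le:
  assumes z: "\<And>i. Re (vec_nth z i) > 5/6" and i: "(l, m, n) \<in> SO6_index"
  shows "norm (SO6_term z (l, m, n)) \<le> real l powr (- (5/3)) * (real m powr (- (5/3)) * real n powr (- (5/3)))"
proof -
  have pos: "1 \<le> l" "1 \<le> m" "1 \<le> n" using i by (auto simp: SO6_index_def)
  have nrm: "norm (of_nat k powr w :: complex) = real k powr Re w" if "k \<ge> 1" for k :: nat and w
    using norm_powr_real_powr[of "of_nat k" w] that by simp
  have le: "real j powr (5/6) \<le> real k powr Re (vec_nth z i)" if "1 \<le> j" "j \<le> k" for j k i
  proof -
    have "real j powr (5/6) \<le> real k powr (5/6)" using that by (intro powr_mono2) auto
    also have "\<dots> \<le> real k powr Re (vec_nth z i)" using that z[of i] by (intro powr_mono) auto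
    finally show ?thesis .
  qed
  define L M N where "L = real l powr (5/6)" and "M = real m powr (5/6)" and "N = real n powr (5/6)"
  have p: "L > 0" "M > 0" "N > 0" using pos by (auto simp: L_def M_def N_def)
  have "L * M * N * L * M * N \<le> real l powr Re (vec_nth z 1) * real m powr Re (vec_nth z 2) * real n powr Re (vec_nth z 3) *
     real (l + m) powr Re (vec_nth z 4) * real (m + n) powr Re (vec_nth z 5) * real (l + m + n) powr Re (vec_nth z 6)"
    unfolding L_def M_def N_def using pos by (intro mult_mono le) auto
  then have "1 / (real l powr Re (vec_nth z 1) * real m powr Re (vec_nth z 2) * real n powr Re (vec_nth z 3) *
     real (l + m) powr Re (vec_nth z 4) * real (m + n) powr Re (vec_nth z 5) * real (l + m + n) powr Re (vec_nth z 6))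
     \<le> 1 / (L * M * N * L * M * N)"
    using p pos by (intro divide_left_mono mult_pos_pos) auto
  also have "1 / (L * M * N * L * M * N) = 1 / (L * L) * (1 / (M * M) * (1 / (N * N)))" by simp
  also have "\<dots> = real l powr (- (5/3)) * (real m powr (- (5/3)) * real n powr (- (5/3)))"
    by (simp add: L_def M_def N_def powr_minus_divide flip: powr_add)
  finally show ?thesis unfolding SO6_term_def prod.case norm_divide norm_mult norm_one
    using pos by (simp only: nrm trans_le_add1)
qed

text \<open>Meromorphy alone would not exclude wrong values on the zero set of a local denominator.
  In this open region \<open>G\<close> is the series, whose terms are continuous and which converges
  uniformly.\<close>

lemma SO6_zeta_isCont:
  assumes G: "is_zeta_SO6 G" and z: "\<And>i. Re (vec_nth z i) > 5/6"
  shows "isCont G z"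
proof -
  define U where "U = {z :: complex ^ 6. \<forall>i. Re (vec_nth z i) > 5/6}"
  have "U = (\<Inter>i. {z. Re (vec_nth z i) > 5/6})" by (auto simp: U_def)
  moreover have "open {z :: complex ^ 6. Re (vec_nth z i) > 5/6}" for i
    by (intro open_Collect_less continuous_intros)
  ultimately have Uo: "open U" by auto
  have bd: "norm (SO6_term z x) \<le> (\<lambda>(l, m, n). real l powr (- (5/3)) * (real m powr (- (5/3)) * real n powr (- (5/3)))) x"
    if "x \<in> SO6_index" "z \<in> U" for x z
  proof -
    obtain l m n where x: "x = (l, m, n)" by (cases x)
    show ?thesis using norm_SO6_term_le[of z l m n] that unfolding x U_def by simp
  qed
  have lim: "uniform_limit U (\<lambda>X z. \<Sum>x\<in>X. SO6_term z x) (\<lambda>z. \<Sum>\<^sub>\<infinity>x\<in>SO6_index. SO6_term z x) (finite_subsets_at_top SO6_index)"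
    by (rule Weierstrass_m_test_general[OF bd SO6_bound_summable])
  have "continuous_on U (\<lambda>z. \<Sum>\<^sub>\<infinity>x\<in>SO6_index. SO6_term z x)"
  proof (rule uniform_limit_theorem[OF _ lim])
    have cont_term: "continuous_on U (\<lambda>z. SO6_term z x)" if "x \<in> SO6_index" for x
    proof -
      obtain l m n where x: "x = (l, m, n)" by (cases x)
      have pos: "1 \<le> l" "1 \<le> m" "1 \<le> n" using that x by (auto simp: SO6_index_def)
      have c: "continuous_on U (\<lambda>z. (of_nat k :: complex) powr vec_nth z i)" if "k \<ge> 1" for k i
      proof -
        have "(\<lambda>z. (of_nat k :: complex) powr vec_nth z i) = (\<lambda>z. exp (vec_nth z i * ln (of_nat k)))"
          using that by (simp add: powr_def)
        then show ?thesis by (simp only:) (intro continuous_intros)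
      qed
      show ?thesis unfolding x SO6_term_def prod.case
        using pos by (intro continuous_on_divide continuous_on_mult c continuous_on_const) (auto simp: powr_def simp del: of_nat_add)
    qed
    show "eventually (\<lambda>X. continuous_on U (\<lambda>z. \<Sum>x\<in>X. SO6_term z x)) (finite_subsets_at_top SO6_index)"
      by (rule eventually_finite_subsets_at_top_weakI) (auto intro!: continuous_on_sum cont_term)
  qed simp
  moreover have eq: "G z = (\<Sum>\<^sub>\<infinity>x\<in>SO6_index. SO6_term z x)" if "z \<in> U" for z
  proof -
    have "(\<lambda>x. norm (SO6_term z x)) summable_on SO6_index"
      by (rule summable_on_comparison_test[OF SO6_bound_summable]) (use bd that in auto)
    then show ?thesis using G unfolding is_zeta_SO6_def by blast
  qed
  have "continuous_on U G \<longleftrightarrow> continuous_on U (\<lambda>z. \<Sum>\<^sub>\<infinity>x\<in>SO6_index. SO6_term z x)"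
    by (rule continuous_on_cong[OF refl eq])
  ultimately have "continuous_on U G" by blast
  then show ?thesis using Uo z by (auto simp: continuous_on_eq_continuous_at U_def)
qed

section \<open>The summands along complex lines and the identity theorem\<close>

lemma regular_at_imp_eventually_isCont:
  assumes "regular_at G z"
  shows "eventually (isCont G) (nhds z)"
proof -
  obtain U where U: "open U" "z \<in> U" "holomorphic_vec_on G U" using assms unfolding regular_at_def by blast
  have "isCont G y" if "y \<in> U" for y
    using U(3) that unfolding holomorphic_vec_on_def by (meson has_derivative_continuous)
  then show ?thesis using U eventually_nhds by blast
qed

lemma exhaust_6:
  fixes i :: 6
  shows "i = 1 \<or> i = 2 \<or> i = 3 \<or> i = 4 \<or> i = 5 \<or> i = 6"
proof (induct i)
  case (of_int z)
  then have "0 \<le> z" and "z < 6" by simp_all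
  then have "z = 0 \<or> z = 1 \<or> z = 2 \<or> z = 3 \<or> z = 4 \<or> z = 5" by arith
  then show ?case by auto
qed

lemma forall_6: "(\<forall>i::6. P i) \<longleftrightarrow> P 1 \<and> P 2 \<and> P 3 \<and> P 4 \<and> P 5 \<and> P 6"
  by (metis exhaust_6)

lemma vector_6_line:
  fixes w :: complex
  shows "(vector [a1, a2, a3, a4, a5, a6] :: complex ^ 6) =
      vector [b1, b2, b3, b4, b5, b6] + w *s (vector [c1, c2, c3, c4, c5, c6] - vector [b1, b2, b3, b4, b5, b6]) \<longleftrightarrow>
    a1 = b1 + w * (c1 - b1) \<and> a2 = b2 + w * (c2 - b2) \<and> a3 = b3 + w * (c3 - b3) \<and>
    a4 = b4 + w * (c4 - b4) \<and> a5 = b5 + w * (c5 - b5) \<and> a6 = b6 + w * (c6 - b6)"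
  unfolding vec_eq_iff forall_6 vector_add_component vector_smult_component vector_minus_component vector_6 ..

text \<open>Each exponent vector contains \<open>s\<close> in one place, so it moves on a complex
  line; the values at 0 and 1 yield a base point and a direction without naming the position of
  \<open>s\<close>.\<close>

lemma S_terms_line:
  assumes "k < 12"
  shows "fst (S_terms p q a b c w ! k) = fst (S_terms p q a b c 0 ! k)"
    "snd (S_terms p q a b c w ! k) = snd (S_terms p q a b c 0 ! k) +
       w *s (snd (S_terms p q a b c 1 ! k) - snd (S_terms p q a b c 0 ! k))"
proof -
  have "k \<in> {0, 1, 2, 3, 4, 5, 6, 7, 8, 9, 10, 11}" by (rule less_12_cases[OF assms])
  then show "fst (S_terms p q a b c w ! k) = fst (S_terms p q a b c 0 ! k)"
    by (elim insertE emptyE; simp add: S_terms_def Let_def)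
  from \<open>k \<in> _\<close> show "snd (S_terms p q a b c w ! k) = snd (S_terms p q a b c 0 ! k) +
       w *s (snd (S_terms p q a b c 1 ! k) - snd (S_terms p q a b c 0 ! k))"
    by (elim insertE emptyE; simp add: S_terms_def Let_def vector_6_line del: vector_ssub_ldistrib)
qed

lemma S_terms_Re:
  assumes "k < 12" "1 \<le> p" "1 \<le> q" "1 \<le> a" "1 \<le> b" "1 \<le> c" "Re w > 1"
  shows "Re (vec_nth (snd (S_terms p q a b c w ! k)) i) > 5/6"
proof -
  have "k \<in> {0, 1, 2, 3, 4, 5, 6, 7, 8, 9, 10, 11}" by (rule less_12_cases[OF assms(1)])
  moreover have "real p > 5/6" "real q > 5/6" "real a > 5/6" "real b > 5/6" "real c > 5/6" "Re w > 5/6" using assms by auto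
  ultimately have "\<forall>i. Re (vec_nth (snd (S_terms p q a b c w ! k)) i) > 5/6"
    by (elim insertE emptyE; simp add: S_terms_def Let_def forall_6 vector_6)
  then show ?thesis by blast
qed

theorem theorem6p1:
  fixes G :: "complex ^ 6 \<Rightarrow> complex" and p q a b c :: nat and s :: complex
  assumes G: "is_zeta_SO6 G"
    and pos: "1 \<le> p" "1 \<le> q" "1 \<le> a" "1 \<le> b" "1 \<le> c"
    and regular_lhs: "\<forall>(k, z) \<in> set (S_terms p q a b c s). regular_at G z"
    and regular_rhs: "(\<lambda>w. (J0 p q a b c w + J2 p q a b c w) / 2) analytic_on {s}"
  shows "S_sum G p q a b c s = (J0 p q a b c s + J2 p q a b c s) / 2"
proof -
  define pt where "pt = (\<lambda>k w. snd (S_terms p q a b c w ! k))"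
  define sg where "sg = (\<lambda>k. fst (S_terms p q a b c 0 ! k))"
  define dir where "dir = (\<lambda>k. pt k 1 - pt k 0)"
  have line: "pt k w = pt k 0 + w *s dir k" if "k < 12" for k w
    unfolding pt_def dir_def by (rule S_terms_line(2)[OF that])
  have S: "S_sum G p q a b c w = (\<Sum>k<12. (-1) ^ sg k * G (pt k w))" for w
    unfolding S_sum_altdef pt_def sg_def by (rule sum.cong[OF refl]) (simp add: S_terms_line(1)[of _ p q a b c w])
  have half: "isCont G (pt k w)" if "k < 12" "Re w > 1" for k w
    unfolding pt_def by (rule SO6_zeta_isCont[OF G S_terms_Re[OF that(1) pos that(2)]])
  \<comment> \<open>On the half-plane Re w > 1 all exponent vectors lie in the region of
    \<open>SO6_zeta_isCont\<close>, so the lines contain the open set of continuity points that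
    \<open>meromorphic_vec_line\<close> requires.\<close>
  have "\<exists>H. H meromorphic_on UNIV \<and> (\<forall>w. isCont G (pt k w) \<longrightarrow> H w = G (pt k w))" if k: "k < 12" for k
  proof -
    have "\<exists>H. H meromorphic_on UNIV \<and> (\<forall>w. isCont G (pt k 0 + w *s dir k) \<longrightarrow> H w = G (pt k 0 + w *s dir k))"
    proof (rule meromorphic_vec_line[where W = "{w. Re w > 1}"])
      show "meromorphic_vec G" using G unfolding is_zeta_SO6_def by blast
      show "open {w. Re w > 1}" by (rule open_halfspace_Re_gt)
      have "2 \<in> {w. Re w > 1}" by simp
      then show "{w. Re w > 1} \<noteq> {}" by blast
      show "isCont G (pt k 0 + w *s dir k)" if "w \<in> {w. Re w > 1}" for w
        using half[OF k, of w] that unfolding line[OF k, symmetric] by blast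
    qed
    then show ?thesis unfolding line[OF k, symmetric] .
  qed
  then obtain H where H: "\<And>k. k < 12 \<Longrightarrow> H k meromorphic_on UNIV"
      "\<And>k w. k < 12 \<Longrightarrow> isCont G (pt k w) \<Longrightarrow> H k w = G (pt k w)"
    by metis
  \<comment> \<open>A meromorphic stand-in for the left-hand side; it agrees with
    \<open>S_sum\<close> wherever \<open>G\<close> is continuous at all twelve points.\<close>
  define L where "L = (\<lambda>w. \<Sum>k<12. (-1) ^ sg k * H k w)"
  define R where "R = (\<lambda>w. (J0 p q a b c w + J2 p q a b c w) / 2)"
  have LS: "L w = S_sum G p q a b c w" if "\<And>k. k < 12 \<Longrightarrow> isCont G (pt k w)" for w
    unfolding L_def S using H(2) that by (intro sum.cong refl) auto
  have Lm: "L meromorphic_on UNIV" unfolding L_def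
    by (intro meromorphic_on_sum meromorphic_on_mult meromorphic_on_const H(1)) auto
  have Rm: "R meromorphic_on UNIV" unfolding R_def J0_eq_R_gen J2_eq_R_gen
    by (intro meromorphic_intros R_gen_meromorphic pos) auto
  have LR: "L w = R w" if "Re w > 1" for w
    using LS[OF half[OF _ that]] S_sum_eq_halfplane[OF G pos that] by (simp add: R_def)
  \<comment> \<open>The identity theorem gives equality near \<open>s\<close> but not at
    \<open>s\<close> itself, where both functions could still differ.\<close>
  have ev: "eventually (\<lambda>w. L w = R w) (at s)"
    by (rule meromorphic_eq_halfplane[OF Lm Rm LR])
  have reg: "regular_at G (pt k s)" if "k < 12" for k
  proof -
    have "S_terms p q a b c s ! k \<in> set (S_terms p q a b c s)"
      using that by (simp add: length_S_terms)
    moreover obtain r z where "S_terms p q a b c s ! k = (r, z)" by (cases "S_terms p q a b c s ! k")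
    ultimately show ?thesis using regular_lhs unfolding pt_def by auto
  qed
  have tend: "(pt k \<longlongrightarrow> pt k s) (nhds s)" if k: "k < 12" for k
  proof -
    have "((\<lambda>w. pt k 0 + w *s dir k) \<longlongrightarrow> pt k 0 + s *s dir k) (nhds s)"
      by (intro tendsto_intros bounded_linear.tendsto[OF bounded_linear_vector_scalar_mult] filterlim_ident)
    then show ?thesis unfolding line[OF k, symmetric] .
  qed
  \<comment> \<open>Regularity is an open condition in the space of exponents, so it yields
    continuity of \<open>G\<close> at the exponent vectors for all parameters near
    \<open>s\<close>.\<close>
  have "eventually (\<lambda>w. isCont G (pt k w)) (nhds s)" if k: "k < 12" for k
    using regular_at_imp_eventually_isCont[OF reg[OF k]] tend[OF k] by (rule eventually_compose_filterlim)
  then have "eventually (\<lambda>w. \<forall>k\<in>{..<12}. isCont G (pt k w)) (nhds s)"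
    by (intro eventually_ball_finite) auto
  then have "eventually (\<lambda>w. \<forall>k\<in>{..<12}. isCont G (pt k w)) (at s)"
    by (simp add: eventually_at_filter eventually_mono)
  with ev have ev2: "eventually (\<lambda>w. S_sum G p q a b c w = R w) (at s)"
    by eventually_elim (use LS in force)
  \<comment> \<open>Both sides are continuous at \<open>s\<close>, so the equality in a punctured
    neighbourhood extends to \<open>s\<close>.\<close>
  have "((\<lambda>w. S_sum G p q a b c w) \<longlongrightarrow> S_sum G p q a b c s) (at s)"
    unfolding S
  proof (intro tendsto_sum tendsto_mult tendsto_const)
    fix k :: nat assume "k \<in> {..<12}"
    then have k: "k < 12" by simp
    have "isCont G (pt k s)"
      using regular_at_imp_eventually_isCont[OF reg[OF k]] by (rule eventually_nhds_x_imp_x)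
    moreover have "(pt k \<longlongrightarrow> pt k s) (at s)"
      by (rule tendsto_mono[OF at_within_le_nhds tend[OF k]])
    ultimately show "((\<lambda>w. G (pt k w)) \<longlongrightarrow> G (pt k s)) (at s)" by (rule isCont_tendsto_compose)
  qed
  then have "(R \<longlongrightarrow> S_sum G p q a b c s) (at s)" by (rule Lim_transform_eventually[OF _ ev2])
  moreover have "(R \<longlongrightarrow> R s) (at s)"
    using regular_rhs unfolding R_def[symmetric] by (intro isContD analytic_at_imp_isCont)
  ultimately have "S_sum G p q a b c s = R s" by (rule tendsto_unique[OF at_neq_bot])
  then show ?thesis by (simp add: R_def)
qed

end
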